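(* Let $R$ be a unital commutative ring, $\mathscr{O}$ a reduced operad in $R$-modules and $V$ a free $R$-module of finite rank. Then the generalized divergence $$\mathsf{Div}^{\mathscr{O}}_V : \mathrm{Der}(\mathscr{O}(V)) \longrightarrow |\mathrm{Der}_\bullet(\mathscr{O}(R\oplus V))|$$ is a $1$-cocycle for the Lie algebra $\mathrm{Der}(\mathscr{O}(V))$ with values in the right $\mathrm{Der}(\mathscr{O}(V))$-module $|\mathrm{Der}_\bullet(\mathscr{O}(R\oplus V))|$; that is, for all $d,e\in \mathrm{Der}(\mathscr{O}(V))$, $$\mathsf{Div}^{\mathscr{O}}_V([d,e]) = \mathsf{Div}^{\mathscr{O}}_V(d)\cdot e - \mathsf{Div}^{\mathscr{O}}_V(e)\cdot d .$$
   Context: Operads are symmetric operads in $R$-modules; $\mathscr{O}$ is reduced if $\mathscr{O}(0)=0$. Write $\otimes=\otimes_R$. Free algebras. For an $R$-module $V$, $\mathscr{O}(V)=\bigoplus_n \mathscr{O}_n(V)$ with $\mathscr{O}_n(V)=\mathscr{O}(n)\otimes_{\mathfrak{S}_n}V^{\otimes n}$ is the free $\mathscr{O}$-algebra on $V$. For $R$-modules $V,W$, $\mathscr{O}(V;W)=\bigoplus_{n\ge 1}\mathscr{O}(n)\otimes_{\mathfrak{S}_{n-1}}(V^{\otimes n-1}\otimes W)$ is the direct summand of $\mathscr{O}(V\oplus W)$ of terms linear in $W$. Derivations. For $V$ free of finite rank, $\mathrm{Der}(\mathscr{O}(V))$ is the $R$-module of derivations of the $\mathscr{O}$-algebra $\mathscr{O}(V)$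 (with values in itself), i.e. $R$-linear maps $d$ with $d(\mu(a_1,\dots,a_n))=\sum_i\mu(a_1,\dots,d(a_i),\dots,a_n)$ for $\mu\in\mathscr{O}(n)$. Restriction to generators gives $\mathrm{Der}(\mathscr{O}(V))\cong\mathrm{Hom}_R(V,\mathscr{O}(V))\cong \mathscr{O}(V)\otimes V^\sharp$, with $V^\sharp=\mathrm{Hom}_R(V,R)$ and $x\otimes f$ corresponding to $v\mapsto f(v)x$. For $d,e\in\mathrm{Der}(\mathscr{O}(V))$, $d\lhd e$ is the derivation with $(d\lhd e)|_V=e\circ(d|_V)$; this is a preLie (right symmetric) product, and $[d,e]=d\lhd e-e\lhd d$ is the Lie bracket on $\mathrm{Der}(\mathscr{O}(V))$. Pointed derivations. $\mathrm{Der}_\bullet(\mathscr{O}(R\oplus V)):=\mathrm{Hom}_R(R,\mathscr{O}(V;R))\cong\mathscr{O}(V;R)$, regarded as a submodule of $\mathrm{Der}(\mathscr{O}(R\oplus V))\cong\mathrm{Hom}_R(R\oplus V,\mathscr{O}(R\oplus V))$ via the projection $R\oplus V\twoheadrightarrow R$ and the inclusion $\mathscr{O}(V;R)\subset\mathscr{O}(R\oplus V)$. The product $\lhd$ of $\mathrm{Der}(\mathscr{O}(R\oplus V))$ restricts to an associative unital product on it. For an associative algebra $A$, $|A|=A/[A,A]$, where $[A,A]$ is the $R$-submodule generated by commutators. Action. $\mathrm{Der}(\mathscr{O}(V))$ embeds in $\mathrm{Der}(\mathscr{O}(R\oplus V))$ by sending $e$ to the derivation which is $0$ on $R$ and equals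 $e|_V$ (followed by $\mathscr{O}(V)\subset\mathscr{O}(R\oplus V)$) on $V$. Then $x\cdot e:=x\lhd e$ defines a right action of the Lie algebra $\mathrm{Der}(\mathscr{O}(V))$ on $\mathrm{Der}_\bullet(\mathscr{O}(R\oplus V))$, which passes to $|\mathrm{Der}_\bullet(\mathscr{O}(R\oplus V))|$. Generalized contraction and divergence. Let $\delta_V:\mathscr{O}(V)\to\mathscr{O}(V;V)$ be the natural map sending $\mu(v_1,\dots,v_n)$ to $\sum_{i}\mu(v_1,\dots,\overline{v_i},\dots,v_n)$, where $\overline{v_i}$ denotes $v_i$ placed in the second (linear) argument. The contraction $\Phi^{\mathscr{O}}_V:\mathrm{Der}(\mathscr{O}(V))\cong\mathscr{O}(V)\otimes V^\sharp\to\mathscr{O}(V;R)\cong\mathrm{Der}_\bullet(\mathscr{O}(R\oplus V))$ is $x\otimes f\mapsto\mathscr{O}(V;f)(\delta_V(x))$. The generalized divergence $\mathsf{Div}^{\mathscr{O}}_V$ is the composite of $\Phi^{\mathscr{O}}_V$ with the quotient map to $|\mathrm{Der}_\bullet(\mathscr{O}(R\oplus V))|$. *)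

theory Defs
  imports
    "HOL-Library.Poly_Mapping"
    "HOL-Library.Set_Algebras"
    "HOL-Library.FuncSet"
    "HOL-Combinatorics.Permutations"
    "HOL-Analysis.Product_Vector"
begin

section \<open>Symmetric operads in modules over a commutative ring\<close>

text \<open>
  The modules \<open>\<O>(n)\<close> are given as submodules \<open>ops P n\<close> of one ambient module; this is no loss,
  since an arbitrary family can be placed in its direct sum. The submodules for different \<open>n\<close> may
  overlap, so the arity of an operation is always carried along explicitly:
  \<open>oact P n \<mu> \<sigma>\<close> is \<open>\<mu>\<sigma>\<close> for \<open>\<mu> \<in> \<O>(n)\<close> and a permutation \<open>\<sigma>\<close> of \<open>{..<n}\<close>, and
  \<open>ocomp P \<mu> [(k\<^sub>1,\<nu>\<^sub>1),\<dots>,(k\<^sub>n,\<nu>\<^sub>n)]\<close> is \<open>\<gamma>(\<mu>; \<nu>\<^sub>1,\<dots>,\<nu>\<^sub>n)\<close> for \<open>\<mu> \<in> \<O>(n)\<close> and \<open>\<nu>\<^sub>i \<in> \<O>(k\<^sub>i)\<close>.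
\<close>

record ('r, 'o) operad_data =
  ops :: "nat \<Rightarrow> 'o set"
  oscale :: "'r \<Rightarrow> 'o \<Rightarrow> 'o"
  oact :: "nat \<Rightarrow> 'o \<Rightarrow> (nat \<Rightarrow> nat) \<Rightarrow> 'o"
  ocomp :: "'o \<Rightarrow> (nat \<times> 'o) list \<Rightarrow> 'o"
  ounit :: "'o"

text \<open>
  Indices start at 0. The right action is normalised by
  \<open>(\<mu>\<sigma>)(v\<^bsub>\<sigma> 0\<^esub>, \<dots>, v\<^bsub>\<sigma> (n-1)\<^esub>) = \<mu>(v\<^sub>0, \<dots>, v\<^bsub>n-1\<^esub>)\<close>, that is,
  \<open>(\<mu>\<sigma>)(permute_list \<sigma> v) = \<mu>(v)\<close>.

  \<open>index_blocks [k\<^sub>1,\<dots>,k\<^sub>n]\<close> cuts \<open>[0..<k\<^sub>1 + \<dots> + k\<^sub>n]\<close> into consecutive blocks of these lengths.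
  With the normalisation above, \<open>block_perm \<sigma> ks\<close> moves the blocks as \<open>\<sigma>\<close> does without changing
  them internally, and \<open>sum_perm [\<tau>\<^sub>1,\<dots>,\<tau>\<^sub>n] ks\<close> is the block sum of the \<open>\<tau>\<^sub>i\<close>.
\<close>

definition index_blocks :: "nat list \<Rightarrow> nat list list" where
  "index_blocks ks =
     map (\<lambda>i. [sum_list (take i ks) ..< sum_list (take (Suc i) ks)]) [0..<length ks]"

definition list_fun :: "nat list \<Rightarrow> nat \<Rightarrow> nat" where
  "list_fun js j = (if j < length js then js ! j else j)"

definition block_perm :: "(nat \<Rightarrow> nat) \<Rightarrow> nat list \<Rightarrow> nat \<Rightarrow> nat" where
  "block_perm \<sigma> ks = list_fun (concat (permute_list \<sigma> (index_blocks ks)))"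

definition sum_perm :: "(nat \<Rightarrow> nat) list \<Rightarrow> nat list \<Rightarrow> nat \<Rightarrow> nat" where
  "sum_perm \<tau>s ks = list_fun (concat (map2 permute_list \<tau>s (index_blocks ks)))"

definition inputs :: "('r, 'o) operad_data \<Rightarrow> (nat \<times> 'o) list \<Rightarrow> bool" where
  "inputs P ps \<longleftrightarrow> (\<forall>(k, \<nu>) \<in> set ps. \<nu> \<in> ops P k)"

definition total :: "(nat \<times> 'o) list \<Rightarrow> nat" where
  "total ps = sum_list (map fst ps)"

locale operad =
  fixes P :: "('r::comm_ring_1, 'o::ab_group_add) operad_data"
  assumes module: "module (oscale P)"
    and subspace: "module.subspace (oscale P) (ops P n)"
    and act_closed: "\<lbrakk>\<mu> \<in> ops P n; \<sigma> permutes {..<n}\<rbrakk> \<Longrightarrow> oact P n \<mu> \<sigma> \<in> ops P n"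
    and act_id: "\<mu> \<in> ops P n \<Longrightarrow> oact P n \<mu> id = \<mu>"
    and act_act: "\<lbrakk>\<mu> \<in> ops P n; \<sigma> permutes {..<n}; \<tau> permutes {..<n}\<rbrakk>
      \<Longrightarrow> oact P n (oact P n \<mu> \<sigma>) \<tau> = oact P n \<mu> (\<sigma> \<circ> \<tau>)"
    and act_add: "\<lbrakk>\<mu> \<in> ops P n; \<nu> \<in> ops P n; \<sigma> permutes {..<n}\<rbrakk>
      \<Longrightarrow> oact P n (\<mu> + \<nu>) \<sigma> = oact P n \<mu> \<sigma> + oact P n \<nu> \<sigma>"
    and act_scale: "\<lbrakk>\<mu> \<in> ops P n; \<sigma> permutes {..<n}\<rbrakk>
      \<Longrightarrow> oact P n (oscale P r \<mu>) \<sigma> = oscale P r (oact P n \<mu> \<sigma>)"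
    and comp_closed: "\<lbrakk>\<mu> \<in> ops P (length ps); inputs P ps\<rbrakk> \<Longrightarrow> ocomp P \<mu> ps \<in> ops P (total ps)"
    and comp_add_left: "\<lbrakk>\<mu> \<in> ops P (length ps); \<mu>' \<in> ops P (length ps); inputs P ps\<rbrakk>
      \<Longrightarrow> ocomp P (\<mu> + \<mu>') ps = ocomp P \<mu> ps + ocomp P \<mu>' ps"
    and comp_scale_left: "\<lbrakk>\<mu> \<in> ops P (length ps); inputs P ps\<rbrakk>
      \<Longrightarrow> ocomp P (oscale P r \<mu>) ps = oscale P r (ocomp P \<mu> ps)"
    and comp_add_right: "\<lbrakk>\<mu> \<in> ops P (length ps + 1 + length qs); inputs P ps; inputs P qs;
        \<nu> \<in> ops P k; \<nu>' \<in> ops P k\<rbrakk>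
      \<Longrightarrow> ocomp P \<mu> (ps @ (k, \<nu> + \<nu>') # qs) =
          ocomp P \<mu> (ps @ (k, \<nu>) # qs) + ocomp P \<mu> (ps @ (k, \<nu>') # qs)"
    and comp_scale_right: "\<lbrakk>\<mu> \<in> ops P (length ps + 1 + length qs); inputs P ps; inputs P qs;
        \<nu> \<in> ops P k\<rbrakk>
      \<Longrightarrow> ocomp P \<mu> (ps @ (k, oscale P r \<nu>) # qs) = oscale P r (ocomp P \<mu> (ps @ (k, \<nu>) # qs))"
    and unit_closed: "ounit P \<in> ops P 1"
    and unit_left: "\<mu> \<in> ops P n \<Longrightarrow> ocomp P (ounit P) [(n, \<mu>)] = \<mu>"
    and unit_right: "\<mu> \<in> ops P n \<Longrightarrow> ocomp P \<mu> (replicate n (1, ounit P)) = \<mu>"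
    and comp_assoc: "\<lbrakk>\<mu> \<in> ops P (length ts);
        \<And>\<nu> qs. (\<nu>, qs) \<in> set ts \<Longrightarrow> \<nu> \<in> ops P (length qs) \<and> inputs P qs\<rbrakk>
      \<Longrightarrow> ocomp P (ocomp P \<mu> (map (\<lambda>(\<nu>, qs). (length qs, \<nu>)) ts)) (concat (map snd ts)) =
          ocomp P \<mu> (map (\<lambda>(\<nu>, qs). (total qs, ocomp P \<nu> qs)) ts)"
    and comp_act_left: "\<lbrakk>\<mu> \<in> ops P (length ps); inputs P ps; \<sigma> permutes {..<length ps}\<rbrakk>
      \<Longrightarrow> ocomp P (oact P (length ps) \<mu> \<sigma>) (permute_list \<sigma> ps) =
          oact P (total ps) (ocomp P \<mu> ps) (block_perm \<sigma> (map fst ps))"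
    and comp_act_right: "\<lbrakk>\<mu> \<in> ops P (length ps); inputs P ps; length \<tau>s = length ps;
        \<And>i. i < length ps \<Longrightarrow> \<tau>s ! i permutes {..<fst (ps ! i)}\<rbrakk>
      \<Longrightarrow> ocomp P \<mu> (map2 (\<lambda>(k, \<nu>) \<tau>. (k, oact P k \<nu> \<tau>)) ps \<tau>s) =
          oact P (total ps) (ocomp P \<mu> ps) (sum_perm \<tau>s (map fst ps))"

definition reduced :: "('r, 'o::zero) operad_data \<Rightarrow> bool" where
  "reduced P \<longleftrightarrow> ops P 0 = {0}"

definition free_of_finite_rank :: "('r::comm_ring_1 \<Rightarrow> 'v::ab_group_add \<Rightarrow> 'v) \<Rightarrow> bool" where
  "free_of_finite_rank s \<longleftrightarrow> module s \<and>
     (\<exists>B. finite B \<and> \<not> module.dependent s B \<and> module.span s B = UNIV)"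


section \<open>Free algebras\<close>

text \<open>
  Below, a module \<open>U\<close> is represented by its scalar multiplication \<open>s\<close>.
  \<open>\<O>(U) = \<Oplus>\<^sub>n \<O>(n) \<otimes>\<^bsub>S(n)\<^esub> U\<^bsup>\<otimes>n\<^esup>\<close> is presented by generators \<open>gen \<mu> [u\<^sub>1,\<dots>,u\<^sub>n]\<close> with
  \<open>\<mu> \<in> \<O>(n)\<close>, standing for \<open>\<mu> \<otimes> u\<^sub>1 \<otimes> \<dots> \<otimes> u\<^sub>n\<close>, and relations: multilinearity and the
  identification of \<open>\<mu>\<sigma> \<otimes> v\<close> with \<open>\<mu> \<otimes> \<sigma>v\<close>. Its elements are cosets in the free module on the
  generators. Addition of cosets is the addition of sets of \<^theory>\<open>HOL-Library.Set_Algebras\<close>;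
  beware that \<open>A - B\<close> on sets is set difference, so subtraction of cosets is \<open>coset_diff\<close>,
  and that \<open>0\<close> is \<open>{0}\<close>, so a possibly empty sum of cosets has the zero coset \<open>rels P s\<close> added.
\<close>

type_synonym ('r, 'o, 'u) formal = "('o \<times> 'u list) \<Rightarrow>\<^sub>0 'r"

definition fscale :: "'r::comm_ring_1 \<Rightarrow> ('k \<Rightarrow>\<^sub>0 'r) \<Rightarrow> ('k \<Rightarrow>\<^sub>0 'r)" where
  "fscale r = Poly_Mapping.map ((*) r)"

lemma lookup_fscale [simp]: "Poly_Mapping.lookup (fscale r x) k = r * Poly_Mapping.lookup x k"
  by (simp add: fscale_def map.rep_eq when_def)

lemma module_fscale: "module fscale"
  by unfold_locales (simp_all add: poly_mapping_eq_iff fun_eq_iff lookup_add algebra_simps)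

definition lin_ext :: "('k \<Rightarrow> ('l \<Rightarrow>\<^sub>0 'r)) \<Rightarrow> ('k \<Rightarrow>\<^sub>0 'r::comm_ring_1) \<Rightarrow> ('l \<Rightarrow>\<^sub>0 'r)" where
  "lin_ext f x = (\<Sum>k\<in>Poly_Mapping.keys x. fscale (Poly_Mapping.lookup x k) (f k))"

definition gen :: "'o \<Rightarrow> 'u list \<Rightarrow> ('r::comm_ring_1, 'o, 'u) formal" where
  "gen \<mu> us = Poly_Mapping.single (\<mu>, us) 1"

definition formals :: "('r::comm_ring_1, 'o) operad_data \<Rightarrow> ('r, 'o, 'u) formal set" where
  "formals P = {x. \<forall>(\<mu>, us) \<in> Poly_Mapping.keys x. \<mu> \<in> ops P (length us)}"

inductive_set tensor_rels ::
    "('r::comm_ring_1, 'o::ab_group_add) operad_data \<Rightarrow> ('r \<Rightarrow> 'u::ab_group_add \<Rightarrow> 'u)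
      \<Rightarrow> ('r, 'o, 'u) formal set"
  for P s where
  "\<lbrakk>\<mu> \<in> ops P (length us); \<nu> \<in> ops P (length us)\<rbrakk>
    \<Longrightarrow> gen (\<mu> + \<nu>) us - gen \<mu> us - gen \<nu> us \<in> tensor_rels P s"
| "\<mu> \<in> ops P (length us) \<Longrightarrow> gen (oscale P r \<mu>) us - fscale r (gen \<mu> us) \<in> tensor_rels P s"
| "\<mu> \<in> ops P (length us + 1 + length ws)
    \<Longrightarrow> gen \<mu> (us @ (v + v') # ws) - gen \<mu> (us @ v # ws) - gen \<mu> (us @ v' # ws) \<in> tensor_rels P s"
| "\<mu> \<in> ops P (length us + 1 + length ws)
    \<Longrightarrow> gen \<mu> (us @ s r v # ws) - fscale r (gen \<mu> (us @ v # ws)) \<in> tensor_rels P s"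
| "\<lbrakk>\<mu> \<in> ops P (length us); \<sigma> permutes {..<length us}\<rbrakk>
    \<Longrightarrow> gen (oact P (length us) \<mu> \<sigma>) (permute_list \<sigma> us) - gen \<mu> us \<in> tensor_rels P s"

definition rels ::
    "('r::comm_ring_1, 'o::ab_group_add) operad_data \<Rightarrow> ('r \<Rightarrow> 'u::ab_group_add \<Rightarrow> 'u)
      \<Rightarrow> ('r, 'o, 'u) formal set" where
  "rels P s = module.span fscale (tensor_rels P s)"

definition cls ::
    "('r::comm_ring_1, 'o::ab_group_add) operad_data \<Rightarrow> ('r \<Rightarrow> 'u::ab_group_add \<Rightarrow> 'u)
      \<Rightarrow> ('r, 'o, 'u) formal \<Rightarrow> ('r, 'o, 'u) formal set" where
  "cls P s x = x +o rels P s"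

definition free_alg ::
    "('r::comm_ring_1, 'o::ab_group_add) operad_data \<Rightarrow> ('r \<Rightarrow> 'u::ab_group_add \<Rightarrow> 'u)
      \<Rightarrow> ('r, 'o, 'u) formal set set" where
  "free_alg P s = cls P s ` formals P"

definition coset_diff :: "'m::ab_group_add set \<Rightarrow> 'm set \<Rightarrow> 'm set" where
  "coset_diff A B = {a - b | a b. a \<in> A \<and> b \<in> B}"

definition coset_scale ::
    "('r::comm_ring_1, 'o::ab_group_add) operad_data \<Rightarrow> ('r \<Rightarrow> 'u::ab_group_add \<Rightarrow> 'u)
      \<Rightarrow> 'r \<Rightarrow> ('r, 'o, 'u) formal set \<Rightarrow> ('r, 'o, 'u) formal set" where
  "coset_scale P s r A = fscale r ` A + rels P s"

definition incl ::
    "('r::comm_ring_1, 'o::ab_group_add) operad_data \<Rightarrow> ('r \<Rightarrow> 'u::ab_group_add \<Rightarrow> 'u)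
      \<Rightarrow> 'u \<Rightarrow> ('r, 'o, 'u) formal set" where
  "incl P s u = cls P s (gen (ounit P) [u])"

text \<open>
  The \<open>\<O>\<close>-algebra structure: \<open>\<mu>(a\<^sub>1,\<dots>,a\<^sub>n)\<close> is the multilinear extension of
  \<open>\<mu>(\<nu>\<^sub>1 \<otimes> v\<^sub>1, \<dots>, \<nu>\<^sub>n \<otimes> v\<^sub>n) = \<gamma>(\<mu>; \<nu>\<^sub>1,\<dots>,\<nu>\<^sub>n) \<otimes> v\<^sub>1 \<otimes> \<dots> \<otimes> v\<^sub>n\<close> (each \<open>v\<^sub>i\<close> a tensor), first on
  formal sums and then on cosets.
\<close>

definition formal_op ::
    "('r::comm_ring_1, 'o) operad_data \<Rightarrow> 'o \<Rightarrow> ('r, 'o, 'u) formal list \<Rightarrow> ('r, 'o, 'u) formal" where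
  "formal_op P \<mu> xs =
     (\<Sum>g \<in> listset (map Poly_Mapping.keys xs).
        fscale (\<Prod>i<length xs. Poly_Mapping.lookup (xs ! i) (g ! i))
          (gen (ocomp P \<mu> (map (\<lambda>(\<nu>, vs). (length vs, \<nu>)) g)) (concat (map snd g))))"

definition free_op ::
    "('r::comm_ring_1, 'o::ab_group_add) operad_data \<Rightarrow> ('r \<Rightarrow> 'u::ab_group_add \<Rightarrow> 'u)
      \<Rightarrow> 'o \<Rightarrow> ('r, 'o, 'u) formal set list \<Rightarrow> ('r, 'o, 'u) formal set" where
  "free_op P s \<mu> As = formal_op P \<mu> ` listset As + rels P s"

text \<open>The map \<open>\<O>(h) : \<O>(U) \<rightarrow> \<O>(W)\<close> induced by a linear map \<open>h : U \<rightarrow> W\<close>, where \<open>t\<close> is the scalar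
  multiplication of \<open>W\<close>.\<close>

definition free_map ::
    "('r::comm_ring_1, 'o::ab_group_add) operad_data \<Rightarrow> ('r \<Rightarrow> 'w::ab_group_add \<Rightarrow> 'w)
      \<Rightarrow> ('u \<Rightarrow> 'w) \<Rightarrow> ('r, 'o, 'u) formal set \<Rightarrow> ('r, 'o, 'w) formal set" where
  "free_map P t h A = lin_ext (\<lambda>(\<mu>, us). gen \<mu> (map h us)) ` A + rels P t"


section \<open>Derivations\<close>

type_synonym ('r, 'o, 'u) endo = "('r, 'o, 'u) formal set \<Rightarrow> ('r, 'o, 'u) formal set"

definition Der ::
    "('r::comm_ring_1, 'o::ab_group_add) operad_data \<Rightarrow> ('r \<Rightarrow> 'u::ab_group_add \<Rightarrow> 'u)
      \<Rightarrow> ('r, 'o, 'u) endo set" where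
  "Der P s = {d \<in> free_alg P s \<rightarrow>\<^sub>E free_alg P s.
     (\<forall>A\<in>free_alg P s. \<forall>B\<in>free_alg P s. d (A + B) = d A + d B) \<and>
     (\<forall>r. \<forall>A\<in>free_alg P s. d (coset_scale P s r A) = coset_scale P s r (d A)) \<and>
     (\<forall>\<mu> As. \<mu> \<in> ops P (length As) \<and> set As \<subseteq> free_alg P s \<longrightarrow>
        d (free_op P s \<mu> As) = rels P s + (\<Sum>i<length As. free_op P s \<mu> (As[i := d (As ! i)])))}"

definition der_zero ::
    "('r::comm_ring_1, 'o::ab_group_add) operad_data \<Rightarrow> ('r \<Rightarrow> 'u::ab_group_add \<Rightarrow> 'u)
      \<Rightarrow> ('r, 'o, 'u) endo" where
  "der_zero P s = (\<lambda>A\<in>free_alg P s. rels P s)"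

definition der_add ::
    "('r::comm_ring_1, 'o::ab_group_add) operad_data \<Rightarrow> ('r \<Rightarrow> 'u::ab_group_add \<Rightarrow> 'u)
      \<Rightarrow> ('r, 'o, 'u) endo \<Rightarrow> ('r, 'o, 'u) endo \<Rightarrow> ('r, 'o, 'u) endo" where
  "der_add P s d e = (\<lambda>A\<in>free_alg P s. d A + e A)"

definition der_diff ::
    "('r::comm_ring_1, 'o::ab_group_add) operad_data \<Rightarrow> ('r \<Rightarrow> 'u::ab_group_add \<Rightarrow> 'u)
      \<Rightarrow> ('r, 'o, 'u) endo \<Rightarrow> ('r, 'o, 'u) endo \<Rightarrow> ('r, 'o, 'u) endo" where
  "der_diff P s d e = (\<lambda>A\<in>free_alg P s. coset_diff (d A) (e A))"

definition der_scale ::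
    "('r::comm_ring_1, 'o::ab_group_add) operad_data \<Rightarrow> ('r \<Rightarrow> 'u::ab_group_add \<Rightarrow> 'u)
      \<Rightarrow> 'r \<Rightarrow> ('r, 'o, 'u) endo \<Rightarrow> ('r, 'o, 'u) endo" where
  "der_scale P s r d = (\<lambda>A\<in>free_alg P s. coset_scale P s r (d A))"

definition der_of ::
    "('r::comm_ring_1, 'o::ab_group_add) operad_data \<Rightarrow> ('r \<Rightarrow> 'u::ab_group_add \<Rightarrow> 'u)
      \<Rightarrow> ('u \<Rightarrow> ('r, 'o, 'u) formal set) \<Rightarrow> ('r, 'o, 'u) endo" where
  "der_of P s \<phi> = (THE d. d \<in> Der P s \<and> (\<forall>u. d (incl P s u) = \<phi> u))"

definition pre_lie ::
    "('r::comm_ring_1, 'o::ab_group_add) operad_data \<Rightarrow> ('r \<Rightarrow> 'u::ab_group_add \<Rightarrow> 'u)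
      \<Rightarrow> ('r, 'o, 'u) endo \<Rightarrow> ('r, 'o, 'u) endo \<Rightarrow> ('r, 'o, 'u) endo" where
  "pre_lie P s d e = der_of P s (\<lambda>u. e (d (incl P s u)))"

definition der_bracket ::
    "('r::comm_ring_1, 'o::ab_group_add) operad_data \<Rightarrow> ('r \<Rightarrow> 'u::ab_group_add \<Rightarrow> 'u)
      \<Rightarrow> ('r, 'o, 'u) endo \<Rightarrow> ('r, 'o, 'u) endo \<Rightarrow> ('r, 'o, 'u) endo" where
  "der_bracket P s d e = der_diff P s (pre_lie P s d e) (pre_lie P s e d)"


section \<open>Pointed derivations\<close>

text \<open>
  \<open>\<O>(V;W)\<close> is realised as the submodule of terms linear in \<open>W\<close>; to match \<open>R \<oplus> V\<close>, the linear
  argument is always the first summand, so \<open>\<O>(V;W) \<subseteq> \<O>(W \<oplus> V)\<close>. The list \<open>marked vs i w\<close> is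
  \<open>v\<^sub>1,\<dots>,v\<^sub>n\<close> with the \<open>i\<close>-th entry replaced by \<open>w \<in> W\<close>. Both scalar multiplications are passed:
  \<open>t\<close> for \<open>W\<close> and \<open>s\<close> for \<open>V\<close>.
\<close>

definition marked :: "'v list \<Rightarrow> nat \<Rightarrow> 'w::zero \<Rightarrow> ('w \<times> 'v::zero) list" where
  "marked vs i w = (map (\<lambda>v. (0, v)) vs)[i := (w, 0)]"

definition free_lin ::
    "('r::comm_ring_1, 'o::ab_group_add) operad_data \<Rightarrow> ('r \<Rightarrow> 'w::ab_group_add \<Rightarrow> 'w)
      \<Rightarrow> ('r \<Rightarrow> 'v::ab_group_add \<Rightarrow> 'v) \<Rightarrow> ('r, 'o, 'w \<times> 'v) formal set set" where
  "free_lin P t s = cls P (module_prod.scale t s) `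
     {x \<in> formals P. \<forall>(\<mu>, us) \<in> Poly_Mapping.keys x. \<exists>vs i w. i < length vs \<and> us = marked vs i w}"

text \<open>The scalar multiplication of \<open>R \<oplus> V\<close>.\<close>

abbreviation scale1 :: "('r::comm_ring_1 \<Rightarrow> 'v::ab_group_add \<Rightarrow> 'v) \<Rightarrow> 'r \<Rightarrow> 'r \<times> 'v \<Rightarrow> 'r \<times> 'v" where
  "scale1 s \<equiv> module_prod.scale (*) s"

text \<open>
  Under \<open>Hom\<^sub>R(R, \<O>(V;R)) \<cong> \<O>(V;R)\<close>, the element \<open>x\<close> corresponds to the linear map \<open>r \<mapsto> r x\<close>,
  and hence to the derivation of \<open>\<O>(R \<oplus> V)\<close> with \<open>(r, v) \<mapsto> r x\<close> on generators.
\<close>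

definition pointed ::
    "('r::comm_ring_1, 'o::ab_group_add) operad_data \<Rightarrow> ('r \<Rightarrow> 'v::ab_group_add \<Rightarrow> 'v)
      \<Rightarrow> ('r, 'o, 'r \<times> 'v) formal set \<Rightarrow> ('r, 'o, 'r \<times> 'v) endo" where
  "pointed P s x = der_of P (scale1 s) (\<lambda>(r, v). coset_scale P (scale1 s) r x)"

definition Der_pt ::
    "('r::comm_ring_1, 'o::ab_group_add) operad_data \<Rightarrow> ('r \<Rightarrow> 'v::ab_group_add \<Rightarrow> 'v)
      \<Rightarrow> ('r, 'o, 'r \<times> 'v) endo set" where
  "Der_pt P s = {D \<in> Der P (scale1 s). \<exists>x \<in> free_lin P (*) s.
     \<forall>r v. D (incl P (scale1 s) (r, v)) = coset_scale P (scale1 s) r x}"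

inductive_set commutators ::
    "('r::comm_ring_1, 'o::ab_group_add) operad_data \<Rightarrow> ('r \<Rightarrow> 'v::ab_group_add \<Rightarrow> 'v)
      \<Rightarrow> ('r, 'o, 'r \<times> 'v) endo set"
  for P s where
  "\<lbrakk>D \<in> Der_pt P s; E \<in> Der_pt P s\<rbrakk> \<Longrightarrow>
     der_diff P (scale1 s) (pre_lie P (scale1 s) D E) (pre_lie P (scale1 s) E D) \<in> commutators P s"
| "der_zero P (scale1 s) \<in> commutators P s"
| "\<lbrakk>C \<in> commutators P s; C' \<in> commutators P s\<rbrakk> \<Longrightarrow> der_add P (scale1 s) C C' \<in> commutators P s"
| "C \<in> commutators P s \<Longrightarrow> der_scale P (scale1 s) r C \<in> commutators P s"

text \<open>The quotient \<open>|Der\<^sub>\<bullet>(\<O>(R \<oplus> V))|\<close> and its operations, again on cosets.\<close>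

definition tr_cls ::
    "('r::comm_ring_1, 'o::ab_group_add) operad_data \<Rightarrow> ('r \<Rightarrow> 'v::ab_group_add \<Rightarrow> 'v)
      \<Rightarrow> ('r, 'o, 'r \<times> 'v) endo \<Rightarrow> ('r, 'o, 'r \<times> 'v) endo set" where
  "tr_cls P s D = der_add P (scale1 s) D ` commutators P s"

definition Tr ::
    "('r::comm_ring_1, 'o::ab_group_add) operad_data \<Rightarrow> ('r \<Rightarrow> 'v::ab_group_add \<Rightarrow> 'v)
      \<Rightarrow> ('r, 'o, 'r \<times> 'v) endo set set" where
  "Tr P s = tr_cls P s ` Der_pt P s"

definition tr_add ::
    "('r::comm_ring_1, 'o::ab_group_add) operad_data \<Rightarrow> ('r \<Rightarrow> 'v::ab_group_add \<Rightarrow> 'v)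
      \<Rightarrow> ('r, 'o, 'r \<times> 'v) endo set \<Rightarrow> ('r, 'o, 'r \<times> 'v) endo set \<Rightarrow> ('r, 'o, 'r \<times> 'v) endo set" where
  "tr_add P s X Y = {der_add P (scale1 s) D E | D E. D \<in> X \<and> E \<in> Y}"

definition tr_diff ::
    "('r::comm_ring_1, 'o::ab_group_add) operad_data \<Rightarrow> ('r \<Rightarrow> 'v::ab_group_add \<Rightarrow> 'v)
      \<Rightarrow> ('r, 'o, 'r \<times> 'v) endo set \<Rightarrow> ('r, 'o, 'r \<times> 'v) endo set \<Rightarrow> ('r, 'o, 'r \<times> 'v) endo set" where
  "tr_diff P s X Y = {der_diff P (scale1 s) D E | D E. D \<in> X \<and> E \<in> Y}"

definition tr_scale ::
    "('r::comm_ring_1, 'o::ab_group_add) operad_data \<Rightarrow> ('r \<Rightarrow> 'v::ab_group_add \<Rightarrow> 'v)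
      \<Rightarrow> 'r \<Rightarrow> ('r, 'o, 'r \<times> 'v) endo set \<Rightarrow> ('r, 'o, 'r \<times> 'v) endo set" where
  "tr_scale P s r X = (\<Union>D\<in>X. tr_cls P s (der_scale P (scale1 s) r D))"

text \<open>The embedding \<open>Der(\<O>(V)) \<rightarrow> Der(\<O>(R \<oplus> V))\<close>, and the right action of \<open>Der(\<O>(V))\<close>.\<close>

definition der_ext ::
    "('r::comm_ring_1, 'o::ab_group_add) operad_data \<Rightarrow> ('r \<Rightarrow> 'v::ab_group_add \<Rightarrow> 'v)
      \<Rightarrow> ('r, 'o, 'v) endo \<Rightarrow> ('r, 'o, 'r \<times> 'v) endo" where
  "der_ext P s e =
     der_of P (scale1 s) (\<lambda>(r, v). free_map P (scale1 s) (\<lambda>v. (0, v)) (e (incl P s v)))"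

definition tr_act ::
    "('r::comm_ring_1, 'o::ab_group_add) operad_data \<Rightarrow> ('r \<Rightarrow> 'v::ab_group_add \<Rightarrow> 'v)
      \<Rightarrow> ('r, 'o, 'r \<times> 'v) endo set \<Rightarrow> ('r, 'o, 'v) endo \<Rightarrow> ('r, 'o, 'r \<times> 'v) endo set" where
  "tr_act P s X e = (\<Union>D\<in>X. tr_cls P s (pre_lie P (scale1 s) D (der_ext P s e)))"


section \<open>Contraction and divergence\<close>

text \<open>\<open>\<delta>\<^sub>V : \<O>(V) \<rightarrow> \<O>(V;V) \<subseteq> \<O>(V \<oplus> V)\<close>\<close>

definition mark ::
    "('r::comm_ring_1, 'o::ab_group_add) operad_data \<Rightarrow> ('r \<Rightarrow> 'v::ab_group_add \<Rightarrow> 'v)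
      \<Rightarrow> ('r, 'o, 'v) formal set \<Rightarrow> ('r, 'o, 'v \<times> 'v) formal set" where
  "mark P s A = lin_ext (\<lambda>(\<mu>, vs). \<Sum>i<length vs. gen \<mu> (marked vs i (vs ! i))) ` A
     + rels P (module_prod.scale s s)"

text \<open>
  \<open>x \<otimes> f \<mapsto> \<O>(V;f)(\<delta>\<^sub>V(x))\<close>, where \<open>\<O>(V;f)\<close> is the restriction of \<open>\<O>(f \<oplus> id)\<close>. A derivation \<open>d\<close>
  corresponds to \<open>x\<^sub>1 \<otimes> f\<^sub>1 + \<dots> + x\<^sub>m \<otimes> f\<^sub>m\<close> if \<open>d(v) = f\<^sub>1(v) x\<^sub>1 + \<dots> + f\<^sub>m(v) x\<^sub>m\<close> for all \<open>v \<in> V\<close>.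
\<close>

definition contract_pure ::
    "('r::comm_ring_1, 'o::ab_group_add) operad_data \<Rightarrow> ('r \<Rightarrow> 'v::ab_group_add \<Rightarrow> 'v)
      \<Rightarrow> ('r, 'o, 'v) formal set \<Rightarrow> ('v \<Rightarrow> 'r) \<Rightarrow> ('r, 'o, 'r \<times> 'v) formal set" where
  "contract_pure P s x f = free_map P (scale1 s) (map_prod f id) (mark P s x)"

definition represents ::
    "('r::comm_ring_1, 'o::ab_group_add) operad_data \<Rightarrow> ('r \<Rightarrow> 'v::ab_group_add \<Rightarrow> 'v)
      \<Rightarrow> (('r, 'o, 'v) formal set \<times> ('v \<Rightarrow> 'r)) list \<Rightarrow> ('r, 'o, 'v) endo \<Rightarrow> bool" where
  "represents P s ts d \<longleftrightarrow>
     (\<forall>(x, f) \<in> set ts. x \<in> free_alg P s \<and> module_hom s (*) f) \<and>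
     (\<forall>v. d (incl P s v) = rels P s + (\<Sum>(x, f)\<leftarrow>ts. coset_scale P s (f v) x))"

definition contraction ::
    "('r::comm_ring_1, 'o::ab_group_add) operad_data \<Rightarrow> ('r \<Rightarrow> 'v::ab_group_add \<Rightarrow> 'v)
      \<Rightarrow> ('r, 'o, 'v) endo \<Rightarrow> ('r, 'o, 'r \<times> 'v) formal set" where
  "contraction P s d = (THE y. \<exists>ts. represents P s ts d \<and>
     y = rels P (scale1 s) + (\<Sum>(x, f)\<leftarrow>ts. contract_pure P s x f))"

definition Div ::
    "('r::comm_ring_1, 'o::ab_group_add) operad_data \<Rightarrow> ('r \<Rightarrow> 'v::ab_group_add \<Rightarrow> 'v)
      \<Rightarrow> ('r, 'o, 'v) endo \<Rightarrow> ('r, 'o, 'r \<times> 'v) endo set" where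
  "Div P s d = tr_cls P s (pointed P s (contraction P s d))"

text \<open>
  A 1-cocycle of the Lie algebra \<open>Der(\<O>(V))\<close> with values in the right module
  \<open>|Der\<^sub>\<bullet>(\<O>(R \<oplus> V))|\<close> is an \<open>R\<close>-linear map satisfying the cocycle identity.
\<close>

definition one_cocycle ::
    "('r::comm_ring_1, 'o::ab_group_add) operad_data \<Rightarrow> ('r \<Rightarrow> 'v::ab_group_add \<Rightarrow> 'v)
      \<Rightarrow> (('r, 'o, 'v) endo \<Rightarrow> ('r, 'o, 'r \<times> 'v) endo set) \<Rightarrow> bool" where
  "one_cocycle P s c \<longleftrightarrow>
     c \<in> Der P s \<rightarrow> Tr P s \<and>
     (\<forall>d\<in>Der P s. \<forall>e\<in>Der P s. c (der_add P s d e) = tr_add P s (c d) (c e)) \<and>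
     (\<forall>r. \<forall>d\<in>Der P s. c (der_scale P s r d) = tr_scale P s r (c d)) \<and>
     (\<forall>d\<in>Der P s. \<forall>e\<in>Der P s.
        c (der_bracket P s d e) = tr_diff P s (tr_act P s (c d) e) (tr_act P s (c e) d))"

end

theory Submission
  imports Defs
begin

text \<open>The divergence is a sum of partial derivatives, and the cocycle identity is the chain rule for them.
Choose a finite basis \<open>B\<close> of \<open>V\<close> with dual basis \<open>b\<^sup>*\<close>. For \<open>f : V \<rightarrow> R\<close>, the map
\<open>\<partial>\<^sub>f : \<O>(V) \<rightarrow> \<O>(V;R)\<close> sends \<open>\<mu>(v\<^sub>1,\<dots>,v\<^sub>n)\<close> to \<open>\<Sum>\<^sub>i f(v\<^sub>i) \<mu>(v\<^sub>1,\<dots>,\<star>,\<dots>,v\<^sub>n)\<close>, where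
\<open>\<star>\<close> is the generator of \<open>R\<close>, placed in position \<open>i\<close>. Expanding linear forms in the dual basis shows that
the contraction of \<open>d\<close> is \<open>\<Sum>\<^sub>b \<partial>\<^sub>b(d b)\<close>, writing \<open>\<partial>\<^sub>b\<close> for \<open>\<partial>\<^sub>f\<close> with \<open>f = b\<^sup>*\<close>; in particular it does
not depend on how \<open>d\<close> is written as a sum of pure tensors \<open>x \<otimes> f\<close> (\<open>represents_div_formal\<close>).

In \<open>\<O>(V;R)\<close>, the product \<open>p \<odot> q\<close> inserts \<open>q\<close> for \<open>\<star>\<close> in \<open>p\<close>, and \<open>p \<cdot> e\<close> differentiates \<open>p\<close> with \<open>e\<close>
in the entries from \<open>V\<close>. If \<open>e(\<mu>(v\<^sub>1,\<dots>,v\<^sub>n)) = \<Sum>\<^sub>i \<mu>(v\<^sub>1,\<dots>,e(v\<^sub>i),\<dots>,v\<^sub>n)\<close> is differentiated once more,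
either \<open>\<partial>\<^sub>f\<close> hits an entry other than the \<open>i\<close>-th one, which gives \<open>\<partial>\<^sub>f(x) \<cdot> e\<close>, or it hits \<open>e(v\<^sub>i)\<close>, and
expanding \<open>v\<^sub>i\<close> in the basis gives the chain rule (\<open>contr_der_along\<close>)
\<open>\<partial>\<^sub>f(e x) = \<partial>\<^sub>f(x) \<cdot> e + \<Sum>\<^sub>a \<partial>\<^sub>a(x) \<odot> \<partial>\<^sub>f(e a)\<close>. Taking \<open>x = d(b)\<close>, \<open>f = b\<^sup>*\<close> and summing over \<open>b\<close>, the
contraction of \<open>d \<lhd> e\<close> is the contraction of \<open>d\<close> acted on by \<open>e\<close>, plus
\<open>\<Sum>\<^bsub>a,b\<^esub> \<partial>\<^sub>a(d b) \<odot> \<partial>\<^sub>b(e a)\<close>. Exchanging \<open>d\<close> and \<open>e\<close> in this double sum reverses each product, so in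
the contraction of \<open>[d,e]\<close> the double sums leave only commutators (\<open>div_formal_bracket\<close>), which vanish
in the quotient.

All computations take place on formal sums modulo the relations of the free algebra. One construction
serves throughout: the derivation \<open>der_along h \<phi>\<close> along the algebra map induced by a linear map \<open>h\<close>,
with prescribed values \<open>\<phi>\<close> on generators. For \<open>h = id\<close> these are the derivations of \<open>\<O>(V)\<close> and
\<open>\<O>(R \<oplus> V)\<close>; for the inclusion \<open>V \<subseteq> R \<oplus> V\<close> they include the \<open>\<partial>\<^sub>f\<close>. They respect the relations
(\<open>der_along_rels\<close>, where the equivariance of operadic composition enters), they satisfy the Leibniz rule
(\<open>der_along_formal_op\<close>, where associativity enters), and the commutator of two of them is again of this
form (\<open>der_along_commutator\<close>). The last fact yields both the chain rule and the compatibility of the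
action with \<open>\<odot>\<close>, by which the action descends to the quotient by commutators.\<close>

section \<open>Linear and multilinear maps on formal sums\<close>

interpretation fm: module "fscale :: 'r::comm_ring_1 \<Rightarrow> ('k \<Rightarrow>\<^sub>0 'r) \<Rightarrow> ('k \<Rightarrow>\<^sub>0 'r)"
  by (rule module_fscale)

abbreviation flinear :: "(('k \<Rightarrow>\<^sub>0 'r::comm_ring_1) \<Rightarrow> ('l \<Rightarrow>\<^sub>0 'r)) \<Rightarrow> bool" where
  "flinear \<equiv> module_hom fscale fscale"

lemma flinearI:
  assumes "\<And>x y. f (x + y) = f x + f y" and "\<And>r x. f (fscale r x) = fscale r (f x)"
  shows "flinear f"
  using assms by (intro module_hom.intro module_hom_axioms.intro module_fscale)

lemmas flinear_add = module_hom.add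
lemmas flinear_scale = module_hom.scale
lemmas flinear_diff = module_hom.diff
lemmas flinear_zero = module_hom.zero
lemmas flinear_sum = module_hom.sum

lemma flinear_id: "flinear (\<lambda>x. x)"
  by (rule flinearI) simp_all

lemma flinear_const_zero: "flinear (\<lambda>x. 0)"
  by (rule flinearI) simp_all

lemma flinear_comp: "flinear f \<Longrightarrow> flinear g \<Longrightarrow> flinear (\<lambda>x. f (g x))"
  by (rule flinearI) (simp_all add: flinear_add flinear_scale)

lemma flinear_plus: "flinear f \<Longrightarrow> flinear g \<Longrightarrow> flinear (\<lambda>x. f x + g x)"
  by (rule flinearI) (simp_all add: flinear_add flinear_scale fm.scale_right_distrib)

lemma flinear_minus: "flinear f \<Longrightarrow> flinear g \<Longrightarrow> flinear (\<lambda>x. f x - g x)"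
  by (rule flinearI) (simp_all add: flinear_add flinear_scale fm.scale_right_diff_distrib)

lemma flinear_fscale: "flinear f \<Longrightarrow> flinear (\<lambda>x. fscale r (f x))"
  by (rule flinearI) (simp_all add: flinear_add flinear_scale fm.scale_right_distrib mult.commute)

lemma flinear_setsum: "(\<And>i. i \<in> I \<Longrightarrow> flinear (f i)) \<Longrightarrow> flinear (\<lambda>x. \<Sum>i\<in>I. f i x)"
  by (induction I rule: infinite_finite_induct) (auto intro: flinear_const_zero flinear_plus)

lemma lin_ext_superset:
  assumes "finite K" and "Poly_Mapping.keys x \<subseteq> K"
  shows "lin_ext f x = (\<Sum>k\<in>K. fscale (Poly_Mapping.lookup x k) (f k))"
  unfolding lin_ext_def
  by (rule sum.mono_neutral_left) (use assms in \<open>auto simp: in_keys_iff\<close>)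

lemma flinear_lin_ext:
  fixes f :: "'k \<Rightarrow> ('l \<Rightarrow>\<^sub>0 'r::comm_ring_1)"
  shows "flinear (lin_ext f)"
proof (rule flinearI)
  fix x y :: "'k \<Rightarrow>\<^sub>0 'r"
  let ?K = "Poly_Mapping.keys x \<union> Poly_Mapping.keys y"
  have "lin_ext f (x + y) = (\<Sum>k\<in>?K. fscale (Poly_Mapping.lookup (x + y) k) (f k))"
    by (rule lin_ext_superset) (auto dest: subsetD[OF Poly_Mapping.keys_add])
  also have "\<dots> = lin_ext f x + lin_ext f y"
    by (simp add: lin_ext_superset[of ?K] lookup_add fm.scale_left_distrib sum.distrib)
  finally show "lin_ext f (x + y) = lin_ext f x + lin_ext f y" .
next
  fix r and x :: "'k \<Rightarrow>\<^sub>0 'r"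
  have "lin_ext f (fscale r x) =
      (\<Sum>k\<in>Poly_Mapping.keys x. fscale (Poly_Mapping.lookup (fscale r x) k) (f k))"
    by (rule lin_ext_superset) (auto simp: in_keys_iff)
  then show "lin_ext f (fscale r x) = fscale r (lin_ext f x)"
    by (simp add: lin_ext_def fm.scale_sum_right)
qed

lemma lin_ext_single [simp]: "lin_ext f (Poly_Mapping.single k 1) = f k"
  by (simp add: lin_ext_def)

lemma lin_ext_gen [simp]: "lin_ext f (gen \<mu> us) = f (\<mu>, us)"
  by (simp add: gen_def)

lemma flinear_lin_ext_fun:
  assumes "\<And>k. flinear (\<lambda>x. f x k)"
  shows "flinear (\<lambda>x. lin_ext (f x) y)"
  unfolding lin_ext_def by (intro flinear_setsum flinear_fscale assms)

lemma formal_expansion: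
  "x = (\<Sum>k\<in>Poly_Mapping.keys x. fscale (Poly_Mapping.lookup x k) (Poly_Mapping.single k 1))"
  by (rule poly_mapping_eqI)
    (simp add: lookup_sum lookup_single when_def in_keys_iff sum.delta if_distrib cong: if_cong)

lemma lin_ext_gens [simp]: "lin_ext (\<lambda>(\<mu>, us). gen \<mu> us) x = x"
  using formal_expansion[of x] by (simp add: lin_ext_def gen_def case_prod_beta)

lemma flinear_span_mem:
  assumes "flinear f" and "fm.subspace S" and "\<And>x. x \<in> A \<Longrightarrow> f x \<in> S" and "x \<in> fm.span A"
  shows "f x \<in> S"
proof -
  have "f ` fm.span A = fm.span (f ` A)" by (rule module_hom.span_image[symmetric, OF assms(1)])
  also have "\<dots> \<subseteq> S" by (rule fm.span_minimal[OF _ assms(2)]) (use assms(3) in auto)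
  finally show ?thesis using assms(4) by blast
qed

text \<open>A property of all elements of the free module need only be checked on generators as soon as it
  says that a linear map takes values in a submodule.\<close>

lemma flinear_formals_mem:
  assumes "flinear f" and "fm.subspace S"
    and "\<And>\<mu> us. \<mu> \<in> ops P (length us) \<Longrightarrow> f (gen \<mu> us) \<in> S"
    and "x \<in> formals P"
  shows "f x \<in> S"
proof -
  have "f x = (\<Sum>k\<in>Poly_Mapping.keys x.
      fscale (Poly_Mapping.lookup x k) (f (Poly_Mapping.single k 1)))"
    by (subst formal_expansion) (simp add: flinear_sum[OF assms(1)] flinear_scale[OF assms(1)])
  also have "\<dots> \<in> S"
    using assms(3,4)
    by (intro fm.subspace_sum fm.subspace_scale assms(2)) (auto simp: formals_def gen_def)
  finally show ?thesis .
qed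

lemma flinear_formals_eq:
  fixes f g :: "('r::comm_ring_1, 'o, 'u) formal \<Rightarrow> ('l \<Rightarrow>\<^sub>0 'r)"
  assumes "flinear f" and "flinear g"
    and "\<And>\<mu> us. \<mu> \<in> ops P (length us) \<Longrightarrow> f (gen \<mu> us) = g (gen \<mu> us)"
    and "x \<in> formals P"
  shows "f x = g x"
  using flinear_formals_mem[OF flinear_minus[OF assms(1,2)] fm.subspace_single_0 _ assms(4)] assms(3)
  by simp

definition formal_map :: "('u \<Rightarrow> 'w) \<Rightarrow> ('r::comm_ring_1, 'o, 'u) formal \<Rightarrow> ('r, 'o, 'w) formal" where
  "formal_map h = lin_ext (\<lambda>(\<mu>, us). gen \<mu> (map h us))"

lemma flinear_formal_map: "flinear (formal_map h)"
  by (simp add: formal_map_def flinear_lin_ext)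

lemma formal_map_gen [simp]: "formal_map h (gen \<mu> us) = gen \<mu> (map h us)"
  by (simp add: formal_map_def)

lemma formal_map_ident [simp]: "formal_map (\<lambda>u. u) = (\<lambda>x. x)"
  by (simp add: formal_map_def fun_eq_iff)

definition multilinear :: "(('k \<Rightarrow>\<^sub>0 'r::comm_ring_1) list \<Rightarrow> ('l \<Rightarrow>\<^sub>0 'r)) \<Rightarrow> bool" where
  "multilinear M \<longleftrightarrow> (\<forall>ps qs. flinear (\<lambda>x. M (ps @ x # qs)))"

lemma multilinearI: "(\<And>ps qs. flinear (\<lambda>x. M (ps @ x # qs))) \<Longrightarrow> multilinear M"
  by (simp add: multilinear_def)

lemma multilinearD: "multilinear M \<Longrightarrow> flinear (\<lambda>x. M (ps @ x # qs))"
  by (simp add: multilinear_def)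

lemma multilinear_update:
  assumes "multilinear M" and "i < length xs"
  shows "flinear (\<lambda>x. M (xs[i := x]))"
  using multilinearD[OF assms(1), of "take i xs" "drop (Suc i) xs"] assms(2)
  by (simp add: upd_conv_take_nth_drop)

lemma multilinear_comp: "flinear f \<Longrightarrow> multilinear M \<Longrightarrow> multilinear (\<lambda>xs. f (M xs))"
  by (rule multilinearI) (rule flinear_comp, assumption, rule multilinearD)

lemma multilinear_map: "flinear f \<Longrightarrow> multilinear M \<Longrightarrow> multilinear (\<lambda>xs. M (map f xs))"
  unfolding multilinear_def by (simp add: flinear_comp[where f = "\<lambda>x. M (_ @ x # _)"])

lemma multilinear_context: "multilinear M \<Longrightarrow> multilinear (\<lambda>xs. M (as @ xs @ bs))"
  by (rule multilinearI) (use multilinearD[of M "as @ ps" "qs @ bs" for ps qs] in simp)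

lemma multilinear_minus:
  "multilinear M \<Longrightarrow> multilinear N \<Longrightarrow> multilinear (\<lambda>xs. M xs - N xs)"
  unfolding multilinear_def by (simp add: flinear_minus)

definition valid_gens :: "('r, 'o) operad_data \<Rightarrow> ('o \<times> 'u list) list \<Rightarrow> bool" where
  "valid_gens P gs \<longleftrightarrow> (\<forall>(\<nu>, vs) \<in> set gs. \<nu> \<in> ops P (length vs))"

lemma valid_gens_simps [simp]:
  "valid_gens P []"
  "valid_gens P ((\<nu>, vs) # gs) \<longleftrightarrow> \<nu> \<in> ops P (length vs) \<and> valid_gens P gs"
  "valid_gens P (gs @ gs') \<longleftrightarrow> valid_gens P gs \<and> valid_gens P gs'"
  by (auto simp: valid_gens_def)

abbreviation gens :: "('o \<times> 'u list) list \<Rightarrow> ('r::comm_ring_1, 'o, 'u) formal list" where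
  "gens \<equiv> map (\<lambda>(\<nu>, vs). gen \<nu> vs)"

abbreviation inner_ops :: "('o \<times> 'u list) list \<Rightarrow> (nat \<times> 'o) list" where
  "inner_ops \<equiv> map (\<lambda>(\<nu>, vs). (length vs, \<nu>))"

text \<open>A multilinear map is determined by its values on lists of generators: the arguments are expanded one
  after the other, from left to right.\<close>

lemma multilinear_formals_mem:
  fixes M :: "('r::comm_ring_1, 'o, 'u) formal list \<Rightarrow> ('l \<Rightarrow>\<^sub>0 'r)"
  assumes "multilinear M" and "fm.subspace S"
    and gens: "\<And>gs. length gs = n \<Longrightarrow> valid_gens P gs \<Longrightarrow> M (gens gs) \<in> S"
    and "set xs \<subseteq> formals P" and "length xs = n"
  shows "M xs \<in> S"
proof -
  have "M (gens gs @ xs) \<in> S"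
    if "length gs + length xs = n" and "valid_gens P gs" and "set xs \<subseteq> formals P" for gs xs
    using that
  proof (induction xs arbitrary: gs)
    case Nil
    then show ?case using gens[of gs] by simp
  next
    case (Cons x xs)
    have "x \<in> formals P" using Cons.prems(3) by simp
    have "M (gens gs @ gen \<mu> us # xs) \<in> S" if "\<mu> \<in> ops P (length us)" for \<mu> us
      using Cons.IH[of "gs @ [(\<mu>, us)]"] Cons.prems that by auto
    then show ?case
      by (rule flinear_formals_mem[OF multilinearD[OF assms(1)] assms(2) _ \<open>x \<in> formals P\<close>])
  qed
  from this[of "[]" xs] assms(4,5) show ?thesis by simp
qed

lemma multilinear_formals_eq:
  fixes M N :: "('r::comm_ring_1, 'o, 'u) formal list \<Rightarrow> ('l \<Rightarrow>\<^sub>0 'r)"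
  assumes "multilinear M" "multilinear N"
    and "\<And>gs. length gs = n \<Longrightarrow> valid_gens P gs \<Longrightarrow> M (gens gs) = N (gens gs)"
    and "set xs \<subseteq> formals P" and "length xs = n"
  shows "M xs = N xs"
  using multilinear_formals_mem[OF multilinear_minus[OF assms(1,2)] fm.subspace_single_0, of n P xs]
    assms(3-5) by auto

text \<open>For expressions that are multilinear on lists of one length only, such as those containing
  \<open>permute_list \<sigma> xs\<close>.\<close>

lemma multilinear_guard:
  assumes "\<And>ps qs. length ps + 1 + length qs = n \<Longrightarrow> flinear (\<lambda>x. M (ps @ x # qs))"
  shows "multilinear (\<lambda>xs. if length xs = n then M xs else 0)"
proof (rule multilinearI)
  fix ps qs
  show "flinear (\<lambda>x. if length (ps @ x # qs) = n then M (ps @ x # qs) else 0)"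
    using assms[of ps qs] by (cases "length ps + 1 + length qs = n") (simp_all add: flinear_const_zero)
qed

text \<open>The multilinear extension of a function on lists of generators, one argument at a time; in this
  form the operations of the free algebra are visibly multilinear.\<close>

fun multi_ext :: "('k list \<Rightarrow> ('l \<Rightarrow>\<^sub>0 'r)) \<Rightarrow> ('k \<Rightarrow>\<^sub>0 'r::comm_ring_1) list \<Rightarrow> ('l \<Rightarrow>\<^sub>0 'r)" where
  "multi_ext T [] = T []"
| "multi_ext T (x # xs) = lin_ext (\<lambda>k. multi_ext (\<lambda>ks. T (k # ks)) xs) x"

lemma multilinear_multi_ext: "multilinear (multi_ext T)"
proof (rule multilinearI)
  fix ps qs
  show "flinear (\<lambda>x. multi_ext T (ps @ x # qs))"
    by (induction ps arbitrary: T) (simp_all add: flinear_lin_ext flinear_lin_ext_fun)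
qed

lemma multi_ext_gens [simp]: "multi_ext T (gens gs) = T gs"
  by (induction gs arbitrary: T) auto

lemma multi_ext_eq_sum:
  "multi_ext T xs = (\<Sum>g \<in> listset (map Poly_Mapping.keys xs).
     fscale (\<Prod>i<length xs. Poly_Mapping.lookup (xs ! i) (g ! i)) (T g))"
proof (induction xs arbitrary: T)
  case Nil
  then show ?case by simp
next
  case (Cons x xs)
  let ?L = "listset (map Poly_Mapping.keys xs)"
  let ?c = "\<lambda>g. \<Prod>i<length xs. Poly_Mapping.lookup (xs ! i) (g ! i)"
  have "multi_ext T (x # xs) = (\<Sum>k\<in>Poly_Mapping.keys x. \<Sum>g\<in>?L.
      fscale (Poly_Mapping.lookup x k * ?c g) (T (k # g)))"
    by (simp add: Cons.IH lin_ext_def fm.scale_sum_right)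
  also have "\<dots> = (\<Sum>(k, g)\<in>Poly_Mapping.keys x \<times> ?L.
      fscale (Poly_Mapping.lookup x k * ?c g) (T (k # g)))"
    by (simp add: sum.cartesian_product)
  also have "\<dots> = (\<Sum>g \<in> set_Cons (Poly_Mapping.keys x) ?L.
     fscale (\<Prod>i<Suc (length xs). Poly_Mapping.lookup ((x # xs) ! i) (g ! i)) (T g))"
    by (rule sum.reindex_bij_witness[where i = "\<lambda>l. (hd l, tl l)" and j = "\<lambda>(k, g). k # g"])
      (auto simp: set_Cons_def prod.lessThan_Suc_shift simp del: prod.lessThan_Suc)
  finally show ?case by simp
qed

lemma formal_op_eq_multi_ext:
  "formal_op P \<mu> = multi_ext (\<lambda>g. gen (ocomp P \<mu> (inner_ops g)) (concat (map snd g)))"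
  by (rule ext) (simp add: formal_op_def multi_ext_eq_sum)

lemma multilinear_formal_op: "multilinear (formal_op P \<mu>)"
  by (simp add: formal_op_eq_multi_ext multilinear_multi_ext)

lemma formal_op_gens:
  "formal_op P \<mu> (gens gs) =
     gen (ocomp P \<mu> (inner_ops gs)) (concat (map snd gs))"
  by (simp add: formal_op_eq_multi_ext)

text \<open>The Leibniz sum: each summand of \<open>leibniz M g f xs\<close> applies \<open>f\<close> to one entry of \<open>xs\<close> and
  \<open>g\<close> to all others. A derivation along an algebra map \<open>g\<close> turns \<open>M\<close> into such a sum.\<close>

definition leibniz ::
    "('b list \<Rightarrow> 'c::comm_monoid_add) \<Rightarrow> ('a \<Rightarrow> 'b) \<Rightarrow> ('a \<Rightarrow> 'b) \<Rightarrow> 'a list \<Rightarrow> 'c" where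
  "leibniz M g f xs = (\<Sum>i<length xs. M ((map g xs)[i := f (xs ! i)]))"

lemma leibniz_Nil [simp]: "leibniz M g f [] = 0"
  by (simp add: leibniz_def)

lemma leibniz_Cons:
  "leibniz M g f (x # xs) = M (f x # map g xs) + leibniz (\<lambda>l. M (g x # l)) g f xs"
  by (simp add: leibniz_def sum.lessThan_Suc_shift del: sum.lessThan_Suc)

lemma leibniz_append:
  "leibniz M g f (xs @ ys) =
     leibniz (\<lambda>l. M (l @ map g ys)) g f xs + leibniz (\<lambda>l. M (map g xs @ l)) g f ys"
  by (induction xs arbitrary: M) (simp_all add: leibniz_Cons add.assoc)

lemma leibniz_concat:
  "leibniz M g f (concat vss) = (\<Sum>i<length vss.
     leibniz (\<lambda>l. M (map g (concat (take i vss)) @ l @ map g (concat (drop (Suc i) vss)))) g f (vss ! i))"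
  by (induction vss arbitrary: M) (simp_all add: leibniz_append sum.lessThan_Suc_shift del: sum.lessThan_Suc)

lemma leibniz_cong:
  assumes "\<And>as x bs. xs = as @ x # bs
    \<Longrightarrow> M (map g as @ f x # map g bs) = M' (map g' as @ f' x # map g' bs)"
  shows "leibniz M g f xs = leibniz M' g' f' xs"
  unfolding leibniz_def
proof (rule sum.cong[OF refl])
  fix i assume "i \<in> {..<length xs}"
  then have "i < length xs" by simp
  with assms[OF id_take_nth_drop[OF this]]
  show "M ((map g xs)[i := f (xs ! i)]) = M' ((map g' xs)[i := f' (xs ! i)])"
    by (simp add: upd_conv_take_nth_drop take_map drop_map)
qed

lemma flinear_leibniz:
  "flinear L \<Longrightarrow> L (leibniz M g f xs) = leibniz (\<lambda>l. L (M l)) g f xs"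
  by (simp add: leibniz_def flinear_sum)

lemma leibniz_map: "leibniz M g f (map h xs) = leibniz M (\<lambda>x. g (h x)) (\<lambda>x. f (h x)) xs"
  by (simp add: leibniz_def comp_def)

lemma multilinear_leibniz:
  assumes M: "multilinear M" and g: "flinear g" and f: "flinear f"
  shows "multilinear (leibniz M g f)"
proof (rule multilinearI)
  fix ps qs
  have 1: "flinear (\<lambda>x. leibniz (\<lambda>l. M (l @ g x # map g qs)) g f ps)"
    unfolding leibniz_def
    by (intro flinear_setsum flinear_comp[OF multilinearD[OF M] g])
  have 2: "flinear (\<lambda>x. M (map g ps @ f x # map g qs))"
    by (rule flinear_comp[OF multilinearD[OF M] f])
  have 3: "flinear (\<lambda>x. leibniz (\<lambda>l. M (map g ps @ g x # l)) g f qs)"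
    unfolding leibniz_def
    by (intro flinear_setsum flinear_comp[OF multilinearD[OF M] g])
  show "flinear (\<lambda>x. leibniz M g f (ps @ x # qs))"
    unfolding leibniz_append leibniz_Cons
    using flinear_plus[OF 1 flinear_plus[OF 2 3]] by simp
qed


section \<open>Block permutations act on concatenations\<close>

text \<open>The axioms of an operad express equivariance by permutations of the inputs of a composite, and the free
  algebra by permutations of tensor factors. The two are linked by the action of \<open>block_perm\<close> and
  \<open>sum_perm\<close> on the concatenation of the lists of factors.\<close>

lemma permute_list_update:
  assumes "\<sigma> permutes {..<length xs}" and "i < length xs"
  shows "permute_list \<sigma> (xs[\<sigma> i := y]) = (permute_list \<sigma> xs)[i := y]"
proof (rule nth_equalityI)
  fix j assume "j < length (permute_list \<sigma> (xs[\<sigma> i := y]))"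
  then have "j < length xs" by simp
  moreover have "\<sigma> i < length xs" "\<sigma> j < length xs"
    using permutes_in_image[OF assms(1)] assms(2) calculation by auto
  moreover have "\<sigma> i = \<sigma> j \<longleftrightarrow> i = j"
    using permutes_inj[OF assms(1)] by (auto dest: injD)
  ultimately show "permute_list \<sigma> (xs[\<sigma> i := y]) ! j = (permute_list \<sigma> xs)[i := y] ! j"
    using assms by (auto simp: permute_list_nth nth_list_update)
qed simp

lemma index_blocks_Nil [simp]: "index_blocks [] = []"
  by (simp add: index_blocks_def)

lemma index_blocks_snoc:
  "index_blocks (ks @ [k]) = index_blocks ks @ [[sum_list ks ..< sum_list ks + k]]"
  by (simp add: index_blocks_def)

lemma concat_index_blocks: "concat (index_blocks ks) = [0..<sum_list ks]"
  by (induction ks rule: rev_induct) (simp_all add: index_blocks_snoc upt_add_eq_append[of 0])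

lemma length_index_blocks [simp]: "length (index_blocks ks) = length ks"
  by (simp add: index_blocks_def)

lemma map_length_index_blocks: "map length (index_blocks ks) = ks"
  by (induction ks rule: rev_induct) (simp_all add: index_blocks_snoc)

lemma map_nth_index_blocks:
  "map (map ((!) (concat vss))) (index_blocks (map length vss)) = vss"
proof (induction vss rule: rev_induct)
  case Nil
  then show ?case by simp
next
  case (snoc vs vss)
  let ?n = "sum_list (map length vss)"
  have n: "?n = length (concat vss)" by (simp add: length_concat)
  have "map (map ((!) (concat (vss @ [vs])))) (index_blocks (map length vss)) =
      map (map ((!) (concat vss))) (index_blocks (map length vss))"
  proof (intro map_cong refl)
    fix B j assume "B \<in> set (index_blocks (map length vss))" and "j \<in> set B"
    then have "j \<in> set (concat (index_blocks (map length vss)))" by auto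
    then show "concat (vss @ [vs]) ! j = concat vss ! j"
      by (simp add: concat_index_blocks n nth_append)
  qed
  moreover have "map ((!) (concat (vss @ [vs]))) [?n ..< ?n + length vs] = vs"
    by (rule nth_equalityI) (simp_all add: n nth_append)
  ultimately show ?case using snoc.IH by (simp add: index_blocks_snoc)
qed

lemma list_fun_permutes:
  assumes "mset js = mset [0..<n]"
  shows "list_fun js permutes {..<n}"
proof -
  have js: "set js = {..<n}" "distinct js" "length js = n"
    using mset_eq_setD[OF assms] mset_eq_imp_distinct_iff[OF assms] mset_eq_length[OF assms]
    by (simp_all add: atLeast0LessThan)
  then have "bij_betw ((!) js) {..<n} {..<n}" by (intro bij_betw_nth) auto
  then have "bij_betw (list_fun js) {..<n} {..<n}"
    by (subst bij_betw_cong[of _ _ "(!) js"]) (simp_all add: list_fun_def js)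
  then show ?thesis
    by (rule bij_imp_permutes) (simp add: list_fun_def js)
qed

lemma permute_list_list_fun:
  "length js = length xs \<Longrightarrow> permute_list (list_fun js) xs = map ((!) xs) js"
  by (rule nth_equalityI) (simp_all add: permute_list_def list_fun_def)

lemma mset_concat_permute_list:
  assumes "\<sigma> permutes {..<length xss}"
  shows "mset (concat (permute_list \<sigma> xss)) = mset (concat xss)"
proof -
  have "map mset (permute_list \<sigma> xss) = permute_list \<sigma> (map mset xss)"
    by (rule permute_list_map[OF assms, symmetric])
  then have "mset (map mset (permute_list \<sigma> xss)) = mset (map mset xss)"
    using assms by simp
  from arg_cong[OF this, of sum_mset] show ?thesis by (simp only: mset_concat sum_mset_sum_list)
qed

lemma block_perm_permutes:
  assumes "\<sigma> permutes {..<length ks}"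
  shows "block_perm \<sigma> ks permutes {..<sum_list ks}"
  unfolding block_perm_def
  by (rule list_fun_permutes) (use assms in \<open>simp add: mset_concat_permute_list concat_index_blocks\<close>)

lemma permute_list_block_perm:
  assumes "\<sigma> permutes {..<length vss}"
  shows "permute_list (block_perm \<sigma> (map length vss)) (concat vss) = concat (permute_list \<sigma> vss)"
proof -
  let ?B = "index_blocks (map length vss)"
  have "mset (concat (permute_list \<sigma> ?B)) = mset (concat ?B)"
    using assms by (simp add: mset_concat_permute_list)
  from mset_eq_length[OF this] have "length (concat (permute_list \<sigma> ?B)) = length (concat vss)"
    by (simp only: concat_index_blocks length_upt length_concat diff_zero)
  then have "permute_list (block_perm \<sigma> (map length vss)) (concat vss) =
      concat (map (map ((!) (concat vss))) (permute_list \<sigma> ?B))"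
    by (simp add: block_perm_def permute_list_list_fun map_concat)
  also have "\<dots> = concat (permute_list \<sigma> vss)"
    using assms by (simp add: map_nth_index_blocks flip: permute_list_map)
  finally show ?thesis .
qed

lemma mset_concat_map2_permute_list:
  assumes "list_all2 (\<lambda>\<tau> xs. \<tau> permutes {..<length xs}) \<tau>s xss"
  shows "mset (concat (map2 permute_list \<tau>s xss)) = mset (concat xss)"
  using assms by (induction rule: list_all2_induct) simp_all

lemma map_concat_map2_permute_list:
  assumes "list_all2 (\<lambda>\<tau> xs. \<tau> permutes {..<length xs}) \<tau>s xss"
  shows "map f (concat (map2 permute_list \<tau>s xss)) = concat (map2 permute_list \<tau>s (map (map f) xss))"
  using assms by (induction rule: list_all2_induct) (simp_all add: permute_list_map)

lemma list_all2_index_blocks: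
  "list_all2 (\<lambda>\<tau> B. \<tau> permutes {..<length B}) \<tau>s (index_blocks ks) \<longleftrightarrow>
   list_all2 (\<lambda>\<tau> k. \<tau> permutes {..<k}) \<tau>s ks"
proof -
  have "list_all2 (\<lambda>\<tau> k. \<tau> permutes {..<k}) \<tau>s (map length (index_blocks ks)) \<longleftrightarrow>
      list_all2 (\<lambda>\<tau> B. \<tau> permutes {..<length B}) \<tau>s (index_blocks ks)"
    by (simp add: list_all2_map2)
  then show ?thesis by (simp only: map_length_index_blocks)
qed

lemma sum_perm_permutes:
  assumes "list_all2 (\<lambda>\<tau> k. \<tau> permutes {..<k}) \<tau>s ks"
  shows "sum_perm \<tau>s ks permutes {..<sum_list ks}"
  unfolding sum_perm_def
  by (rule list_fun_permutes)
    (use assms in \<open>simp add: mset_concat_map2_permute_list list_all2_index_blocks concat_index_blocks\<close>)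

lemma permute_list_sum_perm:
  assumes "list_all2 (\<lambda>\<tau> vs. \<tau> permutes {..<length vs}) \<tau>s vss"
  shows "permute_list (sum_perm \<tau>s (map length vss)) (concat vss) = concat (map2 permute_list \<tau>s vss)"
proof -
  let ?B = "index_blocks (map length vss)"
  have B: "list_all2 (\<lambda>\<tau> B. \<tau> permutes {..<length B}) \<tau>s ?B"
    using assms by (simp add: list_all2_index_blocks list_all2_map2)
  have "length (concat (map2 permute_list \<tau>s ?B)) = length (concat vss)"
    using mset_eq_length[OF mset_concat_map2_permute_list[OF B]]
    by (simp only: concat_index_blocks length_upt length_concat diff_zero)
  then have "permute_list (sum_perm \<tau>s (map length vss)) (concat vss) =
      map ((!) (concat vss)) (concat (map2 permute_list \<tau>s ?B))"
    by (simp add: sum_perm_def permute_list_list_fun)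
  also have "\<dots> = concat (map2 permute_list \<tau>s vss)"
    by (simp only: map_concat_map2_permute_list[OF B] map_nth_index_blocks)
  finally show ?thesis .
qed


section \<open>The operations of the free algebra modulo the relations\<close>

context operad
begin

lemma subspace_rels: "fm.subspace (rels P t)"
  by (simp add: rels_def)

lemma tensor_rels_rels: "x \<in> tensor_rels P t \<Longrightarrow> x \<in> rels P t"
  by (simp add: rels_def fm.span_base)

text \<open>Equality of the elements of the free algebra represented by two formal sums.\<close>

definition req ::
    "('r \<Rightarrow> 'u::ab_group_add \<Rightarrow> 'u) \<Rightarrow> ('r, 'o, 'u) formal \<Rightarrow> ('r, 'o, 'u) formal \<Rightarrow> bool" where
  "req t x y \<longleftrightarrow> x - y \<in> rels P t"

lemma req_refl [simp]: "req t x x"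
  by (simp add: req_def fm.subspace_0 subspace_rels)

lemma req_sym: "req t x y \<Longrightarrow> req t y x"
  using fm.subspace_neg[OF subspace_rels, of "x - y" t] by (simp add: req_def)

lemma req_trans [trans]: "req t x y \<Longrightarrow> req t y z \<Longrightarrow> req t x z"
  using fm.subspace_add[OF subspace_rels, of "x - y" t "y - z"] by (simp add: req_def)

lemma req_add: "req t x y \<Longrightarrow> req t x' y' \<Longrightarrow> req t (x + x') (y + y')"
  using fm.subspace_add[OF subspace_rels, of "x - y" t "x' - y'"]
  by (simp add: req_def algebra_simps)

lemma req_diff: "req t x y \<Longrightarrow> req t x' y' \<Longrightarrow> req t (x - x') (y - y')"
  using fm.subspace_diff[OF subspace_rels, of "x - y" t "x' - y'"]
  by (simp add: req_def algebra_simps)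

lemma req_scale: "req t x y \<Longrightarrow> req t (fscale r x) (fscale r y)"
  using fm.subspace_scale[OF subspace_rels, of "x - y" t r]
  by (simp add: req_def fm.scale_right_diff_distrib)

lemma req_sum: "(\<And>i. i \<in> I \<Longrightarrow> req t (f i) (g i)) \<Longrightarrow> req t (\<Sum>i\<in>I. f i) (\<Sum>i\<in>I. g i)"
  by (induction I rule: infinite_finite_induct) (auto intro: req_add)

lemma req_zero_iff: "req t x 0 \<longleftrightarrow> x \<in> rels P t"
  by (simp add: req_def)

lemma subspace_formals: "fm.subspace (formals P :: ('r, 'o, 'u) formal set)"
proof (rule fm.subspaceI)
  fix x y :: "('r, 'o, 'u) formal" and r
  assume x: "x \<in> formals P" 
  then show "fscale r x \<in> formals P"
    unfolding formals_def by (auto simp: in_keys_iff split_beta)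
  assume "y \<in> formals P"
  with x show "x + y \<in> formals P"
    unfolding formals_def using Poly_Mapping.keys_add[of x y] by blast
qed (simp add: formals_def)

lemma zero_formals [simp]: "0 \<in> formals P"
  by (rule fm.subspace_0[OF subspace_formals])

lemma gen_formals: "\<mu> \<in> ops P (length us) \<Longrightarrow> gen \<mu> us \<in> formals P"
  by (auto simp: formals_def gen_def split: if_splits)

lemma ops_add: "\<mu> \<in> ops P n \<Longrightarrow> \<nu> \<in> ops P n \<Longrightarrow> \<mu> + \<nu> \<in> ops P n"
  using module.subspace_add[OF module subspace] .

lemma ops_scale: "\<mu> \<in> ops P n \<Longrightarrow> oscale P r \<mu> \<in> ops P n"
  using module.subspace_scale[OF module subspace] .

lemma tensor_rels_formals: "x \<in> tensor_rels P t \<Longrightarrow> x \<in> formals P"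
  by (induction rule: tensor_rels.induct)
    (auto intro!: fm.subspace_diff fm.subspace_scale subspace_formals gen_formals ops_add ops_scale act_closed)

lemma rels_formals: "rels P t \<subseteq> formals P"
  unfolding rels_def by (rule fm.span_minimal) (auto intro: tensor_rels_formals subspace_formals)

lemma req_formals: "req t x y \<Longrightarrow> y \<in> formals P \<Longrightarrow> x \<in> formals P"
  using rels_formals[of t] fm.subspace_add[OF subspace_formals, of y "x - y"] by (auto simp: req_def)

abbreviation eta :: "'u \<Rightarrow> ('r, 'o, 'u) formal" where
  "eta u \<equiv> gen (ounit P) [u]"

lemma eta_formals [simp]: "eta u \<in> formals P"
  using unit_closed by (intro gen_formals) simp

lemma set_map_eta [simp]: "set (map eta us) \<subseteq> formals P"
  by auto

lemma map_eta_eq_gens: "map eta us = gens (map (\<lambda>u. (ounit P, [u])) us)"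
  by simp

lemma valid_gens_etas [simp]: "valid_gens P (map (\<lambda>u. (ounit P, [u])) us)"
  using unit_closed by (auto simp: valid_gens_def)

lemma inputs_append [simp]: "inputs P (ps @ qs) \<longleftrightarrow> inputs P ps \<and> inputs P qs"
  by (auto simp: inputs_def)

lemma inputs_Cons [simp]: "inputs P ((k, \<nu>) # qs) \<longleftrightarrow> \<nu> \<in> ops P k \<and> inputs P qs"
  by (auto simp: inputs_def)

lemma inputs_units [simp]: "inputs P (replicate n (Suc 0, ounit P))"
  using unit_closed by (auto simp: inputs_def)

lemma inputs_arities [simp]: "valid_gens P gs \<Longrightarrow> inputs P (inner_ops gs)"
  by (auto simp: inputs_def valid_gens_def)

lemma total_arities [simp]: "total (inner_ops gs) = length (concat (map snd gs))"
  by (simp add: total_def length_concat comp_def case_prod_beta)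

lemma ocomp_arities_closed:
  "\<mu> \<in> ops P (length gs) \<Longrightarrow> valid_gens P gs
    \<Longrightarrow> ocomp P \<mu> (inner_ops gs) \<in> ops P (length (concat (map snd gs)))"
  using comp_closed[of \<mu> "inner_ops gs"] by simp

lemma formal_op_closed:
  fixes xs :: "('r, 'o, 'u) formal list"
  assumes "set xs \<subseteq> formals P" and "\<mu> \<in> ops P (length xs)"
  shows "formal_op P \<mu> xs \<in> formals P"
proof (rule multilinear_formals_mem[OF multilinear_formal_op subspace_formals _ assms(1) refl])
  fix gs :: "('o \<times> 'u list) list"
  assume "length gs = length xs" and "valid_gens P gs"
  then show "formal_op P \<mu> (gens gs) \<in> formals P"
    unfolding formal_op_gens using assms(2) by (intro gen_formals ocomp_arities_closed) auto
qed

lemma etas_simps: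
  "inner_ops (map (\<lambda>u. (ounit P, [u])) us) = replicate (length us) (1, ounit P)"
  "concat (map snd (map (\<lambda>u. (ounit P, [u])) us)) = us"
  by (induction us) auto

lemma formal_op_etas: "\<mu> \<in> ops P (length us) \<Longrightarrow> formal_op P \<mu> (map eta us) = gen \<mu> us"
  unfolding map_eta_eq_gens formal_op_gens etas_simps by (simp only: unit_right)

lemma formal_op_unit:
  fixes x :: "('r, 'o, 'u) formal"
  assumes "x \<in> formals P"
  shows "formal_op P (ounit P) [x] = x"
proof -
  have "formal_op P (ounit P) [x] - x \<in> {0}"
  proof (rule flinear_formals_mem[OF _ fm.subspace_single_0 _ assms])
    show "flinear (\<lambda>x. formal_op P (ounit P) [x] - x)"
      using multilinearD[OF multilinear_formal_op, of P "ounit P" "[]" "[]"]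
      by (intro flinear_minus flinear_id) simp
    fix \<mu> and us :: "'u list" assume "\<mu> \<in> ops P (length us)"
    then show "formal_op P (ounit P) [gen \<mu> us] - gen \<mu> us \<in> {0}"
      using formal_op_gens[of P "ounit P" "[(\<mu>, us)]"] by (simp add: unit_left)
  qed
  then show ?thesis by simp
qed

lemma formal_op_add_left:
  fixes xs :: "('r, 'o, 'u::ab_group_add) formal list"
  assumes "set xs \<subseteq> formals P" and "\<mu> \<in> ops P (length xs)" and "\<nu> \<in> ops P (length xs)"
  shows "req t (formal_op P (\<mu> + \<nu>) xs) (formal_op P \<mu> xs + formal_op P \<nu> xs)"
proof -
  have "formal_op P (\<mu> + \<nu>) xs - formal_op P \<mu> xs - formal_op P \<nu> xs \<in> rels P t"
  proof (rule multilinear_formals_mem[OF _ subspace_rels _ assms(1) refl])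
    show "multilinear (\<lambda>xs. formal_op P (\<mu> + \<nu>) xs - formal_op P \<mu> xs - formal_op P \<nu> xs)"
      by (intro multilinear_minus multilinear_formal_op)
    fix gs :: "('o \<times> 'u list) list"
    assume "length gs = length xs" and "valid_gens P gs"
    then show "formal_op P (\<mu> + \<nu>) (gens gs) - formal_op P \<mu> (gens gs) - formal_op P \<nu> (gens gs)
        \<in> rels P t"
      using assms(2,3) comp_add_left[of \<mu> "inner_ops gs" \<nu>] unfolding formal_op_gens
      by (auto intro!: tensor_rels_rels tensor_rels.intros ocomp_arities_closed)
  qed
  then show ?thesis by (simp add: req_def algebra_simps)
qed

lemma formal_op_scale_left:
  fixes xs :: "('r, 'o, 'u::ab_group_add) formal list"
  assumes "set xs \<subseteq> formals P" and "\<mu> \<in> ops P (length xs)"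
  shows "req t (formal_op P (oscale P r \<mu>) xs) (fscale r (formal_op P \<mu> xs))"
  unfolding req_def
proof (rule multilinear_formals_mem[OF _ subspace_rels _ assms(1) refl])
  show "multilinear (\<lambda>xs. formal_op P (oscale P r \<mu>) xs - fscale r (formal_op P \<mu> xs))"
    by (intro multilinear_minus multilinear_comp[OF flinear_fscale[OF flinear_id]] multilinear_formal_op)
  fix gs :: "('o \<times> 'u list) list"
  assume "length gs = length xs" and "valid_gens P gs"
  then show "formal_op P (oscale P r \<mu>) (gens gs) - fscale r (formal_op P \<mu> (gens gs)) \<in> rels P t"
    using assms(2) comp_scale_left[of \<mu> "inner_ops gs" r] unfolding formal_op_gens
    by (auto intro!: tensor_rels_rels tensor_rels.intros ocomp_arities_closed)
qed

text \<open>On generators, permuting the arguments permutes blocks of tensor factors, which the relations undo by the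
  block permutation that equivariance produces in the operation.\<close>

lemma formal_op_permute:
  fixes xs :: "('r, 'o, 'u::ab_group_add) formal list"
  assumes "set xs \<subseteq> formals P" and \<mu>: "\<mu> \<in> ops P (length xs)" and \<sigma>: "\<sigma> permutes {..<length xs}"
  shows "req t (formal_op P (oact P (length xs) \<mu> \<sigma>) (permute_list \<sigma> xs)) (formal_op P \<mu> xs)"
proof -
  define n where "n = length xs"
  let ?M = "\<lambda>xs :: ('r, 'o, 'u) formal list. if length xs = n then formal_op P (oact P n \<mu> \<sigma>) (permute_list \<sigma> xs) else 0"
  have \<sigma>n: "\<sigma> permutes {..<n}" and \<mu>n: "\<mu> \<in> ops P n"
    using \<sigma> \<mu> by (simp_all add: n_def)
  have "?M xs - formal_op P \<mu> xs \<in> rels P t"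
  proof (rule multilinear_formals_mem[where M = "\<lambda>xs. ?M xs - formal_op P \<mu> xs",
      OF _ subspace_rels _ assms(1) n_def[symmetric]])
    have "multilinear ?M"
    proof (rule multilinear_guard)
      fix ps qs :: "('r, 'o, 'u) formal list"
      assume len: "length ps + 1 + length qs = n"
      then have "length ps \<in> \<sigma> ` {..<n}" using permutes_image[OF \<sigma>n] len by auto
      then obtain j where j: "j < n" "\<sigma> j = length ps" by auto
      define zs where "zs = permute_list \<sigma> (ps @ 0 # qs)"
      have "permute_list \<sigma> (ps @ x # qs) = zs[j := x]" for x
        using permute_list_update[of \<sigma> "ps @ 0 # qs" j x] \<sigma>n j len by (simp add: zs_def)
      moreover have "j < length zs" using j len by (simp add: zs_def)
      ultimately show "flinear (\<lambda>x. formal_op P (oact P n \<mu> \<sigma>) (permute_list \<sigma> (ps @ x # qs)))"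
        using multilinear_update[OF multilinear_formal_op] by simp
    qed
    then show "multilinear (\<lambda>xs. ?M xs - formal_op P \<mu> xs)"
      by (rule multilinear_minus) (rule multilinear_formal_op)
    fix gs :: "('o \<times> 'u list) list"
    assume len: "length gs = n" and gs: "valid_gens P gs"
    let ?vss = "map snd gs"
    have \<sigma>': "\<sigma> permutes {..<length gs}" using \<sigma>n len by simp
    have ks: "map fst (inner_ops gs) = map length ?vss" by (simp add: comp_def case_prod_beta)
    have "?M (gens gs) = gen (oact P (length (concat ?vss)) (ocomp P \<mu> (inner_ops gs))
        (block_perm \<sigma> (map length ?vss))) (permute_list (block_perm \<sigma> (map length ?vss)) (concat ?vss))"
      using comp_act_left[of \<mu> "inner_ops gs" \<sigma>] \<mu> gs len \<sigma>' \<mu>n 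
      by (simp add: formal_op_gens permute_list_block_perm ks permute_list_map[OF \<sigma>'] del: map_map)
    moreover have "block_perm \<sigma> (map length ?vss) permutes {..<length (concat ?vss)}"
      using block_perm_permutes[of \<sigma> "map length ?vss"] \<sigma>' by (simp add: length_concat)
    moreover have "ocomp P \<mu> (inner_ops gs) \<in> ops P (length (concat ?vss))"
      using \<mu>n len gs by (intro ocomp_arities_closed) simp_all
    ultimately show "?M (gens gs) - formal_op P \<mu> (gens gs) \<in> rels P t"
      by (simp only: formal_op_gens tensor_rels.intros(5) tensor_rels_rels)
  qed
  then show ?thesis unfolding req_def by (simp add: n_def)
qed

lemma formal_op_gens_insert:
  "formal_op P \<mu> (gens gs @ gen \<nu> vs # gens gs') =
    gen (ocomp P \<mu> (inner_ops gs @ (length vs, \<nu>) # inner_ops gs'))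
      (concat (map snd gs) @ vs @ concat (map snd gs'))"
  using formal_op_gens[of P \<mu> "gs @ (\<nu>, vs) # gs'"] by simp

lemma ocomp_arities_insert_closed:
  assumes "\<mu> \<in> ops P (length gs + 1 + length gs')" "valid_gens P gs" "valid_gens P gs'"
    "\<nu> \<in> ops P (length vs)"
  shows "ocomp P \<mu> (inner_ops gs @ (length vs, \<nu>) # inner_ops gs')
    \<in> ops P (length (concat (map snd gs) @ vs @ concat (map snd gs')))"
  using ocomp_arities_closed[of \<mu> "gs @ (\<nu>, vs) # gs'"] assms by simp

text \<open>A relation in one argument gives a relation of the same kind in the concatenated tensor. A permutation of
  the factors of one argument becomes its block sum with identity permutations.\<close>

lemma formal_op_gens_tensor_rels:
  fixes \<rho> :: "('r, 'o, 'u::ab_group_add) formal"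
  assumes "\<rho> \<in> tensor_rels P t" and \<mu>: "\<mu> \<in> ops P (length gs + 1 + length gs')"
    and gs: "valid_gens P gs" "valid_gens P gs'"
  shows "formal_op P \<mu> (gens gs @ \<rho> # gens gs') \<in> rels P t"
proof -
  let ?F = "\<lambda>x. formal_op P \<mu> (gens gs @ x # gens gs')"
  let ?a = "concat (map snd gs)" and ?b = "concat (map snd gs')"
  let ?c = "\<lambda>k \<nu>. ocomp P \<mu> (inner_ops gs @ (k, \<nu>) # inner_ops gs')"
  have lin: "flinear ?F" by (rule multilinearD[OF multilinear_formal_op])
  note F = flinear_diff[OF lin] flinear_scale[OF lin] formal_op_gens_insert
  note closed = ocomp_arities_insert_closed[OF \<mu> gs]
  show ?thesis using assms(1)
  proof cases
    case (1 \<nu> us \<nu>')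
    then have "?c (length us) (\<nu> + \<nu>') = ?c (length us) \<nu> + ?c (length us) \<nu>'"
      using comp_add_right[of \<mu> "inner_ops gs" "inner_ops gs'" \<nu> "length us" \<nu>'] \<mu> gs by simp
    with 1 show ?thesis
      using tensor_rels.intros(1)[OF closed closed, of \<nu> us \<nu>' t] by (simp add: F tensor_rels_rels)
  next
    case (2 \<nu> us r)
    then have "?c (length us) (oscale P r \<nu>) = oscale P r (?c (length us) \<nu>)"
      using comp_scale_right[of \<mu> "inner_ops gs" "inner_ops gs'" \<nu> "length us" r] \<mu> gs by simp
    with 2 show ?thesis
      using tensor_rels.intros(2)[OF closed, of \<nu> us r t] by (simp add: F tensor_rels_rels)
  next
    case (3 \<nu> us ws v v')
    then show ?thesis
      using tensor_rels.intros(3)[of "?c (length us + 1 + length ws) \<nu>" P "?a @ us" "ws @ ?b" v v' t]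
        closed[of \<nu> "us @ v # ws"] by (simp add: F tensor_rels_rels add.assoc)
  next
    case (4 \<nu> us ws r v)
    then show ?thesis
      using tensor_rels.intros(4)[of "?c (length us + 1 + length ws) \<nu>" P "?a @ us" "ws @ ?b" t r v]
        closed[of \<nu> "us @ v # ws"] by (simp add: F tensor_rels_rels add.assoc)
  next
    case (5 \<nu> us \<sigma>)
    let ?ps = "inner_ops gs @ (length us, \<nu>) # inner_ops gs'"
    let ?vss = "map snd gs @ us # map snd gs'"
    let ?\<tau>s = "replicate (length gs) id @ \<sigma> # replicate (length gs') id"
    have ks: "map fst ?ps = map length ?vss" by (simp add: comp_def case_prod_beta)
    have perm: "list_all2 (\<lambda>\<tau> vs. \<tau> permutes {..<length vs}) ?\<tau>s ?vss"
    proof -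
      have "list_all2 (\<lambda>\<tau> vs. \<tau> permutes {..<length vs}) (replicate (length hs) id) (map snd hs)"
        for hs :: "('o \<times> 'u list) list"
        by (induction hs) (auto simp: permutes_def)
      with 5 show ?thesis by (auto intro!: list_all2_appendI)
    qed
    have units: "map2 (\<lambda>(k, \<nu>) \<tau>. (k, oact P k \<nu> \<tau>)) (inner_ops hs) (replicate (length hs) id) = inner_ops hs"
      "map2 permute_list (replicate (length hs) id) (map snd hs) = map snd hs"
      if "valid_gens P hs" for hs :: "('o \<times> 'u list) list"
      using that by (induction hs) (auto simp: act_id)
    have "\<tau>s ! i permutes {..<fst (ps ! i)}"
      if "list_all2 (\<lambda>\<tau> vs. \<tau> permutes {..<length vs}) \<tau>s vss" "map fst ps = map length vss"
        "i < length ps" for \<tau>s and ps :: "(nat \<times> 'o) list" and vss :: "'u list list" and i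
    proof -
      have len: "length ps = length vss" using arg_cong[OF that(2), of length] by simp
      have "fst (ps ! i) = map fst ps ! i" using that(3) by simp
      also have "\<dots> = length (vss ! i)" unfolding that(2) using len that(3) by simp
      finally show ?thesis using list_all2_nthD2[OF that(1), of i] that(3) len by simp
    qed
    from this[OF perm ks] have "?\<tau>s ! i permutes {..<fst (?ps ! i)}" if "i < length ?ps" for i
      using that .
    then have "ocomp P \<mu> (map2 (\<lambda>(k, \<nu>) \<tau>. (k, oact P k \<nu> \<tau>)) ?ps ?\<tau>s) =
        oact P (total ?ps) (ocomp P \<mu> ?ps) (sum_perm ?\<tau>s (map fst ?ps))"
      using \<mu> gs 5 by (intro comp_act_right) auto
    then have act: "?c (length us) (oact P (length us) \<nu> \<sigma>) =
        oact P (length (concat ?vss)) (?c (length us) \<nu>) (sum_perm ?\<tau>s (map length ?vss))"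
      using gs total_arities[of "gs @ (\<nu>, us) # gs'"] unfolding ks by (simp add: units)
    have "concat (map2 permute_list ?\<tau>s ?vss) = ?a @ permute_list \<sigma> us @ ?b"
      using gs by (simp add: units)
    then have conc: "permute_list (sum_perm ?\<tau>s (map length ?vss)) (concat ?vss) =
        ?a @ permute_list \<sigma> us @ ?b"
      using permute_list_sum_perm[OF perm] by (simp only:)
    have "sum_perm ?\<tau>s (map length ?vss) permutes {..<length (concat ?vss)}"
      using sum_perm_permutes[of ?\<tau>s "map length ?vss"] perm
      by (simp only: list_all2_map2 length_concat)
    from tensor_rels.intros(5)[OF _ this, of "?c (length us) \<nu>" P t] closed[OF 5(2)]
    show ?thesis
      unfolding 5(1) F act[symmetric] conc using 5
      by (simp add: F conc[simplified] act[simplified] tensor_rels_rels)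
  qed
qed

lemma formal_op_rels:
  assumes \<rho>: "\<rho> \<in> rels P t" and \<mu>: "\<mu> \<in> ops P (length ps + 1 + length qs)"
    and ps: "set ps \<subseteq> formals P" and qs: "set qs \<subseteq> formals P"
  shows "formal_op P \<mu> (ps @ \<rho> # qs) \<in> rels P t"
proof -
  have gens: "formal_op P \<mu> (gens gs @ \<rho> # gens gs') \<in> rels P t"
    if "length gs = length ps" "length gs' = length qs" "valid_gens P gs" "valid_gens P gs'" for gs gs'
  proof -
    have "\<mu> \<in> ops P (length gs + 1 + length gs')" using \<mu> that by simp
    then show ?thesis
      using flinear_span_mem[OF multilinearD[OF multilinear_formal_op] subspace_rels
          formal_op_gens_tensor_rels \<rho>[unfolded rels_def]] that(3,4) by blast
  qed
  have gens': "formal_op P \<mu> (ps @ \<rho> # gens gs') \<in> rels P t"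
    if gs': "length gs' = length qs" "valid_gens P gs'" for gs'
  proof (rule multilinear_formals_mem[OF _ subspace_rels _ ps refl])
    show "multilinear (\<lambda>ps. formal_op P \<mu> (ps @ \<rho> # gens gs'))"
      using multilinear_context[OF multilinear_formal_op, of P \<mu> "[]" "\<rho> # gens gs'"] by simp
  qed (use gens gs' in auto)
  show ?thesis
  proof (rule multilinear_formals_mem[OF _ subspace_rels _ qs refl])
    show "multilinear (\<lambda>qs. formal_op P \<mu> (ps @ \<rho> # qs))"
      using multilinear_context[OF multilinear_formal_op, of P \<mu> "ps @ [\<rho>]" "[]"] by simp
  qed (use gens' in auto)
qed

text \<open>The operations of the free algebra are well defined: the arguments are replaced one at a time.\<close>

lemma formal_op_cong:
  assumes "list_all2 (req t) xs ys" and "set ys \<subseteq> formals P" and "\<mu> \<in> ops P (length xs)"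
  shows "req t (formal_op P \<mu> xs) (formal_op P \<mu> ys)"
proof -
  have "req t (formal_op P \<mu> (zs @ xs)) (formal_op P \<mu> (zs @ ys))"
    if "set zs \<subseteq> formals P" and "\<mu> \<in> ops P (length zs + length xs)" for zs
    using assms(1,2) that
  proof (induction arbitrary: zs rule: list_all2_induct)
    case Nil
    then show ?case by simp
  next
    case (Cons x xs y ys)
    have sub: "x \<in> formals P" "set xs \<subseteq> formals P"
    proof -
      show "x \<in> formals P" using req_formals[OF Cons.hyps(1)] Cons.prems by simp
      show "set xs \<subseteq> formals P"
      proof -
        have "set ys \<subseteq> formals P" using Cons.prems(1) by simp
        with Cons.hyps(2) show ?thesis
          by (induction rule: list_all2_induct) (auto intro: req_formals)
      qed
    qed
    have "formal_op P \<mu> (zs @ (x - y) # xs) \<in> rels P t"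
      using Cons.hyps(1) Cons.prems sub by (intro formal_op_rels) (auto simp: req_def)
    then have "req t (formal_op P \<mu> (zs @ x # xs)) (formal_op P \<mu> (zs @ y # xs))"
      using flinear_diff[OF multilinearD[OF multilinear_formal_op, of P \<mu> zs xs]] by (simp add: req_def)
    also have "req t (formal_op P \<mu> (zs @ y # xs)) (formal_op P \<mu> (zs @ y # ys))"
      using Cons.IH[of "zs @ [y]"] Cons.prems by simp
    finally show ?case .
  qed
  from this[of "[]"] assms(3) show ?thesis by simp
qed

text \<open>Associativity of operadic composition in the form in which a Leibniz sum uses it: the outer operation is
  applied to tensors, the inner one to vectors except for one arbitrary argument \<open>x\<close>, where the derivation
  has put its value.\<close>

lemma formal_op_insert:
  fixes x :: "('r, 'o, 'u) formal"
  assumes \<mu>: "\<mu> \<in> ops P (length gs + 1 + length gs')" and gs: "valid_gens P gs" "valid_gens P gs'"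
    and \<nu>: "\<nu> \<in> ops P (length as + 1 + length bs)" and x: "x \<in> formals P"
  shows "formal_op P (ocomp P \<mu> (inner_ops gs @ (length as + 1 + length bs, \<nu>) # inner_ops gs'))
      (map eta (concat (map snd gs) @ as) @ x # map eta (bs @ concat (map snd gs'))) =
    formal_op P \<mu> (gens gs @ formal_op P \<nu> (map eta as @ x # map eta bs) # gens gs')"
    (is "?L x = ?R x")
proof -
  have "?L x - ?R x \<in> {0}"
  proof (rule flinear_formals_mem[OF _ fm.subspace_single_0 _ x])
    show "flinear (\<lambda>x. ?L x - ?R x)"
      by (intro flinear_minus multilinearD[OF multilinear_formal_op]
          flinear_comp[OF multilinearD[OF multilinear_formal_op]])
  next
    fix \<rho> and ws :: "'u list" assume \<rho>: "\<rho> \<in> ops P (length ws)"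
    let ?E = "map (\<lambda>u. (ounit P, [u])) :: 'u list \<Rightarrow> _" and ?U = "\<lambda>n. replicate n (1, ounit P)"
    let ?u = "map (\<lambda>(\<nu>, vs). (\<nu>, ?U (length vs))) :: ('o \<times> 'u list) list \<Rightarrow> _"
    let ?qs = "?U (length as) @ (length ws, \<rho>) # ?U (length bs)"
    let ?ts = "?u gs @ (\<nu>, ?qs) # ?u gs'"
    have u: "map (\<lambda>(\<nu>, qs). (length qs, \<nu>)) (?u hs) = inner_ops hs"
      "concat (map snd (?u hs)) = ?U (length (concat (map snd hs)))"
      for hs
      by (induction hs) (auto simp: replicate_add)
    have u': "map (\<lambda>(\<nu>, qs). (total qs, ocomp P \<nu> qs)) (?u hs) = inner_ops hs"
      if "valid_gens P hs" for hs
      using that by (induction hs) (auto simp: total_def sum_list_replicate unit_right[simplified])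
    have qs: "total ?qs = length (as @ ws @ bs)"
      by (simp add: total_def sum_list_replicate)
    have "ocomp P (ocomp P \<mu> (map (\<lambda>(\<nu>, qs). (length qs, \<nu>)) ?ts)) (concat (map snd ?ts)) =
          ocomp P \<mu> (map (\<lambda>(\<nu>, qs). (total qs, ocomp P \<nu> qs)) ?ts)"
    proof (rule comp_assoc)
      show "\<mu> \<in> ops P (length ?ts)" using \<mu> by simp
      fix \<nu>' qs assume "(\<nu>', qs) \<in> set ?ts"
      then show "\<nu>' \<in> ops P (length qs) \<and> inputs P qs"
        using gs \<nu> \<rho> by (auto simp: valid_gens_def)
    qed
    then have *: "ocomp P (ocomp P \<mu> (inner_ops gs @ (Suc (length as + length bs), \<nu>) # inner_ops gs'))
        (?U (length (concat (map snd gs) @ as)) @ (length ws, \<rho>) # ?U (length (bs @ concat (map snd gs')))) =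
      ocomp P \<mu> (inner_ops gs @ (length (as @ ws @ bs), ocomp P \<nu> ?qs) # inner_ops gs')"
      using gs by (simp add: u u' qs replicate_add del: length_concat map_map One_nat_def)
    have "?L (gen \<rho> ws) = gen (ocomp P (ocomp P \<mu> (inner_ops gs @ (length as + 1 + length bs, \<nu>) # inner_ops gs'))
        (?U (length (concat (map snd gs) @ as)) @ (length ws, \<rho>) # ?U (length (bs @ concat (map snd gs')))))
      (concat (map snd gs) @ as @ ws @ bs @ concat (map snd gs'))"
      unfolding map_eta_eq_gens formal_op_gens_insert etas_simps by simp
    also have "\<dots> = ?R (gen \<rho> ws)"
      using * unfolding map_eta_eq_gens formal_op_gens_insert etas_simps by simp
    finally show "?L (gen \<rho> ws) - ?R (gen \<rho> ws) \<in> {0}" by simp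
  qed
  then show ?thesis by simp
qed


section \<open>Derivations along linear maps\<close>

lemma flinear_formals_req:
  assumes "flinear f" and "flinear g"
    and "\<And>\<mu> us. \<mu> \<in> ops P (length us) \<Longrightarrow> req t (f (gen \<mu> us)) (g (gen \<mu> us))"
    and "x \<in> formals P"
  shows "req t (f x) (g x)"
  using flinear_formals_mem[OF flinear_minus[OF assms(1,2)] subspace_rels _ assms(4)] assms(3)
  by (simp add: req_def)

lemma flinear_rels:
  assumes f: "flinear f" and tensor: "\<And>\<rho>. \<rho> \<in> tensor_rels P s \<Longrightarrow> f \<rho> \<in> rels P t"
    and \<rho>: "\<rho> \<in> rels P s"
  shows "f \<rho> \<in> rels P t"
  by (rule flinear_span_mem[OF f subspace_rels tensor \<rho>[unfolded rels_def]])

lemma flinear_req: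
  assumes "flinear f" and "\<And>\<rho>. \<rho> \<in> rels P s \<Longrightarrow> f \<rho> \<in> rels P t" and "req s x y"
  shows "req t (f x) (f y)"
  using assms(2)[of "x - y"] assms(3) by (simp add: req_def flinear_diff[OF assms(1)])

lemma formal_map_closed: "x \<in> formals P \<Longrightarrow> formal_map h x \<in> formals P"
  by (rule flinear_formals_mem[OF flinear_formal_map subspace_formals]) (auto intro: gen_formals)

lemma formal_map_rels:
  assumes h: "module_hom s t h" and "\<rho> \<in> rels P s"
  shows "formal_map h \<rho> \<in> rels P t"
proof (rule flinear_rels[OF flinear_formal_map _ assms(2)])
  note lin = flinear_diff[OF flinear_formal_map] flinear_scale[OF flinear_formal_map]
  fix \<rho> assume "\<rho> \<in> tensor_rels P s"
  then show "formal_map h \<rho> \<in> rels P t"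
  proof cases
    case (1 \<mu> us \<nu>)
    then show ?thesis
      using tensor_rels.intros(1)[of \<mu> P "map h us" \<nu> t] by (simp add: lin tensor_rels_rels)
  next
    case (2 \<mu> us r)
    then show ?thesis
      using tensor_rels.intros(2)[of \<mu> P "map h us" r t] by (simp add: lin tensor_rels_rels)
  next
    case (3 \<mu> us ws v v')
    then show ?thesis
      using tensor_rels.intros(3)[of \<mu> P "map h us" "map h ws" "h v" "h v'" t]
      by (simp add: lin tensor_rels_rels module_hom.add[OF h])
  next
    case (4 \<mu> us ws r v)
    then show ?thesis
      using tensor_rels.intros(4)[of \<mu> P "map h us" "map h ws" t r "h v"]
      by (simp add: lin tensor_rels_rels module_hom.scale[OF h])
  next
    case (5 \<mu> us \<sigma>)
    then show ?thesis
      using tensor_rels.intros(5)[of \<mu> P "map h us" \<sigma> t]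
      by (simp add: lin tensor_rels_rels permute_list_map)
  qed
qed

text \<open>The derivation along the algebra map induced by \<open>h\<close> that has the value \<open>\<phi> u\<close> on each generator \<open>u\<close>. Besides
  the derivations of a free algebra, for which \<open>h\<close> is the identity, this covers \<open>\<delta>\<^sub>V\<close>, where \<open>h\<close> is the
  inclusion of the second summand of \<open>V \<oplus> V\<close> and \<open>\<phi> v\<close> is \<open>v\<close> in the first one.\<close>

definition der_along ::
    "('u \<Rightarrow> 'w) \<Rightarrow> ('u \<Rightarrow> ('r, 'o, 'w) formal) \<Rightarrow> ('r, 'o, 'u) formal \<Rightarrow> ('r, 'o, 'w) formal" where
  "der_along h \<phi> = lin_ext (\<lambda>(\<mu>, us). leibniz (formal_op P \<mu>) (\<lambda>u. eta (h u)) \<phi> us)"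

lemma flinear_der_along: "flinear (der_along h \<phi>)"
  by (simp add: der_along_def flinear_lin_ext)

lemma der_along_gen [simp]: "der_along h \<phi> (gen \<mu> us) = leibniz (formal_op P \<mu>) (\<lambda>u. eta (h u)) \<phi> us"
  by (simp add: der_along_def)

lemma der_along_eta: "\<phi> u \<in> formals P \<Longrightarrow> der_along h \<phi> (eta u) = \<phi> u"
  by (simp add: leibniz_Cons formal_op_unit)

lemma set_update_formals: "set xs \<subseteq> formals P \<Longrightarrow> y \<in> formals P \<Longrightarrow> set (xs[i := y]) \<subseteq> formals P"
  using set_update_subset_insert[of xs i y] by auto

lemma leibniz_closed:
  assumes "\<And>u. g u \<in> formals P" and "\<And>u. \<phi> u \<in> formals P" and "\<mu> \<in> ops P (length us)"
  shows "leibniz (formal_op P \<mu>) g \<phi> us \<in> formals P"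
  unfolding leibniz_def
  by (intro fm.subspace_sum subspace_formals formal_op_closed set_update_formals assms)
    (use assms in auto)

lemma der_along_closed:
  assumes "\<And>u. \<phi> u \<in> formals P" and "x \<in> formals P"
  shows "der_along h \<phi> x \<in> formals P"
  by (rule flinear_formals_mem[OF flinear_der_along subspace_formals _ assms(2)])
    (auto intro: leibniz_closed assms)

lemma der_along_add:
  fixes x :: "('r, 'o, 'u) formal"
  assumes "x \<in> formals P"
  shows "der_along h (\<lambda>u. \<phi> u + \<psi> u) x = der_along h \<phi> x + der_along h \<psi> x"
proof (rule flinear_formals_eq[OF flinear_der_along flinear_plus[OF flinear_der_along flinear_der_along] _ assms])
  fix \<mu> and us :: "'u list"
  show "der_along h (\<lambda>u. \<phi> u + \<psi> u) (gen \<mu> us) = der_along h \<phi> (gen \<mu> us) + der_along h \<psi> (gen \<mu> us)"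
    by (simp add: leibniz_def flinear_add[OF multilinear_update[OF multilinear_formal_op]] sum.distrib)
qed

lemma der_along_scale:
  fixes x :: "('r, 'o, 'u) formal"
  assumes "x \<in> formals P"
  shows "der_along h (\<lambda>u. fscale r (\<phi> u)) x = fscale r (der_along h \<phi> x)"
proof (rule flinear_formals_eq[OF flinear_der_along flinear_fscale[OF flinear_der_along] _ assms])
  fix \<mu> and us :: "'u list"
  show "der_along h (\<lambda>u. fscale r (\<phi> u)) (gen \<mu> us) = fscale r (der_along h \<phi> (gen \<mu> us))"
    by (simp add: leibniz_def flinear_scale[OF multilinear_update[OF multilinear_formal_op]]
        fm.scale_sum_right)
qed

lemma der_along_diff:
  "x \<in> formals P \<Longrightarrow> der_along h (\<lambda>u. \<phi> u - \<psi> u) x = der_along h \<phi> x - der_along h \<psi> x"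
  using der_along_add[of x h \<phi> "\<lambda>u. fscale (-1) (\<psi> u)"] der_along_scale[of x h "-1" \<psi>] by simp

lemma der_along_const_zero: "x \<in> formals P \<Longrightarrow> der_along h (\<lambda>u. 0) x = 0"
  using der_along_scale[of x h 0 "\<lambda>u. 0"] by simp

lemma der_along_sum:
  "x \<in> formals P \<Longrightarrow> der_along h (\<lambda>u. \<Sum>i\<in>I. \<phi> i u) x = (\<Sum>i\<in>I. der_along h (\<phi> i) x)"
  by (induction I rule: infinite_finite_induct) (simp_all add: der_along_const_zero der_along_add)

lemma formal_op_update_cong:
  assumes "set xs \<subseteq> formals P" and "req t x y" and "y \<in> formals P" and "\<mu> \<in> ops P (length xs)"
  shows "req t (formal_op P \<mu> (xs[i := x])) (formal_op P \<mu> (xs[i := y]))"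
  using assms by (intro formal_op_cong list_all2_update_cong list.rel_refl set_update_formals) auto

lemma der_along_cong:
  fixes x :: "('r, 'o, 'u) formal"
  assumes "\<And>u. req t (\<phi> u) (\<psi> u)" and "\<And>u. \<psi> u \<in> formals P" and "x \<in> formals P"
  shows "req t (der_along h \<phi> x) (der_along h \<psi> x)"
proof (rule flinear_formals_req[OF flinear_der_along flinear_der_along _ assms(3)])
  fix \<mu> and us :: "'u list" assume "\<mu> \<in> ops P (length us)"
  then show "req t (der_along h \<phi> (gen \<mu> us)) (der_along h \<psi> (gen \<mu> us))"
    unfolding der_along_gen leibniz_def by (intro req_sum formal_op_update_cong assms) auto
qed

text \<open>The choices of representatives for the values of a linear map from a module to a free algebra.\<close>

definition rlinear ::
    "('r \<Rightarrow> 'u::ab_group_add \<Rightarrow> 'u) \<Rightarrow> ('r \<Rightarrow> 'w::ab_group_add \<Rightarrow> 'w) \<Rightarrow> ('u \<Rightarrow> ('r, 'o, 'w) formal)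
      \<Rightarrow> bool" where
  "rlinear s t \<phi> \<longleftrightarrow> (\<forall>u. \<phi> u \<in> formals P) \<and> (\<forall>u v. req t (\<phi> (u + v)) (\<phi> u + \<phi> v)) \<and>
     (\<forall>r u. req t (\<phi> (s r u)) (fscale r (\<phi> u)))"

lemma rlinearD:
  assumes "rlinear s t \<phi>"
  shows "\<phi> u \<in> formals P" "req t (\<phi> (u + v)) (\<phi> u + \<phi> v)" "req t (\<phi> (s r u)) (fscale r (\<phi> u))"
  using assms by (auto simp: rlinear_def)

lemma rlinear_zero: "rlinear s t \<phi> \<Longrightarrow> \<phi> 0 \<in> rels P t"
  using req_sym[OF rlinearD(2)[of s t \<phi> 0 0]] by (simp add: req_def)

lemma rlinear_sum:
  assumes "rlinear s t \<phi>"
  shows "req t (\<phi> (\<Sum>i\<in>I. u i)) (\<Sum>i\<in>I. \<phi> (u i))"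
proof (induction I rule: infinite_finite_induct)
  case (insert i I)
  have "req t (\<phi> (u i + (\<Sum>i\<in>I. u i))) (\<phi> (u i) + \<phi> (\<Sum>i\<in>I. u i))"
    by (rule rlinearD[OF assms])
  also have "req t \<dots> (\<phi> (u i) + (\<Sum>i\<in>I. \<phi> (u i)))"
    by (intro req_add req_refl insert.IH)
  finally show ?case using insert.hyps by simp
qed (simp_all add: req_zero_iff rlinear_zero[OF assms])

lemma rlinear_flinear_comp:
  assumes \<phi>: "rlinear s t \<phi>" and f: "flinear f" "\<And>\<rho>. \<rho> \<in> rels P t \<Longrightarrow> f \<rho> \<in> rels P t'"
    "\<And>x. x \<in> formals P \<Longrightarrow> f x \<in> formals P"
  shows "rlinear s t' (\<lambda>u. f (\<phi> u))"
proof -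
  have req: "req t x y \<Longrightarrow> req t' (f x) (f y)" for x y
    by (rule flinear_req[OF f(1)]) (auto intro: f(2))
  show ?thesis
    using req[OF rlinearD(2)[OF \<phi>]] req[OF rlinearD(3)[OF \<phi>]] f(3)[OF rlinearD(1)[OF \<phi>]]
    by (simp add: rlinear_def flinear_add[OF f(1)] flinear_scale[OF f(1)])
qed

lemma rlinear_module_hom_comp:
  assumes "rlinear t t' \<phi>" and "module_hom s t h"
  shows "rlinear s t' (\<lambda>u. \<phi> (h u))"
  using assms(1) by (simp add: rlinear_def module_hom.add[OF assms(2)] module_hom.scale[OF assms(2)])

lemma rlinear_add:
  assumes "rlinear s t \<phi>" "rlinear s t \<psi>"
  shows "rlinear s t (\<lambda>u. \<phi> u + \<psi> u)"
  unfolding rlinear_def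
proof (intro conjI allI)
  fix u v r
  show "\<phi> u + \<psi> u \<in> formals P"
    by (intro fm.subspace_add subspace_formals rlinearD(1)[OF assms(1)] rlinearD(1)[OF assms(2)])
  show "req t (\<phi> (u + v) + \<psi> (u + v)) (\<phi> u + \<psi> u + (\<phi> v + \<psi> v))"
    using req_add[OF rlinearD(2)[OF assms(1)] rlinearD(2)[OF assms(2)], of u v u v]
    by (simp add: algebra_simps)
  show "req t (\<phi> (s r u) + \<psi> (s r u)) (fscale r (\<phi> u + \<psi> u))"
    using req_add[OF rlinearD(3)[OF assms(1)] rlinearD(3)[OF assms(2)], of r u r u]
    by (simp add: fm.scale_right_distrib)
qed

lemma rlinear_scale: "rlinear s t \<phi> \<Longrightarrow> rlinear s t (\<lambda>u. fscale r (\<phi> u))"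
proof (erule rlinear_flinear_comp[OF _ flinear_fscale[OF flinear_id]])
qed (auto intro: fm.subspace_scale subspace_formals subspace_rels)

lemma rlinear_diff:
  assumes "rlinear s t \<phi>" "rlinear s t \<psi>"
  shows "rlinear s t (\<lambda>u. \<phi> u - \<psi> u)"
  using rlinear_add[OF assms(1) rlinear_scale[OF assms(2), of "-1"]] by simp

lemma eta_add: "req t (eta (u + v)) (eta u + eta v)"
  using tensor_rels.intros(3)[of "ounit P" P "[]" "[]" u v t] unit_closed
  by (simp add: req_def tensor_rels_rels diff_diff_eq)

lemma eta_scale: "req t (eta (t r u)) (fscale r (eta u))"
  using tensor_rels.intros(4)[of "ounit P" P "[]" "[]" t r u] unit_closed
  by (simp add: req_def tensor_rels_rels)

lemma rlinear_eta: "rlinear t t eta"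
  by (simp add: rlinear_def eta_add eta_scale)

text \<open>The relations say that tensors are multilinear and balanced; both sides of each relation are
  differentiated term by term. For a relation in one tensor factor, the summand differentiating this
  factor is linear because \<open>\<phi>\<close> is, and the other summands are because \<open>h\<close> is.\<close>

lemma der_along_rels:
  assumes \<phi>: "rlinear s t \<phi>" and h: "module_hom s t h" and "\<rho> \<in> rels P s"
  shows "der_along h \<phi> \<rho> \<in> rels P t"
proof (rule flinear_rels[OF flinear_der_along _ assms(3)])
  note lin = flinear_diff[OF flinear_der_along] flinear_scale[OF flinear_der_along]
  let ?g = "\<lambda>u. eta (h u)"
  have g: "rlinear s t ?g" by (rule rlinear_module_hom_comp[OF rlinear_eta h])
  have wf: "set ((map ?g us)[i := \<phi> u]) \<subseteq> formals P" for us i u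
    by (rule set_update_formals) (use rlinearD(1)[OF \<phi>] in auto)
  have slot: "\<exists>L N. (\<forall>v. der_along h \<phi> (gen \<mu> (us @ v # ws)) = L (?g v) + N (\<phi> v)) \<and>
      flinear L \<and> flinear N \<and> (\<forall>\<rho>\<in>rels P t. L \<rho> \<in> rels P t \<and> N \<rho> \<in> rels P t)"
    if \<mu>: "\<mu> \<in> ops P (length us + 1 + length ws)" for \<mu> us ws
  proof -
    let ?M = "formal_op P \<mu>"
    define L where "L x = leibniz (\<lambda>l. ?M (l @ x # map ?g ws)) ?g \<phi> us +
      leibniz (\<lambda>l. ?M (map ?g us @ x # l)) ?g \<phi> ws" for x
    define N where "N x = ?M (map ?g us @ x # map ?g ws)" for x
    have "der_along h \<phi> (gen \<mu> (us @ v # ws)) = L (?g v) + N (\<phi> v)" for v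
      by (simp add: leibniz_append leibniz_Cons L_def N_def add_ac)
    moreover have "flinear L"
      unfolding L_def leibniz_def
      by (intro flinear_plus flinear_setsum multilinearD[OF multilinear_formal_op])
    moreover have "flinear N"
      unfolding N_def by (rule multilinearD[OF multilinear_formal_op])
    moreover have "L \<rho> \<in> rels P t \<and> N \<rho> \<in> rels P t" if "\<rho> \<in> rels P t" for \<rho>
      unfolding L_def N_def leibniz_def using that \<mu> wf
      by (intro conjI fm.subspace_add fm.subspace_sum subspace_rels formal_op_rels) auto
    ultimately show ?thesis by metis
  qed
  fix \<rho> assume "\<rho> \<in> tensor_rels P s"
  then show "der_along h \<phi> \<rho> \<in> rels P t"
  proof cases
    case (1 \<mu> us \<nu>)
    then have "req t (der_along h \<phi> (gen (\<mu> + \<nu>) us)) (der_along h \<phi> (gen \<mu> us) + der_along h \<phi> (gen \<nu> us))"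
      unfolding der_along_gen leibniz_def sum.distrib[symmetric]
      by (intro req_sum formal_op_add_left wf) auto
    then show ?thesis unfolding 1(1) lin req_def by (simp only: diff_diff_eq)
  next
    case (2 \<mu> us r)
    then have "req t (der_along h \<phi> (gen (oscale P r \<mu>) us)) (fscale r (der_along h \<phi> (gen \<mu> us)))"
      unfolding der_along_gen leibniz_def fm.scale_sum_right
      by (intro req_sum formal_op_scale_left wf) auto
    then show ?thesis unfolding 2(1) lin req_def .
  next
    case (3 \<mu> us ws v v')
    obtain L N where LN: "\<And>v. der_along h \<phi> (gen \<mu> (us @ v # ws)) = L (?g v) + N (\<phi> v)"
        "flinear L" "flinear N" "\<And>\<rho>. \<rho> \<in> rels P t \<Longrightarrow> L \<rho> \<in> rels P t" "\<And>\<rho>. \<rho> \<in> rels P t \<Longrightarrow> N \<rho> \<in> rels P t"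
      using slot[OF 3(2)] by metis
    have reqLN: "req t x y \<Longrightarrow> req t (L x) (L y)" "req t x y \<Longrightarrow> req t (N x) (N y)" for x y
      by (rule flinear_req[OF LN(2)], rule LN(4), assumption+)
        (rule flinear_req[OF LN(3)], rule LN(5), assumption+)
    have "req t (L (?g (v + v')) + N (\<phi> (v + v'))) (L (?g v + ?g v') + N (\<phi> v + \<phi> v'))"
      by (intro req_add reqLN rlinearD(2)[OF g] rlinearD(2)[OF \<phi>])
    then show ?thesis
      unfolding 3(1) lin LN(1) flinear_add[OF LN(2)] flinear_add[OF LN(3)] req_def
      by (simp add: algebra_simps)
  next
    case (4 \<mu> us ws r v)
    obtain L N where LN: "\<And>v. der_along h \<phi> (gen \<mu> (us @ v # ws)) = L (?g v) + N (\<phi> v)"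
        "flinear L" "flinear N" "\<And>\<rho>. \<rho> \<in> rels P t \<Longrightarrow> L \<rho> \<in> rels P t" "\<And>\<rho>. \<rho> \<in> rels P t \<Longrightarrow> N \<rho> \<in> rels P t"
      using slot[OF 4(2)] by metis
    have reqLN: "req t x y \<Longrightarrow> req t (L x) (L y)" "req t x y \<Longrightarrow> req t (N x) (N y)" for x y
      by (rule flinear_req[OF LN(2)], rule LN(4), assumption+)
        (rule flinear_req[OF LN(3)], rule LN(5), assumption+)
    have "req t (L (?g (s r v)) + N (\<phi> (s r v))) (L (fscale r (?g v)) + N (fscale r (\<phi> v)))"
      by (intro req_add reqLN rlinearD(3)[OF g] rlinearD(3)[OF \<phi>])
    then show ?thesis
      unfolding 4(1) lin LN(1) flinear_scale[OF LN(2)] flinear_scale[OF LN(3)] req_def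
      by (simp add: fm.scale_right_distrib)
  next
    case (5 \<mu> us \<sigma>)
    let ?n = "length us"
    have \<sigma>: "\<sigma> permutes {..<length (map ?g us)}" using 5 by simp
    have "der_along h \<phi> (gen (oact P ?n \<mu> \<sigma>) (permute_list \<sigma> us)) =
        (\<Sum>i<?n. formal_op P (oact P ?n \<mu> \<sigma>) (permute_list \<sigma> ((map ?g us)[\<sigma> i := \<phi> (us ! \<sigma> i)])))"
      using 5(3) permute_list_update[OF \<sigma>]
      by (simp add: leibniz_def permute_list_nth flip: permute_list_map)
    also have "req t \<dots> (\<Sum>i<?n. formal_op P \<mu> ((map ?g us)[\<sigma> i := \<phi> (us ! \<sigma> i)]))"
    proof (rule req_sum)
      fix i
      show "req t (formal_op P (oact P ?n \<mu> \<sigma>) (permute_list \<sigma> ((map ?g us)[\<sigma> i := \<phi> (us ! \<sigma> i)])))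
          (formal_op P \<mu> ((map ?g us)[\<sigma> i := \<phi> (us ! \<sigma> i)]))"
        using formal_op_permute[OF wf, of \<mu> us "\<sigma> i" "us ! \<sigma> i" \<sigma> t] 5 by simp
    qed
    also have "(\<Sum>i<?n. formal_op P \<mu> ((map ?g us)[\<sigma> i := \<phi> (us ! \<sigma> i)])) = der_along h \<phi> (gen \<mu> us)"
      unfolding der_along_gen leibniz_def
      by (rule sum.reindex_bij_betw[OF permutes_imp_bij[OF 5(3)]])
    finally show ?thesis unfolding 5(1) lin req_def .
  qed
qed

lemma der_along_req:
  "rlinear s t \<phi> \<Longrightarrow> module_hom s t h \<Longrightarrow> req s x y \<Longrightarrow> req t (der_along h \<phi> x) (der_along h \<phi> y)"
  by (rule flinear_req[OF flinear_der_along der_along_rels])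

lemma rlinear_der_along_comp:
  "rlinear s t \<phi> \<Longrightarrow> rlinear t t' \<psi> \<Longrightarrow> module_hom t t' h \<Longrightarrow> rlinear s t' (\<lambda>u. der_along h \<psi> (\<phi> u))"
  by (rule rlinear_flinear_comp[OF _ flinear_der_along der_along_rels])
    (auto intro: der_along_closed rlinearD)

lemma rlinear_formal_map_comp:
  "rlinear s t \<phi> \<Longrightarrow> module_hom t t' h \<Longrightarrow> rlinear s t' (\<lambda>u. formal_map h (\<phi> u))"
  by (rule rlinear_flinear_comp[OF _ flinear_formal_map formal_map_rels]) (auto intro: formal_map_closed)

text \<open>By multilinearity the Leibniz rule need only be checked for \<open>\<mu>(\<nu>\<^sub>1 \<otimes> v\<^sub>1, \<dots>, \<nu>\<^sub>n \<otimes> v\<^sub>n)\<close>,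
  which is a single tensor over the concatenation of the \<open>v\<^sub>i\<close>. Differentiating it entry by entry and
  collecting the entries of each \<open>v\<^sub>i\<close> gives the claim by associativity.\<close>

theorem der_along_formal_op:
  fixes xs :: "('r, 'o, 'u) formal list"
  assumes \<phi>: "\<And>u. \<phi> u \<in> formals P" and xs: "set xs \<subseteq> formals P" and \<mu>: "\<mu> \<in> ops P (length xs)"
  shows "der_along h \<phi> (formal_op P \<mu> xs) = leibniz (formal_op P \<mu>) (formal_map h) (der_along h \<phi>) xs"
proof (rule multilinear_formals_eq[OF _ _ _ xs refl])
  show "multilinear (\<lambda>xs. der_along h \<phi> (formal_op P \<mu> xs))"
    by (rule multilinear_comp[OF flinear_der_along multilinear_formal_op])
  show "multilinear (leibniz (formal_op P \<mu>) (formal_map h) (der_along h \<phi>))"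
    by (rule multilinear_leibniz[OF multilinear_formal_op flinear_formal_map flinear_der_along])
  fix gs :: "('o \<times> 'u list) list"
  assume n: "length gs = length xs" and gs: "valid_gens P gs"
  let ?g = "\<lambda>u. eta (h u)" and ?vss = "map snd gs"
  let ?G = "map (\<lambda>(\<nu>, vs). (\<nu>, map h vs)) :: ('o \<times> 'u list) list \<Rightarrow> _"
  have G: "valid_gens P (?G hs)" "inner_ops (?G hs) = inner_ops hs"
      "concat (map snd (?G hs)) = map h (concat (map snd hs))" if "valid_gens P hs" for hs
    using that by (induction hs) auto
  have "der_along h \<phi> (formal_op P \<mu> (gens gs)) = leibniz (formal_op P (ocomp P \<mu> (inner_ops gs))) ?g \<phi> (concat ?vss)"
    by (simp add: formal_op_gens)
  also have "\<dots> = (\<Sum>i<length gs. leibniz (\<lambda>l. formal_op P (ocomp P \<mu> (inner_ops gs))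
      (map ?g (concat (take i ?vss)) @ l @ map ?g (concat (drop (Suc i) ?vss)))) ?g \<phi> (?vss ! i))"
    by (simp add: leibniz_concat)
  also have "\<dots> = (\<Sum>i<length gs. formal_op P \<mu> ((map (formal_map h) (gens gs))[i := der_along h \<phi> (gens gs ! i)]))"
  proof (rule sum.cong[OF refl])
    fix i assume "i \<in> {..<length gs}"
    then have i: "i < length gs" by simp
    obtain \<nu> vs where \<nu>: "gs ! i = (\<nu>, vs)" by fastforce
    define as bs where "as = take i gs" and "bs = drop (Suc i) gs"
    have gs_split: "gs = as @ (\<nu>, vs) # bs"
      using id_take_nth_drop[OF i] \<nu> by (simp add: as_def bs_def)
    have valid: "valid_gens P as" "valid_gens P bs" "\<nu> \<in> ops P (length vs)"
      using gs by (simp_all add: gs_split)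
    have len: "\<mu> \<in> ops P (length as + 1 + length bs)"
      using \<mu> n by (simp add: gs_split)
    have "leibniz (\<lambda>l. formal_op P (ocomp P \<mu> (inner_ops gs))
        (map ?g (concat (map snd as)) @ l @ map ?g (concat (map snd bs)))) ?g \<phi> vs =
      leibniz (\<lambda>l. formal_op P \<mu> (gens (?G as) @ formal_op P \<nu> l # gens (?G bs))) ?g \<phi> vs"
    proof (rule leibniz_cong)
      fix cs v ds assume vs: "vs = cs @ v # ds"
      show "formal_op P (ocomp P \<mu> (inner_ops gs)) (map ?g (concat (map snd as)) @
          (map ?g cs @ \<phi> v # map ?g ds) @ map ?g (concat (map snd bs))) =
        formal_op P \<mu> (gens (?G as) @ formal_op P \<nu> (map ?g cs @ \<phi> v # map ?g ds) # gens (?G bs))"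
        using formal_op_insert[of \<mu> "?G as" "?G bs" \<nu> "map h cs" "map h ds" "\<phi> v"] len valid vs \<phi> 
        by (simp add: G gs_split del: map_map) (simp add: comp_def)
    qed
    also have "\<dots> = formal_op P \<mu> (gens (?G as) @ leibniz (formal_op P \<nu>) ?g \<phi> vs # gens (?G bs))"
      by (rule flinear_leibniz[OF multilinearD[OF multilinear_formal_op], symmetric])
    also have "gens (?G as) @ leibniz (formal_op P \<nu>) ?g \<phi> vs # gens (?G bs) =
        (map (formal_map h) (gens gs))[i := der_along h \<phi> (gens gs ! i)]"
      using i by (simp add: upd_conv_take_nth_drop as_def bs_def \<nu> take_map drop_map comp_def case_prod_beta)
    finally show "leibniz (\<lambda>l. formal_op P (ocomp P \<mu> (inner_ops gs))
        (map ?g (concat (take i ?vss)) @ l @ map ?g (concat (drop (Suc i) ?vss)))) ?g \<phi> (?vss ! i) =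
      formal_op P \<mu> ((map (formal_map h) (gens gs))[i := der_along h \<phi> (gens gs ! i)])"
      using i by (simp add: as_def bs_def \<nu> take_map drop_map)
  qed
  also have "\<dots> = leibniz (formal_op P \<mu>) (formal_map h) (der_along h \<phi>) (gens gs)"
    by (simp add: leibniz_def)
  finally show "der_along h \<phi> (formal_op P \<mu> (gens gs)) =
      leibniz (formal_op P \<mu>) (formal_map h) (der_along h \<phi>) (gens gs)" .
qed

text \<open>The commutator of two derivations is a derivation, hence determined by its values on generators: the
  terms in which two different tensor factors are differentiated occur in both composites and cancel. Since
  \<open>\<psi>\<close> leads from one free algebra to another, the other derivation is given on both sides, as \<open>\<phi>\<close> and as
  \<open>\<phi>'\<close>, which correspond to each other under \<open>h\<close>.\<close>

theorem der_along_commutator: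
  fixes x :: "('r, 'o, 'u) formal"
  assumes \<phi>: "\<And>u. \<phi> u \<in> formals P" and \<psi>: "\<And>u. \<psi> u \<in> formals P" and \<phi>': "\<And>w. \<phi>' w \<in> formals P"
    and rel: "\<And>u. req t (\<phi>' (h u)) (formal_map h (\<phi> u))" and x: "x \<in> formals P"
  shows "req t (der_along h \<psi> (der_along (\<lambda>u. u) \<phi> x) - der_along (\<lambda>w. w) \<phi>' (der_along h \<psi> x))
    (der_along h (\<lambda>u. der_along h \<psi> (\<phi> u) - der_along (\<lambda>w. w) \<phi>' (\<psi> u)) x)"
proof (rule flinear_formals_req[OF _ flinear_der_along _ x])
  show "flinear (\<lambda>x. der_along h \<psi> (der_along (\<lambda>u. u) \<phi> x) - der_along (\<lambda>w. w) \<phi>' (der_along h \<psi> x))"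
    by (intro flinear_minus flinear_comp[OF flinear_der_along flinear_der_along])
  fix \<mu> and us :: "'u list" assume \<mu>: "\<mu> \<in> ops P (length us)"
  let ?n = "length us" and ?w = "map (\<lambda>u. eta (h u)) us"
  \<comment> \<open>\<open>A i j\<close> collects the terms with two differentiated factors, \<open>B\<close> and \<open>C\<close> those in which one factor is
    differentiated twice.\<close>
  define A where "A i j = formal_op P \<mu> (?w[i := formal_map h (\<phi> (us ! i)), j := \<psi> (us ! j)])" for i j
  define B where "B i = formal_op P \<mu> (?w[i := der_along h \<psi> (\<phi> (us ! i))])" for i
  define C where "C j = formal_op P \<mu> (?w[j := der_along (\<lambda>w. w) \<phi>' (\<psi> (us ! j))])" for j
  define S where "S = (\<Sum>i<?n. \<Sum>j<?n. if i = j then 0 else A i j)"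
  have sum_split: "(\<Sum>j<?n. if i = j then X else Y j) = (\<Sum>j<?n. if i = j then 0 else Y j) + X"
    if "i < ?n" for i X and Y :: "nat \<Rightarrow> ('r, 'o, 'b) formal"
    using that sum.remove[of "{..<?n}" i "\<lambda>j. if i = j then X else Y j"]
      sum.remove[of "{..<?n}" i "\<lambda>j. if i = j then 0 else Y j"]
    by (simp add: add.commute)
  have wf: "set (map eta vs) \<subseteq> formals P" for vs by auto
  have "der_along h \<psi> (der_along (\<lambda>u. u) \<phi> (gen \<mu> us)) =
      (\<Sum>i<?n. der_along h \<psi> (formal_op P \<mu> ((map eta us)[i := \<phi> (us ! i)])))"
    by (simp add: leibniz_def flinear_sum[OF flinear_der_along])
  also have "\<dots> = (\<Sum>i<?n. \<Sum>j<?n. if i = j then B i else A i j)"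
  proof (rule sum.cong[OF refl])
    fix i assume i: "i \<in> {..<?n}"
    have "der_along h \<psi> (formal_op P \<mu> ((map eta us)[i := \<phi> (us ! i)])) =
        leibniz (formal_op P \<mu>) (formal_map h) (der_along h \<psi>) ((map eta us)[i := \<phi> (us ! i)])"
      by (rule der_along_formal_op[OF \<psi> set_update_formals]) (use \<mu> \<phi> in auto)
    also have "\<dots> = (\<Sum>j<?n. if i = j then B i else A i j)"
      unfolding leibniz_def using i
      by (intro sum.cong) (auto simp: A_def B_def map_update comp_def der_along_eta \<psi> nth_list_update
          simp del: der_along_gen)
    finally show "der_along h \<psi> (formal_op P \<mu> ((map eta us)[i := \<phi> (us ! i)])) = \<dots>" .
  qed
  also have "\<dots> = S + (\<Sum>i<?n. B i)"
    unfolding S_def sum.distrib[symmetric] by (rule sum.cong[OF refl]) (rule sum_split, simp)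
  finally have 1: "der_along h \<psi> (der_along (\<lambda>u. u) \<phi> (gen \<mu> us)) = S + (\<Sum>i<?n. B i)" .
  have "der_along (\<lambda>w. w) \<phi>' (der_along h \<psi> (gen \<mu> us)) =
      (\<Sum>j<?n. der_along (\<lambda>w. w) \<phi>' (formal_op P \<mu> (?w[j := \<psi> (us ! j)])))"
    by (simp add: leibniz_def flinear_sum[OF flinear_der_along])
  also have "req t \<dots> (\<Sum>j<?n. \<Sum>i<?n. if j = i then C j else A i j)"
  proof (rule req_sum)
    fix j assume j: "j \<in> {..<?n}"
    have "der_along (\<lambda>w. w) \<phi>' (formal_op P \<mu> (?w[j := \<psi> (us ! j)])) =
        leibniz (formal_op P \<mu>) (formal_map (\<lambda>w. w)) (der_along (\<lambda>w. w) \<phi>') (?w[j := \<psi> (us ! j)])"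
      by (rule der_along_formal_op[OF \<phi>' set_update_formals]) (use \<mu> \<psi> in auto)
    also have "req t \<dots> (\<Sum>i<?n. if j = i then C j else A i j)"
      unfolding leibniz_def length_list_update length_map
    proof (rule req_sum)
      fix i assume i: "i \<in> {..<?n}"
      show "req t (formal_op P \<mu> ((map (formal_map (\<lambda>w. w)) (?w[j := \<psi> (us ! j)]))
            [i := der_along (\<lambda>w. w) \<phi>' (?w[j := \<psi> (us ! j)] ! i)])) (if j = i then C j else A i j)"
      proof (cases "j = i")
        case True
        then show ?thesis using i by (simp add: C_def)
      next
        case False
        have "req t (formal_op P \<mu> (?w[j := \<psi> (us ! j), i := \<phi>' (h (us ! i))]))
            (formal_op P \<mu> (?w[j := \<psi> (us ! j), i := formal_map h (\<phi> (us ! i))]))"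
          by (rule formal_op_update_cong[OF set_update_formals])
            (use \<mu> \<psi> \<phi> rel in \<open>auto intro: formal_map_closed\<close>)
        then show ?thesis using False i
          by (simp add: A_def list_update_swap der_along_eta \<phi>' del: der_along_gen)
      qed
    qed
    finally show "req t (der_along (\<lambda>w. w) \<phi>' (formal_op P \<mu> (?w[j := \<psi> (us ! j)]))) \<dots>" .
  qed
  also have "(\<Sum>j<?n. \<Sum>i<?n. if j = i then C j else A i j) =
      (\<Sum>j<?n. \<Sum>i<?n. if j = i then 0 else A i j) + (\<Sum>j<?n. C j)"
    unfolding sum.distrib[symmetric] by (rule sum.cong[OF refl]) (rule sum_split, simp)
  also have "(\<Sum>j<?n. \<Sum>i<?n. if j = i then 0 else A i j) = S"
    unfolding S_def by (subst sum.swap) (intro sum.cong refl, auto)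
  finally have 2: "req t (der_along (\<lambda>w. w) \<phi>' (der_along h \<psi> (gen \<mu> us))) (S + (\<Sum>j<?n. C j))" .
  have "der_along h (\<lambda>u. der_along h \<psi> (\<phi> u) - der_along (\<lambda>w. w) \<phi>' (\<psi> u)) (gen \<mu> us) = (\<Sum>i<?n. B i) - (\<Sum>i<?n. C i)"
    by (simp add: leibniz_def B_def C_def sum_subtractf
        flinear_diff[OF multilinear_update[OF multilinear_formal_op]])
  then show "req t (der_along h \<psi> (der_along (\<lambda>u. u) \<phi> (gen \<mu> us)) - der_along (\<lambda>w. w) \<phi>' (der_along h \<psi> (gen \<mu> us)))
      (der_along h (\<lambda>u. der_along h \<psi> (\<phi> u) - der_along (\<lambda>w. w) \<phi>' (\<psi> u)) (gen \<mu> us))"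
    using req_diff[OF req_refl 2, of "S + (\<Sum>i<?n. B i)"] 1 by (simp del: der_along_gen)
qed


section \<open>Derivations of the free algebra\<close>

lemma mem_cls_iff: "y \<in> cls P t x \<longleftrightarrow> req t y x"
proof -
  have "y \<in> cls P t x \<longleftrightarrow> (\<exists>b\<in>rels P t. y = x + b)"
    by (simp add: cls_def elt_set_plus_def)
  also have "\<dots> \<longleftrightarrow> y - x \<in> rels P t"
    by (metis add.commute diff_add_cancel add_diff_cancel_left')
  finally show ?thesis by (simp add: req_def)
qed

lemma cls_eq_iff: "cls P t x = cls P t y \<longleftrightarrow> req t x y"
proof
  assume "cls P t x = cls P t y"
  then show "req t x y" by (metis mem_cls_iff req_refl)
next
  assume "req t x y"
  then show "cls P t x = cls P t y"
    by (intro set_eqI) (metis mem_cls_iff req_trans req_sym)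
qed

lemma rels_eq_cls: "rels P t = cls P t 0"
  by (auto simp: mem_cls_iff req_zero_iff)

lemma cls_add: "cls P t x + cls P t y = cls P t (x + y)"
proof (rule set_eqI, rule iffI)
  fix z assume "z \<in> cls P t x + cls P t y"
  then show "z \<in> cls P t (x + y)" by (auto simp: set_plus_def mem_cls_iff intro: req_add)
next
  fix z assume "z \<in> cls P t (x + y)"
  then have "z - y \<in> cls P t x" by (simp add: mem_cls_iff req_def algebra_simps)
  moreover have "y \<in> cls P t y" by (simp add: mem_cls_iff)
  moreover have "z = (z - y) + y" by simp
  ultimately show "z \<in> cls P t x + cls P t y"
    unfolding set_plus_def by blast
qed

lemma cls_diff: "coset_diff (cls P t x) (cls P t y) = cls P t (x - y)"
proof (rule set_eqI, rule iffI)
  fix z assume "z \<in> coset_diff (cls P t x) (cls P t y)"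
  then show "z \<in> cls P t (x - y)" by (auto simp: coset_diff_def mem_cls_iff intro: req_diff)
next
  fix z assume "z \<in> cls P t (x - y)"
  then have "z + y \<in> cls P t x" by (simp add: mem_cls_iff req_def algebra_simps)
  moreover have "y \<in> cls P t y" by (simp add: mem_cls_iff)
  moreover have "z = (z + y) - y" by simp
  ultimately show "z \<in> coset_diff (cls P t x) (cls P t y)"
    unfolding coset_diff_def by blast
qed

text \<open>How a map of formal sums that respects the relations acts on cosets; the constructions on the free
  algebra that are given by representatives all have the form of the left-hand side.\<close>

lemma image_cls:
  assumes "\<And>y. req s y x \<Longrightarrow> req t (f y) (f x)"
  shows "f ` cls P s x + rels P t = cls P t (f x)"
proof (rule set_eqI, rule iffI)
  fix z assume "z \<in> f ` cls P s x + rels P t"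
  then obtain y \<rho> where "req s y x" "req t \<rho> 0" "z = f y + \<rho>"
    by (auto simp: set_plus_def mem_cls_iff req_zero_iff)
  then show "z \<in> cls P t (f x)"
    using req_add[OF assms, of y \<rho> 0] by (simp add: mem_cls_iff)
next
  fix z assume "z \<in> cls P t (f x)"
  then have "z - f x \<in> rels P t" by (simp add: mem_cls_iff req_def)
  moreover have "z = f x + (z - f x)" by simp
  moreover have "x \<in> cls P s x" by (simp add: mem_cls_iff)
  ultimately show "z \<in> f ` cls P s x + rels P t"
    unfolding set_plus_def by blast
qed

lemma coset_scale_cls: "coset_scale P t r (cls P t x) = cls P t (fscale r x)"
  unfolding coset_scale_def by (rule image_cls) (rule req_scale)

lemma cls_sum: "rels P t + (\<Sum>i\<in>I. cls P t (f i)) = cls P t (\<Sum>i\<in>I. f i)"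
proof (induction I rule: infinite_finite_induct)
  case (insert i I)
  have "rels P t + (\<Sum>j\<in>insert i I. cls P t (f j)) = cls P t (f i) + (rels P t + (\<Sum>j\<in>I. cls P t (f j)))"
    using insert.hyps by (simp add: add.left_commute)
  with insert show ?case by (simp only: insert.IH cls_add) simp
qed (simp_all add: rels_eq_cls)

lemma listset_map_cls: "ys \<in> listset (map (cls P t) xs) \<longleftrightarrow> list_all2 (req t) ys xs"
  by (induction xs arbitrary: ys) (auto simp: set_Cons_def mem_cls_iff list_all2_Cons2)

text \<open>By definition the operation is evaluated on all choices of representatives at once; by \<open>formal_op_cong\<close>
  they give the same coset.\<close>

lemma free_op_cls:
  assumes "set xs \<subseteq> formals P" and "\<mu> \<in> ops P (length xs)"
  shows "free_op P t \<mu> (map (cls P t) xs) = cls P t (formal_op P \<mu> xs)"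
proof (rule set_eqI, rule iffI)
  fix z assume "z \<in> free_op P t \<mu> (map (cls P t) xs)"
  then obtain ys \<rho> where ys: "list_all2 (req t) ys xs" and "req t \<rho> 0" "z = formal_op P \<mu> ys + \<rho>"
    by (auto simp: free_op_def set_plus_def listset_map_cls req_zero_iff)
  moreover have "req t (formal_op P \<mu> ys) (formal_op P \<mu> xs)"
    using assms list_all2_lengthD[OF ys] by (intro formal_op_cong ys) auto
  ultimately show "z \<in> cls P t (formal_op P \<mu> xs)"
    using req_add[of t "formal_op P \<mu> ys" _ \<rho> 0] by (simp add: mem_cls_iff)
next
  fix z assume "z \<in> cls P t (formal_op P \<mu> xs)"
  then have "z - formal_op P \<mu> xs \<in> rels P t" by (simp add: mem_cls_iff req_def)
  moreover have "xs \<in> listset (map (cls P t) xs)"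
    by (simp add: listset_map_cls list.rel_refl)
  moreover have "z = formal_op P \<mu> xs + (z - formal_op P \<mu> xs)" by simp
  ultimately show "z \<in> free_op P t \<mu> (map (cls P t) xs)"
    unfolding free_op_def set_plus_def by blast
qed

lemma cls_free_alg [simp]: "x \<in> formals P \<Longrightarrow> cls P t x \<in> free_alg P t"
  by (simp add: free_alg_def)

lemma free_algE:
  assumes "A \<in> free_alg P t"
  obtains x where "x \<in> formals P" "A = cls P t x"
  using assms by (auto simp: free_alg_def)

lemma free_alg_listE:
  assumes "set As \<subseteq> free_alg P t"
  obtains xs where "set xs \<subseteq> formals P" "As = map (cls P t) xs"
proof -
  have "As \<in> lists (cls P t ` formals P)" using assms by (auto simp: free_alg_def)
  then show ?thesis using that by (auto simp: lists_image)
qed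

lemma endo_eqI:
  assumes "f \<in> extensional (free_alg P t)" "g \<in> extensional (free_alg P t)"
    and "\<And>x. x \<in> formals P \<Longrightarrow> f (cls P t x) = g (cls P t x)"
  shows "f = g"
  by (rule extensionalityI[OF assms(1,2)]) (auto elim!: free_algE simp: assms(3))

text \<open>The derivation with given values on generators, by a formula on representatives. It agrees with \<open>der_of\<close>, and
  all derivations have this form, so identities of derivations can be checked on formal sums.\<close>

definition der_lift ::
    "('r \<Rightarrow> 'u::ab_group_add \<Rightarrow> 'u) \<Rightarrow> ('u \<Rightarrow> ('r, 'o, 'u) formal) \<Rightarrow> ('r, 'o, 'u) endo" where
  "der_lift t \<phi> = (\<lambda>A\<in>free_alg P t. der_along (\<lambda>u. u) \<phi> ` A + rels P t)"

lemma der_lift_extensional [simp]: "der_lift t \<phi> \<in> extensional (free_alg P t)"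
  by (simp add: der_lift_def)

lemma module_hom_self: "module t \<Longrightarrow> module_hom t t (\<lambda>u. u)"
  by (simp add: module_hom_iff)

lemma der_lift_cls:
  assumes "module t" and "rlinear t t \<phi>" and "x \<in> formals P"
  shows "der_lift t \<phi> (cls P t x) = cls P t (der_along (\<lambda>u. u) \<phi> x)"
  using assms(3) unfolding der_lift_def
  by (simp add: image_cls der_along_req[OF assms(2) module_hom_self[OF assms(1)]])

lemma der_lift_incl:
  assumes "module t" and "rlinear t t \<phi>"
  shows "der_lift t \<phi> (incl P t u) = cls P t (\<phi> u)"
  by (simp add: incl_def der_lift_cls[OF assms] der_along_eta rlinearD(1)[OF assms(2)] del: der_along_gen)

lemma der_lift_Der:
  assumes t: "module t" and \<phi>: "rlinear t t \<phi>"
  shows "der_lift t \<phi> \<in> Der P t"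
proof -
  let ?d = "der_lift t \<phi>" and ?f = "der_along (\<lambda>u. u) \<phi>"
  note d = der_lift_cls[OF t \<phi>]
  have closed: "?f x \<in> formals P" if "x \<in> formals P" for x
    by (rule der_along_closed[OF rlinearD(1)[OF \<phi>] that])
  have m1: "?d \<in> free_alg P t \<rightarrow>\<^sub>E free_alg P t"
    by (auto simp: PiE_iff d closed elim!: free_algE)
  have m2: "?d (A + B) = ?d A + ?d B" if A: "A \<in> free_alg P t" and B: "B \<in> free_alg P t" for A B
  proof -
    obtain x where "x \<in> formals P" "A = cls P t x" using A by (rule free_algE)
    moreover obtain y where "y \<in> formals P" "B = cls P t y" using B by (rule free_algE)
    ultimately show ?thesis
      by (simp add: cls_add d fm.subspace_add subspace_formals flinear_add[OF flinear_der_along])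
  qed
  have m3: "?d (coset_scale P t r A) = coset_scale P t r (?d A)" if A: "A \<in> free_alg P t" for r A
  proof -
    obtain x where "x \<in> formals P" "A = cls P t x" using A by (rule free_algE)
    then show ?thesis
      by (simp add: coset_scale_cls d fm.subspace_scale subspace_formals flinear_scale[OF flinear_der_along])
  qed
  have m4: "?d (free_op P t \<mu> As) = rels P t + (\<Sum>i<length As. free_op P t \<mu> (As[i := ?d (As ! i)]))"
    if \<mu>: "\<mu> \<in> ops P (length As)" and "set As \<subseteq> free_alg P t" for \<mu> As
  proof -
    obtain xs where xs: "set xs \<subseteq> formals P" and As: "As = map (cls P t) xs"
      using \<open>set As \<subseteq> _\<close> by (rule free_alg_listE)
    have \<mu>: "\<mu> \<in> ops P (length xs)" using \<mu> As by simp
    have "?d (free_op P t \<mu> As) = cls P t (leibniz (formal_op P \<mu>) (\<lambda>x. x) ?f xs)"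
      using der_along_formal_op[OF rlinearD(1)[OF \<phi>] xs \<mu>, where h = "\<lambda>u. u"]
      by (simp add: As free_op_cls xs \<mu> d formal_op_closed)
    also have "\<dots> = rels P t + (\<Sum>i<length xs. cls P t (formal_op P \<mu> (xs[i := ?f (xs ! i)])))"
      by (simp add: leibniz_def cls_sum)
    also have "(\<Sum>i<length xs. cls P t (formal_op P \<mu> (xs[i := ?f (xs ! i)]))) =
        (\<Sum>i<length As. free_op P t \<mu> (As[i := ?d (As ! i)]))"
    proof (rule sum.cong)
      fix i assume "i \<in> {..<length As}"
      then have i: "i < length xs" by (simp add: As)
      with xs have xi: "xs ! i \<in> formals P" by auto
      have "free_op P t \<mu> (map (cls P t) (xs[i := ?f (xs ! i)])) = cls P t (formal_op P \<mu> (xs[i := ?f (xs ! i)]))"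
        by (rule free_op_cls) (use \<mu> in \<open>simp_all add: set_update_formals xs closed xi\<close>)
      then show "cls P t (formal_op P \<mu> (xs[i := ?f (xs ! i)])) = free_op P t \<mu> (As[i := ?d (As ! i)])"
        using i xi by (simp add: As map_update d)
    qed (simp add: As)
    finally show ?thesis .
  qed
  show ?thesis
    unfolding Der_def
    by (intro CollectI conjI ballI allI impI; (elim conjE)?) (rule m1 m2 m3 m4; assumption)+
qed

lemma der_lift_cong:
  assumes t: "module t" and "rlinear t t \<phi>" "rlinear t t \<psi>" and "\<And>u. req t (\<phi> u) (\<psi> u)"
  shows "der_lift t \<phi> = der_lift t \<psi>"
  by (rule endo_eqI[of _ t])
    (simp_all add: der_lift_cls[OF t] assms cls_eq_iff der_along_cong rlinearD(1)[OF assms(3)])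

text \<open>Every element of the free algebra is a sum of values \<open>\<mu>(v\<^sub>1, \<dots>, v\<^sub>n)\<close> on generators, so the
  Leibniz rule leaves no choice once the derivation is known on the generators.\<close>

lemma Der_obtain_lift:
  assumes t: "module t" and d: "d \<in> Der P t"
  obtains \<phi> where "rlinear t t \<phi>" "d = der_lift t \<phi>"
proof -
  have ext: "d \<in> free_alg P t \<rightarrow>\<^sub>E free_alg P t"
    and add: "\<And>A B. A \<in> free_alg P t \<Longrightarrow> B \<in> free_alg P t \<Longrightarrow> d (A + B) = d A + d B"
    and scale: "\<And>r A. A \<in> free_alg P t \<Longrightarrow> d (coset_scale P t r A) = coset_scale P t r (d A)"
    and Leibniz: "\<And>\<mu> As. \<mu> \<in> ops P (length As) \<Longrightarrow> set As \<subseteq> free_alg P t \<Longrightarrow>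
      d (free_op P t \<mu> As) = rels P t + (\<Sum>i<length As. free_op P t \<mu> (As[i := d (As ! i)]))"
    using d by (auto simp: Der_def)
  have "\<exists>x. x \<in> formals P \<and> d (cls P t (eta u)) = cls P t x" for u
    by (rule free_algE[OF PiE_mem[OF ext cls_free_alg[OF eta_formals]]]) auto
  then obtain \<phi> where \<phi>: "\<And>u. \<phi> u \<in> formals P" "\<And>u. d (cls P t (eta u)) = cls P t (\<phi> u)"
    by metis
  have lin: "rlinear t t \<phi>"
    unfolding rlinear_def
  proof (intro conjI allI \<phi>)
    fix u v r
    have "cls P t (\<phi> (u + v)) = d (cls P t (eta u) + cls P t (eta v))"
      by (simp add: cls_add cls_eq_iff[THEN iffD2, OF eta_add] flip: \<phi>)
    then show "req t (\<phi> (u + v)) (\<phi> u + \<phi> v)"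
      by (subst (asm) add) (simp_all add: \<phi> cls_add cls_eq_iff)
    have "cls P t (\<phi> (t r u)) = d (coset_scale P t r (cls P t (eta u)))"
      by (simp add: coset_scale_cls cls_eq_iff[THEN iffD2, OF eta_scale] flip: \<phi>)
    then show "req t (\<phi> (t r u)) (fscale r (\<phi> u))"
      by (subst (asm) scale) (simp_all add: \<phi> coset_scale_cls cls_eq_iff)
  qed
  let ?f = "der_along (\<lambda>u. u) \<phi>"
  let ?S = "{x \<in> formals P. d (cls P t x) = cls P t (?f x)}"
  have "fm.subspace ?S"
  proof (rule fm.subspaceI)
    obtain y where "d (cls P t 0) = cls P t y"
      using PiE_mem[OF ext cls_free_alg[OF zero_formals]] by (rule free_algE)
    then show "0 \<in> ?S"
      using scale[of "cls P t 0" 0] by (simp add: coset_scale_cls flinear_zero[OF flinear_der_along])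
  next
    fix x y assume "x \<in> ?S" "y \<in> ?S"
    then show "x + y \<in> ?S"
      using add[of "cls P t x" "cls P t y"]
      by (simp add: cls_add fm.subspace_add subspace_formals flinear_add[OF flinear_der_along])
  next
    fix x r assume "x \<in> ?S"
    then show "fscale r x \<in> ?S"
      using scale[of "cls P t x" r]
      by (simp add: coset_scale_cls fm.subspace_scale subspace_formals flinear_scale[OF flinear_der_along])
  qed
  moreover have "gen \<mu> us \<in> ?S" if \<mu>: "\<mu> \<in> ops P (length us)" for \<mu> us
  proof -
    have "d (cls P t (gen \<mu> us)) = d (free_op P t \<mu> (map (cls P t) (map eta us)))"
      using \<mu> by (simp add: free_op_cls[OF set_map_eta] formal_op_etas del: map_map)
    also have "\<dots> = rels P t +
        (\<Sum>i<length us. free_op P t \<mu> ((map (cls P t) (map eta us))[i := cls P t (\<phi> (us ! i))]))"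
      using \<mu> by (subst Leibniz) (auto simp: \<phi> intro!: arg_cong2[of _ _ _ _ "(+)"] sum.cong)
    also have "\<dots> = rels P t + (\<Sum>i<length us. cls P t (formal_op P \<mu> ((map eta us)[i := \<phi> (us ! i)])))"
      using \<mu> by (simp add: free_op_cls[OF set_update_formals[OF set_map_eta \<phi>(1)]] del: map_map flip: map_update)
    finally have "d (cls P t (gen \<mu> us)) = cls P t (?f (gen \<mu> us))"
      by (simp add: cls_sum leibniz_def)
    then show ?thesis using \<mu> by (simp add: gen_formals)
  qed
  ultimately have "x \<in> ?S" if "x \<in> formals P" for x
    using flinear_formals_mem[OF flinear_id _ _ that, of ?S] by blast
  then have "d = der_lift t \<phi>"
    using ext by (intro endo_eqI[of _ t]) (auto simp: der_lift_cls[OF t lin] PiE_def)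
  with lin show ?thesis by (rule that)
qed

lemma der_of_cls:
  assumes t: "module t" and \<phi>: "rlinear t t \<phi>"
  shows "der_of P t (\<lambda>u. cls P t (\<phi> u)) = der_lift t \<phi>"
  unfolding der_of_def
proof (rule the_equality)
  show "der_lift t \<phi> \<in> Der P t \<and> (\<forall>u. der_lift t \<phi> (incl P t u) = cls P t (\<phi> u))"
    by (simp add: der_lift_Der der_lift_incl t \<phi>)
  fix d assume d: "d \<in> Der P t \<and> (\<forall>u. d (incl P t u) = cls P t (\<phi> u))"
  then obtain \<psi> where \<psi>: "rlinear t t \<psi>" "d = der_lift t \<psi>"
    using Der_obtain_lift[OF t] by blast
  with d have "req t (\<psi> u) (\<phi> u)" for u
    by (simp add: der_lift_incl[OF t] flip: cls_eq_iff)
  with \<psi> show "d = der_lift t \<phi>" by (simp add: der_lift_cong[OF t _ \<phi>])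
qed

lemma der_zero_eq: "module t \<Longrightarrow> der_zero P t = der_lift t (\<lambda>u. 0)"
  by (rule endo_eqI[of _ t])
    (simp_all add: der_zero_def der_lift_cls rlinear_def der_along_const_zero rels_eq_cls)

lemma der_add_lift:
  assumes t: "module t" and "rlinear t t \<phi>" "rlinear t t \<psi>"
  shows "der_add P t (der_lift t \<phi>) (der_lift t \<psi>) = der_lift t (\<lambda>u. \<phi> u + \<psi> u)"
  by (rule endo_eqI[of _ t])
    (simp_all add: der_add_def der_lift_cls[OF t] assms rlinear_add der_along_add cls_add)

lemma der_scale_lift:
  assumes t: "module t" and "rlinear t t \<phi>"
  shows "der_scale P t r (der_lift t \<phi>) = der_lift t (\<lambda>u. fscale r (\<phi> u))"
  by (rule endo_eqI[of _ t])
    (simp_all add: der_scale_def der_lift_cls[OF t] assms rlinear_scale der_along_scale coset_scale_cls)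

lemma der_diff_lift:
  assumes t: "module t" and "rlinear t t \<phi>" "rlinear t t \<psi>"
  shows "der_diff P t (der_lift t \<phi>) (der_lift t \<psi>) = der_lift t (\<lambda>u. \<phi> u - \<psi> u)"
  by (rule endo_eqI[of _ t])
    (simp_all add: der_diff_def der_lift_cls[OF t] assms rlinear_diff der_along_diff cls_diff)

lemma pre_lie_lift:
  assumes t: "module t" and \<phi>: "rlinear t t \<phi>" and \<psi>: "rlinear t t \<psi>"
  shows "pre_lie P t (der_lift t \<phi>) (der_lift t \<psi>) = der_lift t (\<lambda>u. der_along (\<lambda>u. u) \<psi> (\<phi> u))"
  unfolding pre_lie_def
  by (simp add: der_lift_incl[OF t \<phi>] der_lift_cls[OF t \<psi>] rlinearD(1)[OF \<phi>]
      der_of_cls[OF t rlinear_der_along_comp[OF \<phi> \<psi> module_hom_self[OF t]]])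

end


section \<open>Pointed derivations and their commutators\<close>

lemma module_mult: "module ((*) :: 'r::comm_ring_1 \<Rightarrow> 'r \<Rightarrow> 'r)"
  by unfold_locales (simp_all add: algebra_simps)

locale operad_module = operad P + V: module s
  for P :: "('r::comm_ring_1, 'o::ab_group_add) operad_data"
    and s :: "'r \<Rightarrow> 'v::ab_group_add \<Rightarrow> 'v"
begin

abbreviation (input) t :: "'r \<Rightarrow> 'r \<times> 'v \<Rightarrow> 'r \<times> 'v" where
  "t \<equiv> scale1 s"

sublocale RV: module_prod "(*) :: 'r \<Rightarrow> 'r \<Rightarrow> 'r" s
  by (intro module_prod.intro module_pair.intro module_mult V.module_axioms)

lemma module_t: "module t"
  by (rule RV.p.module_axioms)

lemma t_simp [simp]: "t r (a, v) = (r * a, s r v)"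
  by (rule RV.scale_prod)

abbreviation \<iota> :: "'v \<Rightarrow> 'r \<times> 'v" where
  "\<iota> \<equiv> \<lambda>v. (0, v)"

lemma module_hom_\<iota>: "module_hom s t \<iota>"
  by (simp add: module_hom_iff V.module_axioms module_t)

lemma module_hom_snd: "module_hom t s snd"
  by (rule RV.module_hom_snd)

text \<open>The values on generators of the pointed derivation of \<open>q\<close>.\<close>

definition point :: "('r, 'o, 'r \<times> 'v) formal \<Rightarrow> 'r \<times> 'v \<Rightarrow> ('r, 'o, 'r \<times> 'v) formal" where
  "point q w = fscale (fst w) q"

definition pt :: "('r, 'o, 'r \<times> 'v) formal \<Rightarrow> ('r, 'o, 'r \<times> 'v) endo" where
  "pt q = der_lift t (point q)"

text \<open>The product of pointed derivations, transported to \<open>\<O>(V;R)\<close>: since \<open>p\<close> is linear in the summand \<open>R\<close>,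
  the derivation of \<open>q\<close> replaces this one entry of \<open>p\<close> by \<open>q\<close>.\<close>

definition ocirc (infixl \<open>\<odot>\<close> 70) where
  "p \<odot> q = der_along (\<lambda>u. u) (point q) p"

text \<open>The values on generators of the extension of a derivation from \<open>\<O>(V)\<close> to \<open>\<O>(R \<oplus> V)\<close>.\<close>

definition extend :: "('v \<Rightarrow> ('r, 'o, 'v) formal) \<Rightarrow> 'r \<times> 'v \<Rightarrow> ('r, 'o, 'r \<times> 'v) formal" where
  "extend \<phi> w = formal_map \<iota> (\<phi> (snd w))"

text \<open>The partial derivative \<open>\<partial>\<^sub>f\<close> from \<open>\<O>(V)\<close> to \<open>\<O>(V;R)\<close>.\<close>

definition contr :: "('v \<Rightarrow> 'r) \<Rightarrow> ('r, 'o, 'v) formal \<Rightarrow> ('r, 'o, 'r \<times> 'v) formal" where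
  "contr f = der_along \<iota> (\<lambda>v. eta (f v, 0))"

lemma rlinear_point: "q \<in> formals P \<Longrightarrow> rlinear t t (point q)"
  by (auto simp: rlinear_def point_def fm.scale_left_distrib intro: fm.subspace_scale subspace_formals)

lemma rlinear_ext: "rlinear s s \<phi> \<Longrightarrow> rlinear t t (extend \<phi>)"
  using rlinear_module_hom_comp[OF rlinear_formal_map_comp[OF _ module_hom_\<iota>] module_hom_snd]
  by (simp add: extend_def[abs_def])

lemma rlinear_contr:
  assumes "module_hom s (*) f"
  shows "rlinear s t (\<lambda>v. eta (f v, 0))"
proof (rule rlinear_module_hom_comp[OF rlinear_eta])
  show "module_hom s t (\<lambda>v. (f v, 0))"
    using assms by (simp add: module_hom_iff module_t)
qed

lemma flinear_contr: "flinear (contr f)"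
  by (simp add: contr_def flinear_der_along)

lemma point_closed: "q \<in> formals P \<Longrightarrow> point q w \<in> formals P"
  by (rule rlinearD(1)[OF rlinear_point])

lemma ocirc_closed: "p \<in> formals P \<Longrightarrow> q \<in> formals P \<Longrightarrow> p \<odot> q \<in> formals P"
  unfolding ocirc_def by (intro der_along_closed point_closed)

text \<open>The formal sums that represent elements of \<open>\<O>(V;R)\<close>. The relations are included, so that membership
  depends only on the coset.\<close>

definition lin_terms :: "('r, 'o, 'r \<times> 'v) formal set" where
  "lin_terms = fm.span (rels P t \<union>
     {gen \<mu> (map \<iota> as @ (r, 0) # map \<iota> bs) | \<mu> as r bs. \<mu> \<in> ops P (length as + 1 + length bs)})"

lemma subspace_lin_terms: "fm.subspace lin_terms"
  by (simp add: lin_terms_def)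

lemma rels_lin_terms: "\<rho> \<in> rels P t \<Longrightarrow> \<rho> \<in> lin_terms"
  by (simp add: lin_terms_def fm.span_base)

lemma gen_lin_terms:
  "\<mu> \<in> ops P (length as + 1 + length bs) \<Longrightarrow> gen \<mu> (map \<iota> as @ (r, 0) # map \<iota> bs) \<in> lin_terms"
  unfolding lin_terms_def by (rule fm.span_base) blast

lemma flinear_lin_terms_mem:
  assumes "flinear f" and "fm.subspace S" and "\<And>\<rho>. \<rho> \<in> rels P t \<Longrightarrow> f \<rho> \<in> S"
    and "\<And>\<mu> as r bs. \<mu> \<in> ops P (length as + 1 + length bs)
      \<Longrightarrow> f (gen \<mu> (map \<iota> as @ (r, 0) # map \<iota> bs)) \<in> S"
    and "x \<in> lin_terms"
  shows "f x \<in> S"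
  using assms(5) unfolding lin_terms_def
  by (rule flinear_span_mem[OF assms(1,2), rotated]) (auto intro: assms(3,4))

lemma lin_terms_formals: "x \<in> lin_terms \<Longrightarrow> x \<in> formals P"
  by (rule flinear_lin_terms_mem[OF flinear_id subspace_formals])
    (auto intro: gen_formals subsetD[OF rels_formals])

lemma length_marked [simp]: "length (marked vs i r) = length vs"
  by (simp add: marked_def)

lemma marked_split:
  "i < length vs \<Longrightarrow> marked vs i r = map \<iota> (take i vs) @ (r, 0) # map \<iota> (drop (Suc i) vs)"
  by (simp add: marked_def upd_conv_take_nth_drop take_map drop_map)

lemma free_lin_eq: "free_lin P (*) s = cls P t ` lin_terms"
proof -
  let ?S = "{x :: ('r, 'o, 'r \<times> 'v) formal. x \<in> formals P \<and>
    (\<forall>(\<mu>, us) \<in> Poly_Mapping.keys x. \<exists>vs i r. i < length vs \<and> us = marked vs i r)}"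
  have "fm.subspace ?S"
  proof (rule fm.subspaceI)
    fix x y assume "x \<in> ?S" "y \<in> ?S"
    then show "x + y \<in> ?S"
      using Poly_Mapping.keys_add[of x y] by (auto intro: fm.subspace_add subspace_formals)
  next
    fix x r assume x: "x \<in> ?S"
    have "Poly_Mapping.keys (fscale r x) \<subseteq> Poly_Mapping.keys x" by (auto simp: in_keys_iff)
    with x show "fscale r x \<in> ?S" by (auto intro: fm.subspace_scale subspace_formals)
  qed simp
  have 1: "\<exists>y\<in>?S. req t x y" if "x \<in> lin_terms" for x
  proof -
    let ?G = "{gen \<mu> (map \<iota> as @ (r, 0) # map \<iota> bs) | \<mu> as r bs. \<mu> \<in> ops P (length as + 1 + length bs)}"
    have "x \<in> {a + b | a b. a \<in> fm.span (rels P t) \<and> b \<in> fm.span ?G}"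
      using that by (simp only: lin_terms_def fm.span_Un mem_Collect_eq)
    then obtain a b where ab: "x = a + b" "a \<in> rels P t" "b \<in> fm.span ?G"
      by (auto simp: fm.span_eq_iff[THEN iffD2, OF subspace_rels])
    have "?G \<subseteq> ?S"
    proof clarify
      fix \<mu> as r bs assume \<mu>: "\<mu> \<in> ops P (length (as :: 'v list) + 1 + length (bs :: 'v list))"
      let ?us = "map \<iota> as @ (r, 0) # map \<iota> bs" and ?vs = "as @ 0 # bs"
      let ?x = "gen \<mu> ?us :: ('r, 'o, 'r \<times> 'v) formal"
      have us: "?us = marked ?vs (length as) r" by (simp add: marked_split)
      have "?x \<in> formals P" by (rule gen_formals) (use \<mu> in simp)
      moreover have "\<exists>vs i r. i < length vs \<and> us' = marked vs i r"
        if "(\<mu>', us') \<in> Poly_Mapping.keys ?x" for \<mu>' us'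
      proof -
        have "us' = ?us" using that by (simp add: gen_def split: if_splits)
        then have "us' = marked ?vs (length as) r" using us by (rule trans)
        moreover have "length as < length ?vs" by simp
        ultimately show ?thesis by (intro exI conjI)
      qed
      ultimately show "?x \<in> formals P \<and> (\<forall>(\<mu>, us) \<in> Poly_Mapping.keys ?x.
          \<exists>vs i r. i < length vs \<and> us = marked vs i r)"
        by (intro conjI ballI case_prodI2) simp_all
    qed
    from fm.span_minimal[OF this \<open>fm.subspace ?S\<close>] ab(3) have "b \<in> ?S" by (rule subsetD)
    moreover have "req t x b" using ab(1,2) by (simp add: req_def)
    ultimately show ?thesis by (rule bexI[rotated])
  qed
  have 2: "?S \<subseteq> lin_terms"
  proof
    fix x assume x: "x \<in> ?S"
    have "fscale (Poly_Mapping.lookup x k) (Poly_Mapping.single k 1) \<in> lin_terms"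
      if k: "k \<in> Poly_Mapping.keys x" for k
    proof -
      obtain \<mu> us where k_eq: "k = (\<mu>, us)" by fastforce
      from x have "\<forall>(\<mu>, us) \<in> Poly_Mapping.keys x. \<mu> \<in> ops P (length us)"
        and "\<forall>(\<mu>, us) \<in> Poly_Mapping.keys x. \<exists>vs i r. i < length vs \<and> us = marked vs i r"
        by (simp_all add: formals_def)
      from this[THEN bspec, OF k] obtain vs i r
        where i: "i < length vs" and us: "us = marked vs i r" and "\<mu> \<in> ops P (length us)"
        by (auto simp: k_eq)
      moreover have "length (take i vs) + 1 + length (drop (Suc i) vs) = length us"
        using i by (simp add: us)
      ultimately have "gen \<mu> us \<in> lin_terms"
        unfolding us marked_split[OF i] by (intro gen_lin_terms) (simp only:)
      with k_eq show ?thesis by (auto simp: gen_def intro: fm.subspace_scale subspace_lin_terms)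
    qed
    then show "x \<in> lin_terms"
      by (subst formal_expansion) (intro fm.subspace_sum subspace_lin_terms)
  qed
  have "free_lin P (*) s = cls P t ` ?S" by (auto simp: free_lin_def)
  also have "\<dots> = cls P t ` lin_terms"
  proof
    show "cls P t ` lin_terms \<subseteq> cls P t ` ?S"
    proof
      fix A assume "A \<in> cls P t ` lin_terms"
      then obtain x where "x \<in> lin_terms" "A = cls P t x" by blast
      with 1[of x] show "A \<in> cls P t ` ?S" by (metis (no_types, lifting) cls_eq_iff image_eqI)
    qed
  qed (use 2 in auto)
  finally show ?thesis .
qed

text \<open>Operations with one argument in \<open>\<O>(V;R)\<close> and all others in \<open>\<O>(V)\<close> have values linear in \<open>R\<close> again,
  because the special entry of the one argument is the only one in the concatenated tensor.\<close>

lemma formal_op_lin_terms: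
  assumes ys: "set ys \<subseteq> formals P" and zs: "set zs \<subseteq> formals P" and q: "q \<in> lin_terms"
    and \<mu>: "\<mu> \<in> ops P (length ys + 1 + length zs)"
  shows "formal_op P \<mu> (map (formal_map \<iota>) ys @ q # map (formal_map \<iota>) zs) \<in> lin_terms"
proof -
  let ?G = "map (\<lambda>(\<nu>, vs). (\<nu>, map \<iota> vs)) :: ('o \<times> 'v list) list \<Rightarrow> _"
  have G: "map (formal_map \<iota>) (gens gs) = gens (?G gs)" "concat (map snd (?G gs)) = map \<iota> (concat (map snd gs))"
    "valid_gens P gs \<Longrightarrow> valid_gens P (?G gs)" "length (?G gs) = length gs"
    for gs
    by (induction gs) auto
  have gens: "formal_op P \<mu> (map (formal_map \<iota>) (gens gs) @ q # map (formal_map \<iota>) (gens gs')) \<in> lin_terms"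
    if gs: "length gs = length ys" "length gs' = length zs" "valid_gens P gs" "valid_gens P gs'" for gs gs'
  proof (rule flinear_lin_terms_mem[OF multilinearD[OF multilinear_formal_op] subspace_lin_terms _ _ q])
    fix \<rho> assume "\<rho> \<in> rels P t"
    then show "formal_op P \<mu> (map (formal_map \<iota>) (gens gs) @ \<rho> # map (formal_map \<iota>) (gens gs')) \<in> lin_terms"
      using gs \<mu>
      by (intro rels_lin_terms formal_op_rels) (auto simp: valid_gens_def intro!: gen_formals formal_map_closed)
  next
    fix \<nu> as r bs assume \<nu>: "\<nu> \<in> ops P (length (as :: 'v list) + 1 + length (bs :: 'v list))"
    let ?ws = "map \<iota> as @ (r, 0) # map \<iota> bs"
    have "ocomp P \<mu> (inner_ops (?G gs) @ (length ?ws, \<nu>) # inner_ops (?G gs'))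
        \<in> ops P (length (concat (map snd (?G gs)) @ ?ws @ concat (map snd (?G gs'))))"
      using \<mu> \<nu> gs by (intro ocomp_arities_insert_closed) (simp_all add: G)
    then show "formal_op P \<mu> (map (formal_map \<iota>) (gens gs) @ gen \<nu> ?ws # map (formal_map \<iota>) (gens gs')) \<in> lin_terms"
      using gen_lin_terms[of _ "concat (map snd gs) @ as" "bs @ concat (map snd gs')" r]
      unfolding G formal_op_gens_insert by (simp add: G add.assoc del: map_map)
  qed
  have gens': "formal_op P \<mu> (map (formal_map \<iota>) ys @ q # map (formal_map \<iota>) (gens gs')) \<in> lin_terms"
    if gs': "length gs' = length zs" "valid_gens P gs'" for gs'
  proof (rule multilinear_formals_mem[OF _ subspace_lin_terms _ ys refl])
    show "multilinear (\<lambda>ys. formal_op P \<mu> (map (formal_map \<iota>) ys @ q # map (formal_map \<iota>) (gens gs')))"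
      using multilinear_map[OF flinear_formal_map multilinear_context[OF multilinear_formal_op, of P \<mu> "[]"]]
      by simp
  qed (use gens gs' in auto)
  show ?thesis
  proof (rule multilinear_formals_mem[OF _ subspace_lin_terms _ zs refl])
    show "multilinear (\<lambda>zs. formal_op P \<mu> (map (formal_map \<iota>) ys @ q # map (formal_map \<iota>) zs))"
      using multilinear_map[OF flinear_formal_map
          multilinear_context[OF multilinear_formal_op, of P \<mu> "map (formal_map \<iota>) ys @ [q]" "[]"]]
      by simp
  qed (use gens' in auto)
qed

text \<open>Each term either differentiates an entry from \<open>V\<close>, which leaves the entry from \<open>R\<close> in place, or
  differentiates the entry from \<open>R\<close>, which gives 0.\<close>

lemma der_along_ext_lin_terms:
  assumes \<phi>: "rlinear s s \<phi>" and "p \<in> lin_terms"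
  shows "der_along (\<lambda>u. u) (extend \<phi>) p \<in> lin_terms"
proof (rule flinear_lin_terms_mem[OF flinear_der_along subspace_lin_terms _ _ assms(2)])
  fix \<rho> assume "\<rho> \<in> rels P t"
  then show "der_along (\<lambda>u. u) (extend \<phi>) \<rho> \<in> lin_terms"
    by (intro rels_lin_terms der_along_rels[OF rlinear_ext[OF \<phi>] module_hom_self[OF module_t]])
next
  fix \<mu> as r bs assume \<mu>: "\<mu> \<in> ops P (length (as :: 'v list) + 1 + length (bs :: 'v list))"
  let ?F = "formal_op P \<mu>" and ?e = "\<lambda>us. map (\<lambda>v. eta (\<iota> v)) us"
  have e: "?e us = map (formal_map \<iota>) (map eta us)" for us by simp
  have upd: "(?e us)[i := extend \<phi> (\<iota> (us ! i))] = map (formal_map \<iota>) ((map eta us)[i := \<phi> (us ! i)])" for us i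
    by (simp add: map_update extend_def comp_def)
  have point: "eta (r, 0) \<in> lin_terms"
    using gen_lin_terms[of "ounit P" "[]" "[]" r] unit_closed by simp
  have wf: "set ((map eta us)[i := \<phi> (us ! i)]) \<subseteq> formals P" for us :: "'v list" and i
    by (rule set_update_formals[OF set_map_eta rlinearD(1)[OF \<phi>]])
  have "leibniz (\<lambda>l. ?F (l @ eta (r, 0) # ?e bs)) (\<lambda>v. eta (\<iota> v)) (\<lambda>v. extend \<phi> (\<iota> v)) as \<in> lin_terms"
    unfolding leibniz_def upd unfolding e
    using \<mu> by (intro fm.subspace_sum subspace_lin_terms formal_op_lin_terms point wf set_map_eta) simp
  moreover have "leibniz (\<lambda>l. ?F (?e as @ eta (r, 0) # l)) (\<lambda>v. eta (\<iota> v)) (\<lambda>v. extend \<phi> (\<iota> v)) bs \<in> lin_terms"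
    unfolding leibniz_def upd unfolding e
    using \<mu> by (intro fm.subspace_sum subspace_lin_terms formal_op_lin_terms point wf set_map_eta) simp
  moreover have "?F (?e as @ extend \<phi> (r, 0) # ?e bs) \<in> lin_terms"
    using \<mu> rlinear_zero[OF \<phi>]
    by (intro rels_lin_terms formal_op_rels) (auto simp: extend_def formal_map_rels[OF module_hom_\<iota>])
  ultimately show "der_along (\<lambda>u. u) (extend \<phi>) (gen \<mu> (map \<iota> as @ (r, 0) # map \<iota> bs)) \<in> lin_terms"
    by (simp add: leibniz_append leibniz_Cons leibniz_map comp_def fm.subspace_add subspace_lin_terms)
qed

lemma contr_gen:
  assumes "\<mu> \<in> ops P (length us)"
  shows "contr f (gen \<mu> us) = (\<Sum>i<length us. gen \<mu> (marked us i (f (us ! i))))"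
  unfolding contr_def der_along_gen leibniz_def
proof (rule sum.cong[OF refl])
  fix i
  have "(map (\<lambda>u. eta (\<iota> u)) us)[i := eta (f (us ! i), 0)] = map eta (marked us i (f (us ! i)))"
    by (simp add: marked_def map_update comp_def)
  then show "formal_op P \<mu> ((map (\<lambda>u. eta (\<iota> u)) us)[i := eta (f (us ! i), 0)]) =
      gen \<mu> (marked us i (f (us ! i)))"
    using assms by (simp only: formal_op_etas length_marked)
qed

lemma contr_lin_terms:
  assumes "x \<in> formals P"
  shows "contr f x \<in> lin_terms"
proof (rule flinear_formals_mem[OF flinear_contr subspace_lin_terms _ assms])
  fix \<mu> and us :: "'v list" assume \<mu>: "\<mu> \<in> ops P (length us)"
  have "gen \<mu> (marked us i (f (us ! i))) \<in> lin_terms" if "i < length us" for i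
  proof -
    have "length (take i us) + 1 + length (drop (Suc i) us) = length us" using that by simp
    with \<mu> show ?thesis unfolding marked_split[OF that] by (intro gen_lin_terms) (simp only:)
  qed
  then show "contr f (gen \<mu> us) \<in> lin_terms"
    unfolding contr_gen[OF \<mu>] by (intro fm.subspace_sum subspace_lin_terms) simp
qed

text \<open>The formal sums that represent sums of commutators in \<open>\<O>(V;R)\<close>.\<close>

definition comms :: "('r, 'o, 'r \<times> 'v) formal set" where
  "comms = fm.span (rels P t \<union> {p \<odot> q - q \<odot> p | p q. p \<in> lin_terms \<and> q \<in> lin_terms})"

lemma subspace_comms: "fm.subspace comms"
  by (simp add: comms_def)

lemma rels_comms: "\<rho> \<in> rels P t \<Longrightarrow> \<rho> \<in> comms"
  by (simp add: comms_def fm.span_base)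

lemma commutator_comms: "p \<in> lin_terms \<Longrightarrow> q \<in> lin_terms \<Longrightarrow> p \<odot> q - q \<odot> p \<in> comms"
  unfolding comms_def by (rule fm.span_base) blast

lemma req_comms: "req t x y \<Longrightarrow> y \<in> comms \<Longrightarrow> x \<in> comms"
  using fm.subspace_add[OF subspace_comms, of "x - y" y] by (simp add: req_def rels_comms)

lemma comms_formals: "x \<in> comms \<Longrightarrow> x \<in> formals P"
  unfolding comms_def
  by (rule flinear_span_mem[OF flinear_id subspace_formals])
    (auto intro: fm.subspace_diff subspace_formals ocirc_closed lin_terms_formals subsetD[OF rels_formals])

text \<open>A pointed derivation vanishes on \<open>V\<close>, hence on \<open>\<O>(V)\<close>.\<close>

lemma der_along_point_formal_map:
  assumes "x \<in> formals P"
  shows "der_along (\<lambda>u. u) (point q) (formal_map \<iota> x) = 0"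
proof (rule flinear_formals_eq[OF flinear_comp[OF flinear_der_along flinear_formal_map] flinear_const_zero _ assms])
  fix \<mu> and us :: "'v list"
  show "der_along (\<lambda>u. u) (point q) (formal_map \<iota> (gen \<mu> us)) = 0"
    by (simp add: leibniz_def point_def flinear_zero[OF multilinear_update[OF multilinear_formal_op]])
qed

text \<open>The difference of the two composites of the extended derivation with the insertion of \<open>q\<close> is a derivation.
  On generators it vanishes on \<open>V\<close> and sends \<open>r\<close> to \<open>r\<close> times the derivative of \<open>q\<close>, so it is the insertion
  of this derivative.\<close>

lemma der_along_ext_ocirc:
  assumes \<phi>: "rlinear s s \<phi>" and p: "p \<in> formals P" and q: "q \<in> formals P"
  shows "req t (der_along (\<lambda>u. u) (extend \<phi>) (p \<odot> q))
    (der_along (\<lambda>u. u) (extend \<phi>) p \<odot> q + p \<odot> der_along (\<lambda>u. u) (extend \<phi>) q)"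
proof -
  let ?e = "der_along (\<lambda>u. u) (extend \<phi>)"
  have "req t (?e (p \<odot> q) - ?e p \<odot> q)
      (der_along (\<lambda>u. u) (\<lambda>w. ?e (point q w) - der_along (\<lambda>u. u) (point q) (extend \<phi> w)) p)"
    unfolding ocirc_def
    by (rule der_along_commutator[OF point_closed[OF q] rlinearD(1)[OF rlinear_ext[OF \<phi>]] point_closed[OF q] _ p]) simp
  also have "(\<lambda>w. ?e (point q w) - der_along (\<lambda>u. u) (point q) (extend \<phi> w)) = point (?e q)"
    by (simp add: fun_eq_iff extend_def der_along_point_formal_map rlinearD(1)[OF \<phi>])
      (simp add: point_def flinear_scale[OF flinear_der_along])
  finally have "req t (?e (p \<odot> q) - ?e p \<odot> q) (p \<odot> ?e q)" by (simp add: ocirc_def)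
  from req_add[OF this req_refl[of t "?e p \<odot> q"]] show ?thesis by (simp add: add.commute)
qed

lemma der_along_ext_comms:
  assumes \<phi>: "rlinear s s \<phi>" and "x \<in> comms"
  shows "der_along (\<lambda>u. u) (extend \<phi>) x \<in> comms"
proof (rule flinear_span_mem[OF flinear_der_along subspace_comms _ assms(2)[unfolded comms_def]])
  let ?e = "der_along (\<lambda>u. u) (extend \<phi>)"
  fix x assume "x \<in> rels P t \<union> {p \<odot> q - q \<odot> p | p q. p \<in> lin_terms \<and> q \<in> lin_terms}"
  then consider "x \<in> rels P t" | p q where "x = p \<odot> q - q \<odot> p" "p \<in> lin_terms" "q \<in> lin_terms"
    by blast
  then show "?e x \<in> comms"
  proof cases
    case 1
    then show ?thesis
      by (intro rels_comms der_along_rels[OF rlinear_ext[OF \<phi>] module_hom_self[OF module_t]])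
  next
    case 2
    note pq = lin_terms_formals[OF 2(2)] lin_terms_formals[OF 2(3)]
    have "req t (?e x) ((?e p \<odot> q + p \<odot> ?e q) - (?e q \<odot> p + q \<odot> ?e p))"
      unfolding 2(1) flinear_diff[OF flinear_der_along] by (intro req_diff der_along_ext_ocirc \<phi> pq)
    also have "(?e p \<odot> q + p \<odot> ?e q) - (?e q \<odot> p + q \<odot> ?e p) =
        (?e p \<odot> q - q \<odot> ?e p) + (p \<odot> ?e q - ?e q \<odot> p)"
      by (simp add: algebra_simps)
    finally show ?thesis
      by (rule req_comms)
        (intro fm.subspace_add subspace_comms commutator_comms der_along_ext_lin_terms \<phi> 2)
  qed
qed

section \<open>The quotient by commutators\<close>

text \<open>A pointed derivation is determined by its value at \<open>(1, 0)\<close>.\<close>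

lemma pt_eq_iff:
  assumes "p \<in> formals P" "q \<in> formals P"
  shows "pt p = pt q \<longleftrightarrow> req t p q"
proof
  assume "pt p = pt q"
  then have "cls P t (point p (1, 0)) = cls P t (point q (1, 0))"
    using assms by (simp add: pt_def flip: der_lift_incl[OF module_t rlinear_point])
  then show "req t p q" by (simp add: point_def cls_eq_iff)
next
  assume "req t p q"
  then show "pt p = pt q"
    unfolding pt_def using assms
    by (intro der_lift_cong module_t rlinear_point) (auto simp: point_def intro: req_scale)
qed

lemma pointed_cls: "q \<in> formals P \<Longrightarrow> pointed P s (cls P t q) = pt q"
proof -
  assume q: "q \<in> formals P"
  have "(\<lambda>(r, v). coset_scale P t r (cls P t q)) = (\<lambda>w. cls P t (point q w))"
    by (simp add: fun_eq_iff coset_scale_cls point_def)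
  then show ?thesis
    by (simp add: pointed_def pt_def der_of_cls[OF module_t rlinear_point[OF q]])
qed

lemma pt_zero: "pt 0 = der_zero P t"
  by (simp add: pt_def point_def[abs_def] der_zero_eq module_t)

lemma pt_add: "p \<in> formals P \<Longrightarrow> q \<in> formals P \<Longrightarrow> der_add P t (pt p) (pt q) = pt (p + q)"
  by (simp add: pt_def der_add_lift module_t rlinear_point)
    (simp add: point_def[abs_def] fm.scale_right_distrib)

lemma pt_diff: "p \<in> formals P \<Longrightarrow> q \<in> formals P \<Longrightarrow> der_diff P t (pt p) (pt q) = pt (p - q)"
  by (simp add: pt_def der_diff_lift module_t rlinear_point)
    (simp add: point_def[abs_def] fm.scale_right_diff_distrib)

lemma pt_scale: "p \<in> formals P \<Longrightarrow> der_scale P t r (pt p) = pt (fscale r p)"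
  by (simp add: pt_def der_scale_lift module_t rlinear_point)
    (simp add: point_def[abs_def] mult.commute)

lemma pre_lie_pt: "p \<in> formals P \<Longrightarrow> q \<in> formals P \<Longrightarrow> pre_lie P t (pt p) (pt q) = pt (p \<odot> q)"
  by (simp add: pt_def pre_lie_lift module_t rlinear_point)
    (simp add: point_def[abs_def] ocirc_def flinear_scale[OF flinear_der_along])

lemma pre_lie_pt_ext:
  "p \<in> formals P \<Longrightarrow> rlinear s s \<phi>
    \<Longrightarrow> pre_lie P t (pt p) (der_lift t (extend \<phi>)) = pt (der_along (\<lambda>u. u) (extend \<phi>) p)"
  by (simp add: pt_def pre_lie_lift module_t rlinear_point rlinear_ext)
    (simp add: point_def[abs_def] flinear_scale[OF flinear_der_along])

text \<open>Together with \<open>pt_eq_iff\<close> and \<open>pre_lie_pt\<close>, this identifies the algebra of pointed derivations with \<open>\<O>(V;R)\<close>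
  under the product \<open>\<odot>\<close>.\<close>

lemma Der_pt_eq: "Der_pt P s = pt ` lin_terms"
proof (rule set_eqI, rule iffI)
  fix D assume "D \<in> Der_pt P s"
  then obtain x where D: "D \<in> Der P t" and x: "x \<in> lin_terms"
    and val: "\<And>r v. D (incl P t (r, v)) = coset_scale P t r (cls P t x)"
    by (auto simp: Der_pt_def free_lin_eq)
  obtain \<psi> where \<psi>: "rlinear t t \<psi>" "D = der_lift t \<psi>"
    using Der_obtain_lift[OF module_t D] .
  have "req t (\<psi> w) (point x w)" for w
    using val[of "fst w" "snd w"]
    by (simp add: \<psi>(2) der_lift_incl[OF module_t \<psi>(1)] coset_scale_cls cls_eq_iff point_def)
  then have "D = pt x"
    unfolding \<psi>(2) pt_def by (rule der_lift_cong[OF module_t \<psi>(1) rlinear_point[OF lin_terms_formals[OF x]]])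
  with x show "D \<in> pt ` lin_terms" by blast
next
  fix D assume "D \<in> pt ` lin_terms"
  then obtain x where x: "x \<in> lin_terms" "D = pt x" by blast
  note lin = rlinear_point[OF lin_terms_formals[OF x(1)]]
  show "D \<in> Der_pt P s"
    unfolding Der_pt_def free_lin_eq x(2) pt_def
    using x(1) der_lift_Der[OF module_t lin]
    by (auto simp: der_lift_incl[OF module_t lin] coset_scale_cls point_def)
qed

lemma commutators_eq: "commutators P s = pt ` comms"
proof (rule set_eqI, rule iffI)
  fix C assume "C \<in> commutators P s"
  then show "C \<in> pt ` comms"
  proof induction
    case (1 D E)
    then obtain p q where pq: "p \<in> lin_terms" "D = pt p" "q \<in> lin_terms" "E = pt q"
      by (auto simp: Der_pt_eq)
    note lin = lin_terms_formals[OF pq(1)] lin_terms_formals[OF pq(3)]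
    have "der_diff P t (pre_lie P t D E) (pre_lie P t E D) = pt (p \<odot> q - q \<odot> p)"
      by (simp add: pq pre_lie_pt pt_diff ocirc_closed lin)
    with commutator_comms[OF pq(1,3)] show ?case by simp
  next
    case 2
    then show ?case using fm.subspace_0[OF subspace_comms] by (auto simp flip: pt_zero)
  next
    case (3 C C')
    then show ?case
      by (auto simp: pt_add comms_formals intro!: imageI fm.subspace_add subspace_comms)
  next
    case (4 C r)
    then show ?case
      by (auto simp: pt_scale comms_formals intro!: imageI fm.subspace_scale subspace_comms)
  qed
next
  let ?S = "{x \<in> formals P. pt x \<in> commutators P s}"
  have "fm.subspace ?S"
  proof (rule fm.subspaceI)
    show "0 \<in> ?S" by (simp add: pt_zero commutators.intros)
  next
    fix x y assume "x \<in> ?S" "y \<in> ?S"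
    then show "x + y \<in> ?S"
      using commutators.intros(3)[of "pt x" P s "pt y"]
      by (simp add: pt_add fm.subspace_add subspace_formals)
  next
    fix x r assume "x \<in> ?S"
    then show "fscale r x \<in> ?S"
      using commutators.intros(4)[of "pt x" P s r]
      by (simp add: pt_scale fm.subspace_scale subspace_formals)
  qed
  moreover have "x \<in> ?S" if "x \<in> rels P t" for x
  proof -
    have x: "x \<in> formals P" using that rels_formals by blast
    then have "pt x = pt 0" using that by (simp add: pt_eq_iff req_zero_iff)
    then show ?thesis using x by (simp add: pt_zero commutators.intros)
  qed
  moreover have "p \<odot> q - q \<odot> p \<in> ?S" if pq: "p \<in> lin_terms" "q \<in> lin_terms" for p q
    using commutators.intros(1)[of "pt p" P s "pt q"] pq
    by (simp add: Der_pt_eq pre_lie_pt pt_diff lin_terms_formals ocirc_closed fm.subspace_diff subspace_formals)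
  ultimately have "comms \<subseteq> ?S"
    unfolding comms_def by (intro fm.span_minimal) auto
  then show "C \<in> commutators P s" if "C \<in> pt ` comms" for C using that by blast
qed

definition tr_coset :: "('r, 'o, 'r \<times> 'v) formal \<Rightarrow> ('r, 'o, 'r \<times> 'v) endo set" where
  "tr_coset x = {pt y | y. y - x \<in> comms}"

lemma tr_coset_eqI:
  assumes "x - y \<in> comms"
  shows "tr_coset x = tr_coset y"
proof -
  have "z - x \<in> comms \<longleftrightarrow> z - y \<in> comms" for z
    using fm.subspace_add[OF subspace_comms _ assms, of "z - x"]
      fm.subspace_diff[OF subspace_comms _ assms, of "z - y"] by auto
  then show ?thesis by (simp add: tr_coset_def)
qed

lemma comms_diff_formals: "y - x \<in> comms \<Longrightarrow> x \<in> formals P \<Longrightarrow> y \<in> formals P"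
  using fm.subspace_add[OF subspace_formals comms_formals, of "y - x" x] by simp

lemma tr_cls_pt:
  assumes "x \<in> formals P"
  shows "tr_cls P s (pt x) = tr_coset x"
proof -
  have "tr_cls P s (pt x) = (\<lambda>y. pt (x + y)) ` comms"
    unfolding tr_cls_def commutators_eq image_image
    by (rule image_cong) (simp_all add: pt_add assms comms_formals)
  also have "\<dots> = tr_coset x"
    unfolding tr_coset_def by (auto intro!: image_eqI[where x = "_ - x"])
  finally show ?thesis .
qed

lemma tr_add_tr_coset:
  assumes "x \<in> formals P" "y \<in> formals P"
  shows "tr_add P s (tr_coset x) (tr_coset y) = tr_coset (x + y)"
proof (rule set_eqI, rule iffI)
  fix D assume "D \<in> tr_add P s (tr_coset x) (tr_coset y)"
  then obtain a b where ab: "a - x \<in> comms" "b - y \<in> comms" "D = der_add P t (pt a) (pt b)"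
    by (auto simp: tr_add_def tr_coset_def)
  then have "D = pt (a + b)" "(a - x) + (b - y) \<in> comms"
    using assms by (auto simp: pt_add comms_diff_formals intro: fm.subspace_add subspace_comms)
  then show "D \<in> tr_coset (x + y)"
    unfolding tr_coset_def by (auto intro!: exI[of _ "a + b"] simp: algebra_simps)
next
  fix D assume "D \<in> tr_coset (x + y)"
  then obtain z where z: "z - (x + y) \<in> comms" "D = pt z" by (auto simp: tr_coset_def)
  then have z': "(z - y) - x \<in> comms" by (simp add: algebra_simps)
  then have "D = der_add P t (pt (z - y)) (pt y)"
    using assms comms_diff_formals[OF z'] z by (simp add: pt_add)
  then show "D \<in> tr_add P s (tr_coset x) (tr_coset y)"
    unfolding tr_add_def tr_coset_def using z' fm.subspace_0[OF subspace_comms] by force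
qed

lemma tr_diff_tr_coset:
  assumes "x \<in> formals P" "y \<in> formals P"
  shows "tr_diff P s (tr_coset x) (tr_coset y) = tr_coset (x - y)"
proof (rule set_eqI, rule iffI)
  fix D assume "D \<in> tr_diff P s (tr_coset x) (tr_coset y)"
  then obtain a b where ab: "a - x \<in> comms" "b - y \<in> comms" "D = der_diff P t (pt a) (pt b)"
    by (auto simp: tr_diff_def tr_coset_def)
  then have "D = pt (a - b)" "(a - x) - (b - y) \<in> comms"
    using assms by (auto simp: pt_diff comms_diff_formals intro: fm.subspace_diff subspace_comms)
  then show "D \<in> tr_coset (x - y)"
    unfolding tr_coset_def by (auto intro!: exI[of _ "a - b"] simp: algebra_simps)
next
  fix D assume "D \<in> tr_coset (x - y)"
  then obtain z where z: "z - (x - y) \<in> comms" "D = pt z" by (auto simp: tr_coset_def)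
  then have z': "(z + y) - x \<in> comms" by (simp add: algebra_simps)
  then have "D = der_diff P t (pt (z + y)) (pt y)"
    using assms comms_diff_formals[OF z'] z by (simp add: pt_diff)
  then show "D \<in> tr_diff P s (tr_coset x) (tr_coset y)"
    unfolding tr_diff_def tr_coset_def using z' fm.subspace_0[OF subspace_comms] by force
qed

text \<open>A linear map that preserves the commutators descends to the quotient, where the union over a coset is
  a single coset.\<close>

lemma UN_tr_coset:
  assumes x: "x \<in> formals P" and f: "flinear f" "\<And>y. y \<in> comms \<Longrightarrow> f y \<in> comms"
    and F: "\<And>y. y \<in> formals P \<Longrightarrow> F (pt y) = tr_coset (f y)"
  shows "(\<Union>D\<in>tr_coset x. F D) = tr_coset (f x)"
proof -
  have "F (pt y) = tr_coset (f x)" if "y - x \<in> comms" for y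
    using f(2)[OF that] comms_diff_formals[OF that x] by (simp add: F flinear_diff[OF f(1)] tr_coset_eqI)
  moreover have "pt x \<in> tr_coset x"
    unfolding tr_coset_def using fm.subspace_0[OF subspace_comms] by force
  ultimately show ?thesis unfolding tr_coset_def by blast
qed

lemma tr_scale_tr_coset:
  assumes "x \<in> formals P"
  shows "tr_scale P s r (tr_coset x) = tr_coset (fscale r x)"
  unfolding tr_scale_def
  by (rule UN_tr_coset[OF assms flinear_fscale[OF flinear_id]])
    (auto simp: pt_scale tr_cls_pt fm.subspace_scale subspace_formals subspace_comms)

lemma der_ext_lift:
  assumes \<phi>: "rlinear s s \<phi>"
  shows "der_ext P s (der_lift s \<phi>) = der_lift t (extend \<phi>)"
proof -
  have "req t (formal_map \<iota> y) (formal_map \<iota> x)" if "req s y x" for x y :: "('r, 'o, 'v) formal"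
    by (rule flinear_req[OF flinear_formal_map _ that]) (rule formal_map_rels[OF module_hom_\<iota>])
  then have "free_map P t \<iota> (cls P s x) = cls P t (formal_map \<iota> x)" for x
    unfolding free_map_def formal_map_def[symmetric] by (intro image_cls)
  then have "(\<lambda>(r, v). free_map P t \<iota> (der_lift s \<phi> (incl P s v))) = (\<lambda>w. cls P t (extend \<phi> w))"
    by (simp add: fun_eq_iff der_lift_incl[OF V.module_axioms \<phi>] extend_def)
  then show ?thesis
    by (simp add: der_ext_def der_of_cls[OF module_t rlinear_ext[OF \<phi>]])
qed

lemma tr_act_tr_coset:
  assumes x: "x \<in> formals P" and \<phi>: "rlinear s s \<phi>"
  shows "tr_act P s (tr_coset x) (der_lift s \<phi>) = tr_coset (der_along (\<lambda>u. u) (extend \<phi>) x)"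
  unfolding tr_act_def der_ext_lift[OF \<phi>]
  by (rule UN_tr_coset[OF x flinear_der_along])
    (auto simp: der_along_ext_comms[OF \<phi>] pre_lie_pt_ext \<phi> tr_cls_pt der_along_closed rlinearD(1)[OF rlinear_ext[OF \<phi>]])


section \<open>The chain rule and the divergence\<close>

text \<open>Both sides insert \<open>q\<close> for the entry from \<open>R\<close> of \<open>contr f x\<close>. This is the commutator formula for the insertion
  of \<open>q\<close>, which restricts to the zero derivation on \<open>\<O>(V)\<close>.\<close>

lemma der_along_pure:
  assumes "module_hom s (*) f" and q: "q \<in> formals P" and x: "x \<in> formals P"
  shows "req t (der_along \<iota> (\<lambda>u. fscale (f u) q) x) (contr f x \<odot> q)"
proof -
  have "req t (der_along \<iota> (\<lambda>v. eta (f v, 0)) (der_along (\<lambda>u. u) (\<lambda>u. 0) x) - der_along (\<lambda>w. w) (point q) (contr f x))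
      (der_along \<iota> (\<lambda>u. der_along \<iota> (\<lambda>v. eta (f v, 0)) 0 - der_along (\<lambda>w. w) (point q) (eta (f u, 0))) x)"
    unfolding contr_def
    by (rule der_along_commutator)
      (simp_all add: point_closed q x, simp add: point_def flinear_zero[OF flinear_formal_map])
  then have "req t (0 - contr f x \<odot> q) (der_along \<iota> (\<lambda>u. 0 - fscale (f u) q) x)"
    by (simp add: der_along_const_zero x flinear_zero[OF flinear_der_along] der_along_eta point_closed q ocirc_def
        del: der_along_gen diff_0) (simp add: point_def)
  also have "der_along \<iota> (\<lambda>u. 0 - fscale (f u) q) x = 0 - der_along \<iota> (\<lambda>u. fscale (f u) q) x"
    by (simp only: der_along_diff[OF x] der_along_const_zero[OF x])
  finally show ?thesis by (simp add: req_def)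
qed

text \<open>The composite of \<open>\<delta>\<^sub>V\<close> and \<open>\<O>(V;f)\<close> is the partial derivative along \<open>f\<close>; since \<open>\<delta>\<^sub>V\<close> is itself a derivation along
  a linear map, it respects the relations.\<close>

lemma contract_pure_cls:
  assumes f: "module_hom s (*) f" and x: "x \<in> formals P"
  shows "contract_pure P s (cls P s x) f = cls P t (contr f x)"
proof -
  let ?s2 = "module_prod.scale s s"
  interpret VV: module_prod s s
    by (intro module_prod.intro module_pair.intro V.module_axioms)
  let ?M = "lin_ext (\<lambda>(\<mu>, vs). \<Sum>i<length vs. gen \<mu> (marked vs i (vs ! i)))
    :: ('r, 'o, 'v) formal \<Rightarrow> ('r, 'o, 'v \<times> 'v) formal"
  let ?j = "\<lambda>v :: 'v. (0 :: 'v, v)"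
  have hom: "module_hom s ?s2 ?j" "module_hom s ?s2 (\<lambda>v. (v, 0))" "module_hom ?s2 t (map_prod f id)"
    using f by (auto simp: module_hom_iff V.module_axioms VV.p.module_axioms module_t VV.scale_prod)
  have M: "?M y = der_along ?j (\<lambda>v. eta (v, 0)) y" if "y \<in> formals P" for y
  proof (rule flinear_formals_eq[OF flinear_lin_ext flinear_der_along _ that])
    fix \<mu> and us :: "'v list" assume \<mu>: "\<mu> \<in> ops P (length us)"
    have "(map (\<lambda>u. eta (?j u)) us)[i := eta (us ! i, 0)] = map eta (marked us i (us ! i))" for i
      by (simp add: marked_def map_update comp_def)
    then show "?M (gen \<mu> us) = der_along ?j (\<lambda>v. eta (v, 0)) (gen \<mu> us)"
      using \<mu> by (simp add: leibniz_def formal_op_etas marked_def)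
  qed
  have "req ?s2 (?M y) (?M x)" if "req s y x" for y
    unfolding M[OF x] M[OF req_formals[OF that x]]
    by (rule der_along_req[OF rlinear_module_hom_comp[OF rlinear_eta hom(2)] hom(1) that])
  then have "mark P s (cls P s x) = cls P ?s2 (?M x)"
    unfolding mark_def by (rule image_cls)
  moreover have "req t (formal_map (map_prod f id) z) (formal_map (map_prod f id) y)" if "req ?s2 z y"
    for y z :: "('r, 'o, 'v \<times> 'v) formal"
    by (rule flinear_req[OF flinear_formal_map _ that]) (rule formal_map_rels[OF hom(3)])
  ultimately have "contract_pure P s (cls P s x) f = cls P t (formal_map (map_prod f id) (?M x))"
    unfolding contract_pure_def free_map_def formal_map_def[symmetric] by (simp add: image_cls)
  also have "formal_map (map_prod f id) (?M x) = contr f x"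
  proof (rule flinear_formals_eq[OF flinear_comp[OF flinear_formal_map flinear_lin_ext] flinear_contr _ x])
    fix \<mu> and us :: "'v list" assume \<mu>: "\<mu> \<in> ops P (length us)"
    have "f 0 = 0" by (rule module_hom.zero[OF f])
    then have "map (map_prod f id) (marked us i (us ! i)) = marked us i (f (us ! i))" for i
      by (simp add: marked_def map_update comp_def)
    then show "formal_map (map_prod f id) (?M (gen \<mu> us)) = contr f (gen \<mu> us)"
      by (simp add: flinear_sum[OF flinear_formal_map] contr_gen[OF \<mu>])
  qed
  finally show ?thesis .
qed

end

text \<open>The coordinate forms \<open>c b\<close> are the dual basis \<open>b\<^sup>*\<close>.\<close>

locale operad_dual_basis = operad_module P s
  for P :: "('r::comm_ring_1, 'o::ab_group_add) operad_data"
    and s :: "'r \<Rightarrow> 'v::ab_group_add \<Rightarrow> 'v" +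
  fixes B :: "'v set" and c :: "'v \<Rightarrow> 'v \<Rightarrow> 'r"
  assumes finite_B: "finite B"
    and coord: "b \<in> B \<Longrightarrow> module_hom s (*) (c b)"
    and expand: "v = (\<Sum>b\<in>B. s (c b v) b)"
begin

lemma rlinear_expand:
  assumes "rlinear s u \<phi>"
  shows "req u (\<phi> v) (\<Sum>b\<in>B. fscale (c b v) (\<phi> b))"
proof -
  have "req u (\<phi> v) (\<Sum>b\<in>B. \<phi> (s (c b v) b))"
    using rlinear_sum[OF assms, of "\<lambda>b. s (c b v) b" B] by (simp flip: expand)
  also have "req u \<dots> (\<Sum>b\<in>B. fscale (c b v) (\<phi> b))"
    by (intro req_sum rlinearD(3)[OF assms])
  finally show ?thesis .
qed

text \<open>Partial derivatives depend linearly on \<open>f\<close>, so they reduce to those along the coordinates.\<close>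

lemma contr_expand:
  assumes f: "module_hom s (*) f" and x: "x \<in> formals P"
  shows "req t (contr f x) (\<Sum>b\<in>B. fscale (f b) (contr (c b) x))"
proof -
  have "req t (eta (f v, 0)) (\<Sum>b\<in>B. fscale (f b) (eta (c b v, 0)))" for v
  proof -
    have "f v = f (\<Sum>b\<in>B. s (c b v) b)" by (simp flip: expand)
    also have "\<dots> = (\<Sum>b\<in>B. f b * c b v)"
      by (simp add: module_hom.sum[OF f] module_hom.scale[OF f] mult.commute)
    finally have "(f v, 0) = (\<Sum>b\<in>B. t (f b) (c b v, 0))"
      by (simp add: prod_eq_iff fst_sum snd_sum)
    then have "req t (eta (f v, 0)) (\<Sum>b\<in>B. eta (t (f b) (c b v, 0)))"
      using rlinear_sum[OF rlinear_eta, of t "\<lambda>b. t (f b) (c b v, 0)" B] by (simp del: t_simp)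
    also have "req t \<dots> (\<Sum>b\<in>B. fscale (f b) (eta (c b v, 0)))"
      by (intro req_sum eta_scale)
    finally show ?thesis .
  qed
  then have "req t (contr f x) (der_along \<iota> (\<lambda>v. \<Sum>b\<in>B. fscale (f b) (eta (c b v, 0))) x)"
    unfolding contr_def
    by (rule der_along_cong) (auto intro!: x fm.subspace_sum fm.subspace_scale subspace_formals)
  then show ?thesis by (simp add: der_along_sum der_along_scale x contr_def)
qed

text \<open>The contraction \<open>\<Sum>\<^sub>b \<partial>\<^sub>b(d b)\<close> of the derivation with values \<open>\<phi>\<close> on generators.\<close>

definition div_formal :: "('v \<Rightarrow> ('r, 'o, 'v) formal) \<Rightarrow> ('r, 'o, 'r \<times> 'v) formal" where
  "div_formal \<phi> = (\<Sum>b\<in>B. contr (c b) (\<phi> b))"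

lemma contr_req: "module_hom s (*) f \<Longrightarrow> req s x y \<Longrightarrow> req t (contr f x) (contr f y)"
  unfolding contr_def by (rule der_along_req[OF rlinear_contr module_hom_\<iota>])

lemma div_formal_lin_terms: "rlinear s s \<phi> \<Longrightarrow> div_formal \<phi> \<in> lin_terms"
  unfolding div_formal_def
  by (intro fm.subspace_sum subspace_lin_terms contr_lin_terms rlinearD(1))

text \<open>The contraction is independent of the representing tensors \<open>\<Sum>\<^sub>k x\<^sub>k \<otimes> f\<^sub>k\<close>: expanding each \<open>f\<^sub>k\<close> in coordinates and
  collecting the coefficients of \<open>\<partial>\<^sub>b\<close> turns \<open>\<Sum>\<^sub>k \<partial>(x\<^sub>k)\<close>, each along its \<open>f\<^sub>k\<close>, into
  \<open>\<Sum>\<^sub>b \<partial>\<^sub>b(\<Sum>\<^sub>k f\<^sub>k(b) x\<^sub>k) = \<Sum>\<^sub>b \<partial>\<^sub>b(d b)\<close>.\<close>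

lemma represents_div_formal:
  assumes \<phi>: "rlinear s s \<phi>" and "represents P s ts (der_lift s \<phi>)"
  shows "rels P t + (\<Sum>(x, f)\<leftarrow>ts. contract_pure P s x f) = cls P t (div_formal \<phi>)"
proof -
  define rep where "rep x = (SOME \<xi>. \<xi> \<in> formals P \<and> x = cls P s \<xi>)" for x
  have rep: "rep x \<in> formals P \<and> x = cls P s (rep x)" if "x \<in> free_alg P s" for x
    unfolding rep_def using that by (intro someI_ex[of "\<lambda>\<xi>. \<xi> \<in> formals P \<and> x = cls P s \<xi>"]) (auto elim: free_algE)
  define n where "n = length ts"
  define \<xi> where "\<xi> k = rep (fst (ts ! k))" for k
  define f where "f k = snd (ts ! k)" for k
  have \<xi>: "\<xi> k \<in> formals P" "fst (ts ! k) = cls P s (\<xi> k)" and f: "module_hom s (*) (f k)" if "k < n" for k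
  proof -
    have "ts ! k \<in> set ts" using that by (simp add: n_def)
    then have "fst (ts ! k) \<in> free_alg P s" and "module_hom s (*) (f k)"
      using assms(2) by (auto simp: represents_def f_def)
    then show "\<xi> k \<in> formals P" "fst (ts ! k) = cls P s (\<xi> k)" "module_hom s (*) (f k)"
      using rep by (auto simp: \<xi>_def)
  qed
  have sum_ts: "(\<Sum>z\<leftarrow>ts. G z) = (\<Sum>k<n. G (ts ! k))" for G :: "_ \<Rightarrow> 'z::comm_monoid_add"
    by (simp add: sum_list_sum_nth n_def atLeast0LessThan)
  have val: "req s (\<phi> v) (\<Sum>k<n. fscale (f k v) (\<xi> k))" for v
  proof -
    have "cls P s (\<phi> v) = rels P s + (\<Sum>(x, f)\<leftarrow>ts. coset_scale P s (f v) x)"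
      using assms(2) by (simp add: represents_def der_lift_incl[OF V.module_axioms \<phi>])
    also have "(\<Sum>(x, f)\<leftarrow>ts. coset_scale P s (f v) x) = (\<Sum>k<n. cls P s (fscale (f k v) (\<xi> k)))"
      unfolding sum_ts case_prod_beta
      by (intro sum.cong refl) (simp add: \<xi>(2) coset_scale_cls f_def)
    finally show ?thesis by (simp add: cls_sum cls_eq_iff)
  qed
  have "(\<Sum>(x, f)\<leftarrow>ts. contract_pure P s x f) = (\<Sum>k<n. cls P t (contr (f k) (\<xi> k)))"
    unfolding sum_ts case_prod_beta
    by (intro sum.cong refl) (simp add: \<xi> f contract_pure_cls flip: f_def)
  then have "rels P t + (\<Sum>(x, f)\<leftarrow>ts. contract_pure P s x f) = cls P t (\<Sum>k<n. contr (f k) (\<xi> k))"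
    by (simp add: cls_sum)
  moreover have "req t (\<Sum>k<n. contr (f k) (\<xi> k)) (div_formal \<phi>)"
  proof -
    have "req t (\<Sum>k<n. contr (f k) (\<xi> k)) (\<Sum>k<n. \<Sum>b\<in>B. fscale (f k b) (contr (c b) (\<xi> k)))"
      by (intro req_sum contr_expand f \<xi>) simp_all
    also have "\<dots> = (\<Sum>b\<in>B. contr (c b) (\<Sum>k<n. fscale (f k b) (\<xi> k)))"
      by (subst sum.swap) (simp add: flinear_sum[OF flinear_contr] flinear_scale[OF flinear_contr])
    also have "req t \<dots> (div_formal \<phi>)"
      unfolding div_formal_def by (intro req_sum contr_req coord req_sym[OF val])
    finally show ?thesis .
  qed
  ultimately show ?thesis by (simp add: cls_eq_iff)
qed

lemma represents_exists:
  assumes \<phi>: "rlinear s s \<phi>"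
  shows "\<exists>ts. represents P s ts (der_lift s \<phi>)"
proof -
  obtain bs where bs: "set bs = B" "distinct bs" using finite_distinct_list[OF finite_B] by blast
  let ?ts = "map (\<lambda>b. (cls P s (\<phi> b), c b)) bs"
  have "der_lift s \<phi> (incl P s v) = rels P s + (\<Sum>(x, f)\<leftarrow>?ts. coset_scale P s (f v) x)" for v
  proof -
    have "(\<Sum>(x, f)\<leftarrow>?ts. coset_scale P s (f v) x) = (\<Sum>b\<in>B. cls P s (fscale (c b v) (\<phi> b)))"
      by (simp add: comp_def coset_scale_cls sum_list_distinct_conv_sum_set bs)
    then show ?thesis
      by (simp add: der_lift_incl[OF V.module_axioms \<phi>] cls_sum cls_eq_iff rlinear_expand[OF \<phi>])
  qed
  moreover have "\<forall>(x, f) \<in> set ?ts. x \<in> free_alg P s \<and> module_hom s (*) f"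
    by (auto simp: bs coord rlinearD(1)[OF \<phi>])
  ultimately show ?thesis unfolding represents_def by blast
qed

lemma Div_lift:
  assumes \<phi>: "rlinear s s \<phi>"
  shows "Div P s (der_lift s \<phi>) = tr_coset (div_formal \<phi>)"
proof -
  have closed: "div_formal \<phi> \<in> formals P"
    by (intro lin_terms_formals div_formal_lin_terms \<phi>)
  have "contraction P s (der_lift s \<phi>) = cls P t (div_formal \<phi>)"
    unfolding contraction_def
    using represents_exists[OF \<phi>] represents_div_formal[OF \<phi>] by (intro the_equality) metis+
  then show ?thesis by (simp add: Div_def pointed_cls tr_cls_pt closed)
qed

text \<open>The chain rule. By the commutator formula, the failure of the partial derivative to commute with the
  derivation \<open>\<chi>\<close> is the derivation along \<open>V \<subseteq> R \<oplus> V\<close> sending \<open>u\<close> to the partial derivative of \<open>\<chi> u\<close>; writing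
  \<open>u\<close> in coordinates splits it into the summands of \<open>der_along_pure\<close>.\<close>

lemma contr_der_along:
  assumes f: "module_hom s (*) f" and \<chi>: "rlinear s s \<chi>" and x: "x \<in> formals P"
  shows "req t (contr f (der_along (\<lambda>u. u) \<chi> x))
    (der_along (\<lambda>u. u) (extend \<chi>) (contr f x) + (\<Sum>a\<in>B. contr (c a) x \<odot> contr f (\<chi> a)))"
proof -
  let ?e = "der_along (\<lambda>u. u) (extend \<chi>)" and ?\<theta> = "\<lambda>u. contr f (\<chi> u)"
  have \<theta>: "rlinear s t ?\<theta>"
    unfolding contr_def by (rule rlinear_der_along_comp[OF \<chi> rlinear_contr[OF f] module_hom_\<iota>])
  have "req t (contr f (der_along (\<lambda>u. u) \<chi> x) - ?e (contr f x))
      (der_along \<iota> (\<lambda>u. ?\<theta> u - ?e (eta (f u, 0))) x)"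
    unfolding contr_def
    by (rule der_along_commutator)
      (simp_all add: rlinearD(1)[OF \<chi>] rlinearD(1)[OF rlinear_ext[OF \<chi>]] x, simp add: extend_def)
  also have "req t \<dots> (der_along \<iota> (\<lambda>u. \<Sum>a\<in>B. fscale (c a u) (?\<theta> a)) x)"
  proof (rule der_along_cong)
    fix u
    have "?e (eta (f u, 0)) = formal_map \<iota> (\<chi> 0)"
      by (subst der_along_eta) (simp_all add: rlinearD(1)[OF rlinear_ext[OF \<chi>]], simp add: extend_def)
    then have "req t (?e (eta (f u, 0))) 0"
      by (simp add: req_zero_iff formal_map_rels[OF module_hom_\<iota> rlinear_zero[OF \<chi>]] del: der_along_gen)
    from req_diff[OF rlinear_expand[OF \<theta>] this]
    show "req t (?\<theta> u - ?e (eta (f u, 0))) (\<Sum>a\<in>B. fscale (c a u) (?\<theta> a))" by simp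
    show "(\<Sum>a\<in>B. fscale (c a u) (?\<theta> a)) \<in> formals P"
      by (intro fm.subspace_sum fm.subspace_scale subspace_formals rlinearD(1)[OF \<theta>])
  qed (rule x)
  also have "der_along \<iota> (\<lambda>u. \<Sum>a\<in>B. fscale (c a u) (?\<theta> a)) x = (\<Sum>a\<in>B. der_along \<iota> (\<lambda>u. fscale (c a u) (?\<theta> a)) x)"
    by (rule der_along_sum[OF x])
  also have "req t \<dots> (\<Sum>a\<in>B. contr (c a) x \<odot> ?\<theta> a)"
    by (intro req_sum der_along_pure coord rlinearD(1)[OF \<theta>] x)
  finally have "req t (contr f (der_along (\<lambda>u. u) \<chi> x) - ?e (contr f x)) (\<Sum>a\<in>B. contr (c a) x \<odot> ?\<theta> a)" .
  from req_add[OF this req_refl[of t "?e (contr f x)"]] show ?thesis by (simp add: add.commute)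
qed

lemma div_formal_pre_lie:
  assumes \<phi>: "rlinear s s \<phi>" and \<chi>: "rlinear s s \<chi>"
  shows "req t (div_formal (\<lambda>u. der_along (\<lambda>u. u) \<chi> (\<phi> u)))
    (der_along (\<lambda>u. u) (extend \<chi>) (div_formal \<phi>) + (\<Sum>b\<in>B. \<Sum>a\<in>B. contr (c a) (\<phi> b) \<odot> contr (c b) (\<chi> a)))"
  unfolding div_formal_def flinear_sum[OF flinear_der_along] sum.distrib[symmetric]
  by (intro req_sum contr_der_along coord \<chi> rlinearD(1)[OF \<phi>])

text \<open>The double sum of \<open>div_formal_pre_lie\<close> for \<open>\<chi>\<close> and \<open>\<phi>\<close> consists, after exchanging the two summation indices,
  of the products for \<open>\<phi>\<close> and \<open>\<chi>\<close> in reverse order.\<close>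

lemma div_formal_bracket:
  assumes \<phi>: "rlinear s s \<phi>" and \<chi>: "rlinear s s \<chi>"
  shows "div_formal (\<lambda>u. der_along (\<lambda>u. u) \<chi> (\<phi> u) - der_along (\<lambda>u. u) \<phi> (\<chi> u)) -
    (der_along (\<lambda>u. u) (extend \<chi>) (div_formal \<phi>) - der_along (\<lambda>u. u) (extend \<phi>) (div_formal \<chi>)) \<in> comms"
    (is "?D - (?E\<^sub>1 - ?E\<^sub>2) \<in> comms")
proof -
  let ?S = "\<lambda>\<phi> \<chi>. \<Sum>b\<in>B. \<Sum>a\<in>B. contr (c a) (\<phi> b) \<odot> contr (c b) (\<chi> a)"
  have "?D = div_formal (\<lambda>u. der_along (\<lambda>u. u) \<chi> (\<phi> u)) - div_formal (\<lambda>u. der_along (\<lambda>u. u) \<phi> (\<chi> u))"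
    by (simp add: div_formal_def flinear_diff[OF flinear_contr] sum_subtractf)
  also have "req t \<dots> ((?E\<^sub>1 + ?S \<phi> \<chi>) - (?E\<^sub>2 + ?S \<chi> \<phi>))"
    by (intro req_diff div_formal_pre_lie \<phi> \<chi>)
  finally have "req t (?D - (?E\<^sub>1 - ?E\<^sub>2)) ((?E\<^sub>1 + ?S \<phi> \<chi>) - (?E\<^sub>2 + ?S \<chi> \<phi>) - (?E\<^sub>1 - ?E\<^sub>2))"
    by (intro req_diff req_refl)
  also have "(?E\<^sub>1 + ?S \<phi> \<chi>) - (?E\<^sub>2 + ?S \<chi> \<phi>) - (?E\<^sub>1 - ?E\<^sub>2) = ?S \<phi> \<chi> - ?S \<chi> \<phi>"
    by (simp add: algebra_simps)
  also have "?S \<chi> \<phi> = (\<Sum>b\<in>B. \<Sum>a\<in>B. contr (c b) (\<chi> a) \<odot> contr (c a) (\<phi> b))"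
    by (rule sum.swap)
  also have "?S \<phi> \<chi> - \<dots> =
      (\<Sum>b\<in>B. \<Sum>a\<in>B. contr (c a) (\<phi> b) \<odot> contr (c b) (\<chi> a) - contr (c b) (\<chi> a) \<odot> contr (c a) (\<phi> b))"
    by (simp only: sum_subtractf)
  finally show ?thesis
    by (rule req_comms)
      (intro fm.subspace_sum subspace_comms commutator_comms contr_lin_terms rlinearD(1)[OF \<phi>]
        rlinearD(1)[OF \<chi>])
qed

theorem one_cocycle_Div: "one_cocycle P s (Div P s)"
  unfolding one_cocycle_def
proof (intro conjI ballI allI Pi_I)
  note closed = lin_terms_formals[OF div_formal_lin_terms]
  fix d assume "d \<in> Der P s"
  then obtain \<phi> where \<phi>: "rlinear s s \<phi>" and d: "d = der_lift s \<phi>"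
    by (rule Der_obtain_lift[OF V.module_axioms])
  show "Div P s d \<in> Tr P s"
    unfolding d Div_lift[OF \<phi>] Tr_def Der_pt_eq
    using div_formal_lin_terms[OF \<phi>] by (auto simp: image_image simp flip: tr_cls_pt[OF closed[OF \<phi>]])
  fix r
  have "div_formal (\<lambda>u. fscale r (\<phi> u)) = fscale r (div_formal \<phi>)"
    by (simp add: div_formal_def flinear_scale[OF flinear_contr] fm.scale_sum_right)
  then show "Div P s (der_scale P s r d) = tr_scale P s r (Div P s d)"
    by (simp add: d der_scale_lift V.module_axioms Div_lift \<phi> rlinear_scale tr_scale_tr_coset closed)
next
  note closed = lin_terms_formals[OF div_formal_lin_terms]
  fix d e assume "d \<in> Der P s" "e \<in> Der P s"
  obtain \<phi> where \<phi>: "rlinear s s \<phi>" and d: "d = der_lift s \<phi>"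
    using \<open>d \<in> Der P s\<close> by (rule Der_obtain_lift[OF V.module_axioms])
  obtain \<chi> where \<chi>: "rlinear s s \<chi>" and e: "e = der_lift s \<chi>"
    using \<open>e \<in> Der P s\<close> by (rule Der_obtain_lift[OF V.module_axioms])
  have "div_formal (\<lambda>u. \<phi> u + \<chi> u) = div_formal \<phi> + div_formal \<chi>"
    by (simp add: div_formal_def flinear_add[OF flinear_contr] sum.distrib)
  then show "Div P s (der_add P s d e) = tr_add P s (Div P s d) (Div P s e)"
    by (simp add: d e der_add_lift V.module_axioms Div_lift \<phi> \<chi> rlinear_add tr_add_tr_coset closed)
  note comp = rlinear_der_along_comp[OF _ _ module_hom_self[OF V.module_axioms]]
  have "der_bracket P s d e = der_lift s (\<lambda>u. der_along (\<lambda>u. u) \<chi> (\<phi> u) - der_along (\<lambda>u. u) \<phi> (\<chi> u))"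
    by (simp add: der_bracket_def d e pre_lie_lift V.module_axioms \<phi> \<chi> der_diff_lift comp)
  then have "Div P s (der_bracket P s d e) =
      tr_coset (der_along (\<lambda>u. u) (extend \<chi>) (div_formal \<phi>) - der_along (\<lambda>u. u) (extend \<phi>) (div_formal \<chi>))"
    by (simp add: Div_lift rlinear_diff comp \<phi> \<chi> tr_coset_eqI[OF div_formal_bracket[OF \<phi> \<chi>]])
  also have "\<dots> = tr_diff P s (tr_act P s (Div P s d) e) (tr_act P s (Div P s e) d)"
    by (simp add: d e Div_lift \<phi> \<chi> tr_act_tr_coset closed tr_diff_tr_coset der_along_closed rlinearD(1)[OF rlinear_ext])
  finally show "Div P s (der_bracket P s d e) =
      tr_diff P s (tr_act P s (Div P s d) e) (tr_act P s (Div P s e) d)" .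
qed

end

lemma free_of_finite_rank_coordinates:
  fixes s :: "'r::comm_ring_1 \<Rightarrow> 'v::ab_group_add \<Rightarrow> 'v"
  assumes "free_of_finite_rank s"
  shows "\<exists>B c. finite B \<and> (\<forall>b\<in>B. module_hom s (*) (c b)) \<and> (\<forall>v. v = (\<Sum>b\<in>B. s (c b v) b))"
proof -
  obtain B where s: "module s" and B: "finite B" "\<not> module.dependent s B" "module.span s B = UNIV"
    using assms by (auto simp: free_of_finite_rank_def)
  interpret module s by (rule s)
  let ?c = "\<lambda>b v. representation B v b"
  have hom: "module_hom s (*) (?c b)" for b
    using B by (simp add: module_hom_iff s module_mult representation_add representation_scale)
  have "v = (\<Sum>b\<in>B. s (?c b v) b)" for v
    using B by (simp add: sum_representation_eq)
  then show ?thesis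
    by (intro exI[of _ B] exI[of _ ?c] conjI ballI allI B(1) hom)
qed

theorem theorem1:
  fixes P :: "('r::comm_ring_1, 'o::ab_group_add) operad_data"
    and s :: "'r \<Rightarrow> 'v::ab_group_add \<Rightarrow> 'v"
  assumes "operad P" and "reduced P" and "free_of_finite_rank s"
  shows "one_cocycle P s (Div P s)"
proof -
  have "module s" using assms(3) by (simp add: free_of_finite_rank_def)
  obtain B c where "finite B" and "\<forall>b\<in>B. module_hom s (*) (c b)"
    and "\<forall>v. v = (\<Sum>b\<in>B. s (c b v) b)"
    using free_of_finite_rank_coordinates[OF assms(3)]
    by (elim exE conjE) (rule that; assumption)
  then interpret operad_dual_basis P s B c
    using assms(1) \<open>module s\<close>
    by (intro operad_dual_basis.intro operad_module.intro operad_dual_basis_axioms.intro)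
      (assumption | erule bspec spec; assumption?)+
  show ?thesis by (rule one_cocycle_Div)
qed

end
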